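(* For every positive integer $n$, $$\begin{aligned} W_{1,28}(n) ={}&\tfrac{1}{2400}\sigma_{3}(n) + \tfrac{1}{800}\sigma_{3}(\tfrac{n}{2}) + \tfrac{1}{150}\sigma_{3}(\tfrac{n}{4}) + \tfrac{49}{2400}\sigma_{3}(\tfrac{n}{7}) + \tfrac{49}{800}\sigma_{3}(\tfrac{n}{14}) + \tfrac{49}{150}\sigma_{3}(\tfrac{n}{28})\\ &+ \left(\tfrac{1}{24}-\tfrac{n}{112}\right)\sigma(n) + \left(\tfrac{1}{24}-\tfrac{n}{4}\right)\sigma(\tfrac{n}{28}) + \tfrac{1121}{67200}c_{1}(n) + \tfrac{2389}{22400}c_{2}(n) - \tfrac{1}{128}c_{3}(n)\\ &- \tfrac{3349}{67200}c_{4}(n) - \tfrac{101}{200}c_{5}(n) - \tfrac{17}{40}c_{6}(n) + \tfrac{13}{200}c_{7}(n) - \tfrac{433}{150}c_{8}(n) - \tfrac{254}{75}c_{9}(n), \end{aligned}$$ $$\begin{aligned} W_{4,7}(n) ={}&\tfrac{1}{2400}\sigma_{3}(n) + \tfrac{1}{800}\sigma_{3}(\tfrac{n}{2}) + \tfrac{1}{150}\sigma_{3}(\tfrac{n}{4}) + \tfrac{49}{2400}\sigma_{3}(\tfrac{n}{7}) + \tfrac{49}{800}\sigma_{3}(\tfrac{n}{14}) + \tfrac{49}{150}\sigma_{3}(\tfrac{n}{28})\\ &+ \left(\tfrac{1}{24}-\tfrac{n}{28}\right)\sigma(\tfrac{n}{4}) + \left(\tfrac{1}{24}-\tfrac{n}{16}\right)\sigma(\tfrac{n}{7})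 + \tfrac{697}{470400}c_{1}(n) + \tfrac{139}{22400}c_{2}(n) - \tfrac{9}{896}c_{3}(n)\\ &- \tfrac{893}{470400}c_{4}(n) + \tfrac{43}{1400}c_{5}(n) - \tfrac{7}{40}c_{6}(n) + \tfrac{241}{1400}c_{7}(n) - \tfrac{881}{1050}c_{8}(n) - \tfrac{178}{525}c_{9}(n), \end{aligned}$$ $$\begin{aligned} W_{1,14}(n) ={}&\tfrac{1}{600}\sigma_3(n) + \tfrac{1}{150}\sigma_3(\tfrac{n}{2}) + \tfrac{49}{600}\sigma_3(\tfrac{n}{7}) + \tfrac{49}{150}\sigma_3(\tfrac{n}{14}) + \left(\tfrac{1}{24}-\tfrac{n}{56}\right)\sigma(n)\\ &+ \left(\tfrac{1}{24}-\tfrac{n}{4}\right)\sigma(\tfrac{n}{14}) + \tfrac{2}{175}c_2(n) - \tfrac{1}{600}c_3(n) - \tfrac{107}{4200}c_4(n), \end{aligned}$$ $$\begin{aligned} W_{2,7}(n) ={}&\tfrac{1}{600}\sigma_3(n) + \tfrac{1}{150}\sigma_3(\tfrac{n}{2}) + \tfrac{49}{600}\sigma_3(\tfrac{n}{7}) + \tfrac{49}{150}\sigma_3(\tfrac{n}{14}) + \left(\tfrac{1}{24}-\tfrac{n}{28}\right)\sigma(\tfrac{n}{2})\\ &+ \left(\tfrac{1}{24}-\tfrac{n}{8}\right)\sigma(\tfrac{n}{7}) + \tfrac{2}{175}c_2(n) - \tfrac{107}{4200}c_3(n) - \tfrac{1}{600}c_4(n), \end{aligned}$$ $$\begin{aligned}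 W_{1,7}(n) ={}&\tfrac{1}{120}\sigma_3(n) + \tfrac{49}{120}\sigma_3(\tfrac{n}{7}) + \left(\tfrac{1}{24}-\tfrac{n}{28}\right)\sigma(n) + \left(\tfrac{1}{24}-\tfrac{n}{4}\right)\sigma(\tfrac{n}{7}) - \tfrac{1}{70}c_1(n) - \tfrac{2}{35}c_2(n). \end{aligned}$$
   Context: For $k,n\in\mathbb{N}=\{1,2,3,\dots\}$, $\sigma_k(n)=\sum_{d\mid n}d^k$ (sum over positive divisors), $\sigma=\sigma_1$, and $\sigma_k(x)=0$ if $x\notin\mathbb{N}$. For $a,b\in\mathbb{N}$ with $a\le b$, the convolution sum is $$W_{a,b}(n)=\sum_{(l,m)\in\mathbb{N}^2,\ al+bm=n}\sigma(l)\sigma(m).$$ Let $q=e^{2\pi i z}$ with $\mathrm{Im}(z)>0$ and let $\eta(z)=q^{1/24}\prod_{n\ge1}(1-q^n)$ be the Dedekind eta function. Define $$C_1(q)=\frac{\eta^5(z)\eta^5(7z)}{\eta(2z)\eta(14z)},\quad C_2(q)=\eta^2(z)\eta^2(2z)\eta^2(7z)\eta^2(14z),\quad C_3(q)=\frac{\eta^6(z)\eta^6(14z)}{\eta^2(2z)\eta^2(7z)},$$ $$C_4(q)=\frac{\eta^6(2z)\eta^6(7z)}{\eta^2(z)\eta^2(14z)},\quad C_5(q)=\eta^2(4z)\eta^4(14z)\eta^2(28z),\quad C_6(q)=\frac{\eta^6(2z)\eta^6(28z)}{\eta^2(4z)\eta^2(14z)},$$ $$C_7(q)=\frac{\eta^4(2z)\eta^6(28z)}{\eta^2(4z)},\quad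 C_8(q)=\frac{\eta(z)\eta(2z)\eta(7z)\eta^8(28z)}{\eta^3(14z)},\quad C_9(q)=\frac{\eta(2z)\eta(4z)\eta^9(28z)}{\eta^3(14z)},$$ and integers $c_r(n)$ ($n\in\mathbb{N}$, $1\le r\le 9$) by $C_r(q)=\sum_{n=1}^\infty c_r(n)q^n$. *)

theory Defs
  imports "HOL-Analysis.Analysis"
begin

definition divisor_sigma :: "nat \<Rightarrow> real \<Rightarrow> nat" where
  "divisor_sigma k x =
     (if x \<in> \<nat> \<and> x > 0 then \<Sum>d | d dvd nat \<lfloor>x\<rfloor>. d ^ k else 0)"

definition W :: "nat \<Rightarrow> nat \<Rightarrow> nat \<Rightarrow> nat" where
  "W a b n = (\<Sum>(l, m) \<in> {(l, m). l > 0 \<and> m > 0 \<and> a * l + b * m = n}.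
     divisor_sigma 1 (real l) * divisor_sigma 1 (real m))"

definition nome :: "complex \<Rightarrow> complex" where
  "nome z = exp (2 * of_real pi * \<i> * z)"

(* nome (z / 24) is the branch exp (2 pi i z / 24) of q^(1/24). *)
definition dedekind_eta :: "complex \<Rightarrow> complex" where
  "dedekind_eta z = nome (z / 24) * (\<Prod>n. 1 - nome z ^ Suc n)"

definition C1 :: "complex \<Rightarrow> complex" where
  "C1 z = dedekind_eta z ^ 5 * dedekind_eta (7 * z) ^ 5 /
     (dedekind_eta (2 * z) * dedekind_eta (14 * z))"

definition C2 :: "complex \<Rightarrow> complex" where
  "C2 z = dedekind_eta z ^ 2 * dedekind_eta (2 * z) ^ 2 *
     dedekind_eta (7 * z) ^ 2 * dedekind_eta (14 * z) ^ 2"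

definition C3 :: "complex \<Rightarrow> complex" where
  "C3 z = dedekind_eta z ^ 6 * dedekind_eta (14 * z) ^ 6 /
     (dedekind_eta (2 * z) ^ 2 * dedekind_eta (7 * z) ^ 2)"

definition C4 :: "complex \<Rightarrow> complex" where
  "C4 z = dedekind_eta (2 * z) ^ 6 * dedekind_eta (7 * z) ^ 6 /
     (dedekind_eta z ^ 2 * dedekind_eta (14 * z) ^ 2)"

definition C5 :: "complex \<Rightarrow> complex" where
  "C5 z = dedekind_eta (4 * z) ^ 2 * dedekind_eta (14 * z) ^ 4 * dedekind_eta (28 * z) ^ 2"

definition C6 :: "complex \<Rightarrow> complex" where
  "C6 z = dedekind_eta (2 * z) ^ 6 * dedekind_eta (28 * z) ^ 6 /
     (dedekind_eta (4 * z) ^ 2 * dedekind_eta (14 * z) ^ 2)"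

definition C7 :: "complex \<Rightarrow> complex" where
  "C7 z = dedekind_eta (2 * z) ^ 4 * dedekind_eta (28 * z) ^ 6 / dedekind_eta (4 * z) ^ 2"

definition C8 :: "complex \<Rightarrow> complex" where
  "C8 z = dedekind_eta z * dedekind_eta (2 * z) * dedekind_eta (7 * z) *
     dedekind_eta (28 * z) ^ 8 / dedekind_eta (14 * z) ^ 3"

definition C9 :: "complex \<Rightarrow> complex" where
  "C9 z = dedekind_eta (2 * z) * dedekind_eta (4 * z) * dedekind_eta (28 * z) ^ 9 /
     dedekind_eta (14 * z) ^ 3"

(* The integer sequence c(1), c(2), ... with f(z) = sum over n >= 1 of c(n) q^n on the whole
   upper half-plane; it is unique if it exists, the irrelevant value c(0) being fixed as 0. *)
definition q_coeff :: "(complex \<Rightarrow> complex) \<Rightarrow> nat \<Rightarrow> int" where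
  "q_coeff f = (THE c. c 0 = 0 \<and>
     (\<forall>z. Im z > 0 \<longrightarrow> (\<lambda>n. of_int (c (Suc n)) * nome z ^ Suc n) sums f z))"

end

theory Submission
  imports Defs "HOL-Complex_Analysis.Complex_Analysis"
begin

unbundle no vec_syntax

text \<open>
  Write \<open>D = q d/dq\<close>. Ramanujan's differential equations for the Eisenstein series \<open>P, Q, R\<close>
  follow from a combinatorial bijection. At level 14 the two quadratic relations between the
  weight 2 Eisenstein series \<open>A, B, C\<close> and the cusp form \<open>H = \<eta>(z)\<eta>(2z)\<eta>(7z)\<eta>(14z)\<close>, and the
  expressions of \<open>Q(q\<^sup>d)\<close> and \<open>R(q\<^sup>d)\<close>, \<open>d | 14\<close>, as polynomials in \<open>A, B, C, H\<close>, can be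
  guessed from \<open>q\<close>-expansions. By Ramanujan's equations the defects of these ten guesses satisfy a
  homogeneous linear system \<open>D Y = M Y\<close> of power series, so they vanish once finitely many of
  their coefficients do; no theory of modular forms is needed. At level 28 the remaining relations
  come from separating even and odd powers of \<open>q\<close> and from cancelling in the integral domain of
  power series. An eta quotient has a logarithmic derivative that is linear in the \<open>P(q\<^sup>d)\<close>, so it
  equals a given quadratic polynomial in the weight 2 forms as soon as that polynomial satisfies
  the same equation \<open>D Y = L Y\<close> and one coefficient agrees. The convolution sums then become
  polynomial identities.
\<close>

section \<open>Convolutions of divisor functions\<close>

text \<open>Ramanujan's equations do not stay among the weight 2 forms: \<open>D\<close> of a
  combination of the \<open>P(q^d)\<close> involves the \<open>Q(q^d)\<close>, their derivatives
  involve the \<open>R(q^d)\<close>, and those involve the squares of the \<open>Q(q^d)\<close>. The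
  system closes only when all eight \<open>Q\<close> and \<open>R\<close> are replaced by
  polynomials in \<open>A\<close>, \<open>B\<close>, \<open>C\<close>, \<open>H\<close>, and then
  only modulo the two relations between these. Hence ten guesses have to be proved at the same time.
  The coefficient of \<open>q^n\<close> in \<open>D Y = M Y\<close> reads
  \<open>(n - M(0)) y_n = 0\<close> once the earlier coefficients vanish, so the eigenvalues of one
  constant matrix bound what must be computed. The terms \<open>n sigma(n)\<close> of the final
  formulas come from the quasimodularity of \<open>P\<close>: in \<open>P(q^a) P(q^b)\<close> the
  nonmodular part is removed by completing a square, which costs the derivatives of both factors.
  Rational coefficients are cleared beforehand, because the identities are checked by ring
  arithmetic with integer numerals; factors such as 576, 1008 or 336 are common denominators,
  cancelled at the end. Analysis is confined to identifying the formal eta quotients with functions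
  on the upper half-plane.\<close>

definition quads :: "nat \<Rightarrow> (nat \<times> nat \<times> nat \<times> nat) set" where
  "quads n = {(a, b, x, y). 0 < a \<and> 0 < b \<and> 0 < x \<and> 0 < y \<and> a * x + b * y =
    n}"

lemma finite_quads [simp]: "finite (quads n)"
proof (rule finite_subset)
  show "quads n \<subseteq> {..n} \<times> {..n} \<times> {..n} \<times> {..n}"
  proof (clarsimp simp: quads_def)
    fix a b x y :: nat
    assume "0 < a" "0 < b" "0 < x" "0 < y"
    then have "a * 1 \<le> a * x" "1 * x \<le> a * x" "b * 1 \<le> b * y" "1 * y \<le> b * y"
      by (intro mult_le_mono; simp)+
    then show "a \<le> a*x + b*y \<and> b \<le> a*x + b*y \<and> x \<le> a*x + b*y
      \<and> y \<le> a*x + b*y"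
      by linarith
  qed
qed simp

text \<open>Skoruppa's device: \<open>(a, b, x, y) \<mapsto> (a - b, b, x, x + y)\<close> maps the solutions of
  \<open>a x + b y = n\<close> with \<open>a > b\<close> bijectively to those with \<open>x < y\<close>.\<close>

lemma quads_descent:
  fixes g h :: "nat \<Rightarrow> nat \<Rightarrow> real"
  assumes g: "\<And>a b. g a b = g b a" and h: "\<And>a b. h a b = h b a"
    and hg: "\<And>a b. h (a + b) b = g a b"
  shows "(\<Sum>(a, b, x, y)\<in>quads n. g a b - h a b) =
         (\<Sum>(a, b, x, y)\<in>{(a, b, x, y)\<in>quads n. x = y}. g a b) -
         (\<Sum>(a, b, x, y)\<in>{(a, b, x, y)\<in>quads n. a = b}. h a b)"
proof -
  let ?G = "\<lambda>(a, b, x :: nat, y :: nat). g a b" and ?H =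
    "\<lambda>(a, b, x :: nat, y :: nat). h a b"
  let ?xl = "{(a, b, x, y)\<in>quads n. x < y}" and ?xg = "{(a, b, x, y)\<in>quads n. y < x}"
  let ?al = "{(a, b, x, y)\<in>quads n. a < b}" and ?ag = "{(a, b, x, y)\<in>quads n. b < a}"
  let ?xe = "{(a, b, x, y)\<in>quads n. x = y}" and ?ae = "{(a, b, x, y)\<in>quads n. a = b}"
  have fin: "finite {(a, b, x, y)\<in>quads n. P a b x y}" for P
    by (rule finite_subset[OF _ finite_quads[of n]]) auto
  have qx: "quads n = ?xl \<union> (?xg \<union> ?xe)" and qa: "quads n =
    ?al \<union> (?ag \<union> ?ae)"
    by auto
  have "sum ?G (quads n) = sum ?G ?xl + sum ?G (?xg \<union> ?xe)"
    by (subst qx, rule sum.union_disjoint) (use fin in auto)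
  also have "sum ?G (?xg \<union> ?xe) = sum ?G ?xg + sum ?G ?xe"
    by (rule sum.union_disjoint) (use fin in auto)
  finally have G: "sum ?G (quads n) = sum ?G ?xl + (sum ?G ?xg + sum ?G ?xe)" .
  have "sum ?H (quads n) = sum ?H ?al + sum ?H (?ag \<union> ?ae)"
    by (subst qa, rule sum.union_disjoint) (use fin in auto)
  also have "sum ?H (?ag \<union> ?ae) = sum ?H ?ag + sum ?H ?ae"
    by (rule sum.union_disjoint) (use fin in auto)
  finally have H: "sum ?H (quads n) = sum ?H ?al + (sum ?H ?ag + sum ?H ?ae)" .
  \<comment> \<open>Interchanging the two summands of \<open>a x + b y\<close> identifies the
    off-diagonal halves, so each sum is twice one half plus its diagonal. The descent then matches a
    half for \<open>g\<close> with a half for \<open>h\<close>.\<close>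
  have Gs: "sum ?G ?xg = sum ?G ?xl"
    by (rule sum.reindex_bij_witness[where i = "\<lambda>(a, b, x, y). (b, a, y, x)"
          and j = "\<lambda>(a, b, x, y). (b, a, y, x)"]) (auto simp: quads_def g add.commute)
  have Hs: "sum ?H ?al = sum ?H ?ag"
    by (rule sum.reindex_bij_witness[where i = "\<lambda>(a, b, x, y). (b, a, y, x)"
          and j = "\<lambda>(a, b, x, y). (b, a, y, x)"]) (auto simp: quads_def h add.commute)
  have GH: "sum ?H ?ag = sum ?G ?xl"
  proof (rule sum.reindex_bij_witness[where i = "\<lambda>(a, b, x, y). (a + b, b, x, y - x)"
          and j = "\<lambda>(a, b, x, y). (a - b, b, x, x + y)"])
    fix q assume "q \<in> ?ag"
    then obtain a b x y where q: "q = (a, b, x, y)" "0 < a" "0 < b" "0 < x" "0 < y"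
      "a * x + b * y = n" "b < a" by (auto simp: quads_def)
    then obtain c where c: "a = c + b" "c > 0" by (metis add.commute less_imp_add_positive)
    show "(case q of (a, b, x, y) \<Rightarrow> (a - b, b, x, x + y)) \<in> ?xl"
      using q c by (auto simp: quads_def algebra_simps)
    show "(case case q of (a, b, x, y) \<Rightarrow> (a - b, b, x, x
      + y) of (a, b, x, y) \<Rightarrow> (a + b, b, x, y - x)) = q"
      using q by simp
    show "?G (case q of (a, b, x, y) \<Rightarrow> (a - b, b, x, x + y)) = ?H q"
      using q c by (simp add: hg)
  next
    fix q assume "q \<in> ?xl"
    then obtain a b x y where q: "q = (a, b, x, y)" "0 < a" "0 < b" "0 < x" "0 < y"
      "a * x + b * y = n" "x < y" by (auto simp: quads_def)
    then obtain z where z: "y = x + z" "z > 0" by (metis less_imp_add_positive)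
    show "(case q of (a, b, x, y) \<Rightarrow> (a + b, b, x, y - x)) \<in> ?ag"
      using q z by (auto simp: quads_def algebra_simps)
    show "(case case q of (a, b, x, y) \<Rightarrow> (a + b, b, x, y
      - x) of (a, b, x, y) \<Rightarrow> (a - b, b, x, x + y)) = q"
      using q by simp
  qed
  have "(\<Sum>(a, b, x, y)\<in>quads n. g a b - h a b) = sum ?G (quads n) - sum ?H (quads n)"
    by (simp add: sum_subtractf[symmetric] case_prod_unfold)
  then show ?thesis using G H Gs Hs GH by simp
qed

text \<open>With \<open>x = y\<close> the equation becomes \<open>(a + b) x = n\<close>:
  \<open>d = a + b\<close> is a divisor of \<open>n\<close>, and \<open>a\<close> is free in
  \<open>0 < a < d\<close>.\<close>

lemma quads_sum_eq_xy:
  fixes g :: "nat \<Rightarrow> nat \<Rightarrow> real"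
  assumes "n > 0"
  shows "(\<Sum>(a, b, x, y)\<in>{(a, b, x, y)\<in>quads n. x = y}. g a b) =
         (\<Sum>d | d dvd n. \<Sum>a\<in>{1..<d}. g a (d - a))"
proof -
  have "(\<Sum>d | d dvd n. \<Sum>a\<in>{1..<d}. g a (d - a)) =
        (\<Sum>(d, a)\<in>Sigma {d. d dvd n} (\<lambda>d. {1..<d}). g a (d - a))"
    using assms by (subst sum.Sigma) auto
  also have "\<dots> = (\<Sum>(a, b, x, y)\<in>{(a, b, x, y)\<in>quads n. x = y}. g a b)"
  proof (rule sum.reindex_bij_witness[where i = "\<lambda>(a, b, x, y). (a + b, a)"
          and j = "\<lambda>(d, a). (a, d - a, n div d, n div d)"])
    fix q assume "q \<in> Sigma {d. d dvd n} (\<lambda>d. {1..<d})"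
    then obtain d a where q: "q = (d, a)" "d dvd n" "1 \<le> a" "a < d" by auto
    then obtain x where x: "n = d * x" by auto
    have "x > 0" using assms x by (auto intro!: Nat.gr0I)
    have "a * x + (d - a) * x = n" using q x by (simp flip: add_mult_distrib)
    then show "(case q of (d, a) \<Rightarrow> (a, d
      - a, n div d, n div d)) \<in> {(a, b, x, y)\<in>quads n. x = y}"
      using q x \<open>x > 0\<close> by (auto simp: quads_def)
    show "(case case q of (d, a) \<Rightarrow> (a, d
      - a, n div d, n div d) of (a, b, x, y) \<Rightarrow> (a + b, a)) = q"
      using q by simp
  qed (auto simp: quads_def simp flip: add_mult_distrib)
  finally show ?thesis ..
qed

text \<open>With \<open>a = b = d\<close> the equation becomes \<open>d (x + y) = n\<close>, which
  leaves \<open>n / d - 1\<close> choices for \<open>x\<close>.\<close>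

lemma quads_sum_eq_ab:
  fixes h :: "nat \<Rightarrow> nat \<Rightarrow> real"
  assumes "n > 0"
  shows "(\<Sum>(a, b, x, y)\<in>{(a, b, x, y)\<in>quads n. a = b}. h a b) =
         (\<Sum>d | d dvd n. h d d * (real n / real d - 1))"
proof -
  have "(\<Sum>(a, b, x, y)\<in>{(a, b, x, y)\<in>quads n. a = b}. h a b) =
        (\<Sum>(d, x)\<in>Sigma {d. d dvd n} (\<lambda>d. {1..<n div d}). h d d)"
  proof (rule sum.reindex_bij_witness[where j = "\<lambda>(a, b, x, y). (a, x)"
          and i = "\<lambda>(d, x). (d, d, x, n div d - x)"])
    fix q assume "q \<in> Sigma {d. d dvd n} (\<lambda>d. {1..<n div d})"
    then obtain d x where q: "q = (d, x)" "d dvd n" "1 \<le> x" "x < n div d" by auto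
    then obtain y where y: "n = d * y" by auto
    have "d > 0" using assms y by (auto intro!: Nat.gr0I)
    then have "x < y" using q y by simp
    then have "d * x + d * (y - x) = n" using y by (simp flip: add_mult_distrib2)
    then show "(case q of (d, x) \<Rightarrow> (d, d, x, n div d
      - x)) \<in> {(a, b, x, y)\<in>quads n. a = b}"
      using q y \<open>d > 0\<close> by (auto simp: quads_def)
  qed (auto simp: quads_def simp flip: add_mult_distrib2)
  also have "\<dots> = (\<Sum>d | d dvd n. \<Sum>x\<in>{1..<n div d}. h d d)"
    using assms by (subst sum.Sigma) auto
  also have "\<dots> = (\<Sum>d | d dvd n. h d d * (real n / real d - 1))"
  proof (rule sum.cong)
    fix d assume "d \<in> {d. d dvd n}"
    then obtain y where y: "n = d * y" by auto
    with assms have "d > 0" "y > 0" by (auto intro!: Nat.gr0I)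
    then show "(\<Sum>x\<in>{1..<n div d}. h d d) = h d d * (real n / real d - 1)"
      using y by (simp add: of_nat_diff)
  qed simp
  finally show ?thesis .
qed

text \<open>In the applications \<open>h a b\<close> is the polynomial \<open>g a b\<close> with
  \<open>b\<close> replaced by \<open>- b\<close>. The difference then keeps only the monomials that
  are odd in both variables, and these are the ones that occur in products of two \<open>eis\<close>
  series of odd index.\<close>

lemma quads_identity:
  fixes g h :: "nat \<Rightarrow> nat \<Rightarrow> real"
  assumes "n > 0" and "\<And>a b. g a b = g b a" and "\<And>a b. h a b = h b a"
    and "\<And>a b. h (a + b) b = g a b"
  shows "(\<Sum>(a, b, x, y)\<in>quads n. g a b - h a b) =
         (\<Sum>d | d dvd n. (\<Sum>a\<in>{1..<d}. g a (d - a)) - h d d * (real n / real d - 1))"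
  using quads_descent[OF assms(2-4)] quads_sum_eq_xy[OF assms(1)] quads_sum_eq_ab[OF assms(1)]
  by (simp add: sum_subtractf)

definition eis :: "nat \<Rightarrow> real fps" where
  "eis k = Abs_fps (\<lambda>n. \<Sum>d | d dvd n. real d ^ k)"

text \<open>The set of divisors of 0 is infinite, so the constant coefficient is the junk value 0.\<close>

lemma eis_nth_0 [simp]: "eis k $ 0 = 0"
  by (simp add: eis_def)

lemma eis_nth: "eis k $ n = (\<Sum>d | d dvd n. real d ^ k)"
  by (simp add: eis_def)

text \<open>A divisor \<open>a\<close> of \<open>i\<close> and a divisor \<open>b\<close> of
  \<open>n - i\<close> form, together with their codivisors \<open>x\<close> and \<open>y\<close>, a
  solution of \<open>a x + b y = n\<close>. The indices \<open>i = 0\<close> and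
  \<open>i = n\<close> drop out because the constant coefficients are 0.\<close>

lemma eis_mult_nth:
  "(eis j * eis k) $ n = (\<Sum>(a, b, x, y)\<in>quads n. real a ^ j * real b ^ k)"
proof -
  have "(eis j * eis k) $ n = (\<Sum>i\<in>{0<..<n}. eis j $ i * eis k $ (n - i))"
    unfolding fps_mult_nth by (rule sum.mono_neutral_right) (auto simp: not_less)
  also have "\<dots> = (\<Sum>i\<in>{0<..<n}. \<Sum>(a, b)\<in>{a. a dvd i} \<times> {b. b dvd n
    - i}. real a ^ j * real b ^ k)"
    by (simp add: eis_nth sum_product sum.cartesian_product)
  also have "\<dots> = (\<Sum>(i, a, b)\<in>Sigma {0<..<n} (\<lambda>i. {a. a dvd i} \<times> {b.
    b dvd n - i}). real a ^ j * real b ^ k)"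
    by (subst sum.Sigma) (auto intro!: finite_cartesian_product)
  also have "\<dots> = (\<Sum>(a, b, x, y)\<in>quads n. real a ^ j * real b ^ k)"
  proof (rule sum.reindex_bij_witness[where i = "\<lambda>(a, b, x, y). (a * x, a, b)"
          and j = "\<lambda>(i, a, b). (a, b, i div a, (n - i) div b)"])
    fix q assume "q \<in> Sigma {0<..<n} (\<lambda>i. {a. a dvd i} \<times> {b. b dvd n - i})"
    then obtain i a b where q: "q = (i, a, b)" "0 < i" "i < n" "a dvd i" "b dvd n - i" by auto
    then obtain x y where xy: "i = a * x" "n - i = b * y" by (auto elim!: dvdE)
    with q have "a > 0" "b > 0" "x > 0" "y > 0" by (auto intro!: Nat.gr0I)
    moreover have "a * x + b * y = n" using xy q by simp
    ultimately show "(case q of (i, a, b) \<Rightarrow> (a, b, i div a, (n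
      - i) div b)) \<in> quads n"
      using q xy by (auto simp: quads_def)
    show "(case case q of (i, a, b) \<Rightarrow> (a, b, i div a, (n - i) div b) of
       (a, b, x, y) \<Rightarrow> (a * x, a, b)) = q" using q by simp
  next
    fix q assume "q \<in> quads n"
    then obtain a b x y where q: "q = (a, b, x, y)" "0 < a" "0 < b" "0 < x" "0 < y"
      "a * x + b * y = n" by (auto simp: quads_def)
    then have "n - a * x = b * y" "0 < a * x" "0 < b * y" by auto
    with q show "(case q of (a, b, x, y) \<Rightarrow> (a * x, a, b)) \<in>
      Sigma {0<..<n} (\<lambda>i. {a. a dvd i} \<times> {b. b dvd n - i})"
      and "(case case q of (a, b, x, y) \<Rightarrow> (a * x, a, b) of
         (i, a, b) \<Rightarrow> (a, b, i div a, (n - i) div b)) = q" by auto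
  qed auto
  finally show ?thesis .
qed

lemma sum_1_lessThan: "(\<Sum>a\<in>{1..<d}. f a) = (\<Sum>a<d. f a)
  - (f 0 :: real)" if "d > 0" for d :: nat
proof -
  have "{..<d} = insert 0 {1..<d}" using that by auto
  then show ?thesis by simp
qed

text \<open>Keeping the upper limit \<open>m\<close> independent of \<open>D\<close> is what allows
  induction on \<open>m\<close>; both become the divisor \<open>d\<close> afterwards.\<close>

lemma sum_quadratic_1:
  "6 * (\<Sum>a<m. D\<^sup>2 - D * real a + (real a)\<^sup>2) =
     6*D\<^sup>2*real m + 3*D*real m - 3*D*real m^2 + real m - 3*real m^2 + 2*real m^3"
  by (induction m) (simp, simp only: sum.lessThan_Suc of_nat_Suc, algebra)

lemma sum_quadratic_2:
  "30 * (\<Sum>a<m. (D\<^sup>2 - D * real a + (real a)\<^sup>2) ^ 2) =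
     - 15*D*real m^2 + 30*D*real m^3 - 15*D*real m^4 + 15*D^2*real m - 45*D^2*real m^2
       + 30*D^2*real m^3 + 30*D^3*real m
     - 30*D^3*real m^2 + 30*D^4*real m - 1*real m + 10*real m^3 - 15*real m^4 + 6*real m^5"
  by (induction m) (simp, simp only: sum.lessThan_Suc of_nat_Suc, algebra)

lemma sum_quadratic_3:
  "420 * (\<Sum>a<m. (D\<^sup>2 - D * real a + (real a)\<^sup>2) ^ 3) =
     105*D*real m^2 - 525*D*real m^4 + 630*D*real m^5 - 210*D*real m^6 - 84*D^2*real m
       + 840*D^2*real m^3 - 1260*D^2*real m^4
     + 504*D^2*real m^5 - 735*D^3*real m^2 + 1470*D^3*real m^3 - 735*D^3*real m^4
       + 420*D^4*real m - 1260*D^4*real m^2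
     + 840*D^4*real m^3 + 630*D^5*real m - 630*D^5*real m^2 + 420*D^6*real m + 10*real m
       - 70*real m^3 + 210*real m^5 - 210*real m^6 + 60*real m^7"
  by (induction m) (simp, simp only: sum.lessThan_Suc of_nat_Suc, algebra)

lemma sum_quartic:
  "30 * (\<Sum>a<m. (real a)\<^sup>2 * (D - real a)\<^sup>2 * D\<^sup>2) =
     - 1*D^2*real m + 10*D^2*real m^3 - 15*D^2*real m^4 + 6*D^2*real m^5 - 15*D^3*real m^2
       + 30*D^3*real m^3 - 15*D^3*real m^4
     + 5*D^4*real m - 15*D^4*real m^2 + 10*D^4*real m^3"
  by (induction m) (simp, simp only: sum.lessThan_Suc of_nat_Suc, algebra)

text \<open>The form \<open>a^2 - a b + b^2\<close> becomes \<open>a^2 + a b + b^2\<close> when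
  \<open>a\<close> is replaced by \<open>a + b\<close>, as the descent requires. For
  \<open>k = 1, 2, 3\<close> the difference of the powers is \<open>2 a b\<close>,
  \<open>4 (a^3 b + a b^3)\<close> and \<open>6 (a^5 b + a b^5) + 14 a^3 b^3\<close>. The term
  \<open>a = 0\<close> of the inner sum on the right equals \<open>d^(2k)\<close> and absorbs the
  \<open>- 1\<close> of \<open>n / d - 1\<close>.\<close>

lemma quads_identity_quadratic:
  assumes "n > 0"
  shows "(\<Sum>(a, b, x, y)\<in>quads n. ((real a)\<^sup>2 + real a * real b
    + (real b)\<^sup>2) ^ k -
            ((real a)\<^sup>2 - real a * real b + (real b)\<^sup>2) ^ k) =
         (\<Sum>d | d dvd n. (\<Sum>a<d. ((real d)\<^sup>2 - real d * real a
           + (real a)\<^sup>2) ^ k)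
            - ((real d)\<^sup>2) ^ k * (real n / real d))"
proof -
  have eq: "(\<Sum>a\<in>{1..<d}. ((real a)\<^sup>2 + real a * real (d - a) + (real (d
    - a))\<^sup>2) ^ k) =
     (\<Sum>a<d. ((real d)\<^sup>2 - real d * real a + (real a)\<^sup>2) ^ k)
       - ((real d)\<^sup>2) ^ k" if "d dvd n" for d
  proof -
    have "d > 0" using that assms by (auto intro!: Nat.gr0I)
    have "(\<Sum>a\<in>{1..<d}. ((real a)\<^sup>2 + real a * real (d - a) + (real (d
      - a))\<^sup>2) ^ k) =
          (\<Sum>a\<in>{1..<d}. ((real d)\<^sup>2 - real d * real a + (real a)\<^sup>2) ^ k)"
      by (rule sum.cong) (auto simp: of_nat_diff power2_eq_square algebra_simps)
    then show ?thesis using \<open>d > 0\<close> by (simp only: sum_1_lessThan) simp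
  qed
  have "(\<Sum>(a, b, x, y)\<in>quads n. ((real a)\<^sup>2 + real a * real b
    + (real b)\<^sup>2) ^ k -
            ((real a)\<^sup>2 - real a * real b + (real b)\<^sup>2) ^ k) =
         (\<Sum>d | d dvd n. (\<Sum>a\<in>{1..<d}. ((real a)\<^sup>2 + real a * real (d - a)
           + (real (d - a))\<^sup>2) ^ k)
            - ((real d)\<^sup>2 - real d * real d + (real d)\<^sup>2) ^ k * (real n / real d
              - 1))"
    by (rule quads_identity[OF assms]) (simp_all add: power2_eq_square algebra_simps)
  also have "\<dots> = (\<Sum>d | d dvd n. (\<Sum>a<d. ((real d)\<^sup>2 - real d * real a
    + (real a)\<^sup>2) ^ k)
            - ((real d)\<^sup>2) ^ k * (real n / real d))"
    by (rule sum.cong) (simp_all only: eq mem_Collect_eq, simp add: power2_eq_square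
      algebra_simps)
  finally show ?thesis .
qed

section \<open>The level 1 convolutions of weight 4, 6 and 8\<close>

lemma eis_convolution_1_1:
  "12 * (eis 1 * eis 1) = 5 * eis 3 + eis 1 - 6 * fps_XD (eis 1)"
proof (rule fps_ext)
  fix n
  show "(12 * (eis 1 * eis 1)) $ n = (5 * eis 3 + eis 1 - 6 * fps_XD (eis 1)) $ n"
  proof (cases "n > 0")
    case True
    have "12 * (\<Sum>(a, b, x, y)\<in>quads n. real a ^ 1 * real b ^ 1) =
      6 * (\<Sum>(a, b, x, y)\<in>quads n. ((real a)\<^sup>2 + real a * real b
        + (real b)\<^sup>2) ^ 1 -
            ((real a)\<^sup>2 - real a * real b + (real b)\<^sup>2) ^ 1)"
      unfolding sum_distrib_left by (rule sum.cong) (auto simp: algebra_simps)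
    also have "\<dots> = (\<Sum>d | d dvd n. 6 * ((\<Sum>a<d. ((real d)\<^sup>2
      - real d * real a + (real a)\<^sup>2))
            - (real d)\<^sup>2 * (real n / real d)))"
      unfolding quads_identity_quadratic[OF True] by (simp add: sum_distrib_left)
    also have "\<dots> = (\<Sum>d | d dvd n. 5 * real d ^ 3 + real d ^ 1
      - 6 * (real n * real d ^ 1))"
    proof (rule sum.cong)
      fix d assume "d \<in> {d. d dvd n}"
      with True have "d > 0" by (auto intro!: Nat.gr0I)
      then show "6 * ((\<Sum>a<d. ((real d)\<^sup>2 - real d * real a + (real a)\<^sup>2))
        - (real d)\<^sup>2 * (real n / real d)) =
        5 * real d ^ 3 + real d ^ 1 - 6 * (real n * real d ^ 1)"
        using sum_quadratic_1[of "real d" d]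
        by (simp add: right_diff_distrib) (simp add: field_simps eval_nat_numeral)
    qed simp
    also have "\<dots> = 5 * eis 3 $ n + eis 1 $ n - 6 * (real n * eis 1 $ n)"
      by (simp add: eis_nth sum.distrib sum_subtractf sum_distrib_left)
    finally show ?thesis
      unfolding eis_mult_nth[symmetric] by (simp add: numeral_fps_const)
  qed (simp add: numeral_fps_const)
qed

lemma eis_convolution_1_3:
  "240 * (eis 1 * eis 3) = 21 * eis 5 + 10 * eis 3 - eis 1 - 30 * fps_XD (eis 3)"
proof (rule fps_ext)
  fix n
  show "(240 * (eis 1 * eis 3)) $ n = (21 * eis 5 + 10 * eis 3 - eis 1 - 30 * fps_XD (eis 3)) $ n"
  proof (cases "n > 0")
    case True
    have "120 * (\<Sum>(a, b, x, y)\<in>quads n. real a ^ 1 * real b ^ 3)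
        + 120 * (\<Sum>(a, b, x, y)\<in>quads n. real a ^ 3 * real b ^ 1) =
      30 * (\<Sum>(a, b, x, y)\<in>quads n. ((real a)\<^sup>2 + real a * real b
        + (real b)\<^sup>2) ^ 2 -
            ((real a)\<^sup>2 - real a * real b + (real b)\<^sup>2) ^ 2)"
      unfolding sum_distrib_left sum.distrib[symmetric]
      by (rule sum.cong) (auto simp: algebra_simps eval_nat_numeral)
    also have "\<dots> = (\<Sum>d | d dvd n. 30 * ((\<Sum>a<d. ((real d)\<^sup>2
      - real d * real a + (real a)\<^sup>2) ^ 2)
            - ((real d)\<^sup>2) ^ 2 * (real n / real d)))"
      unfolding quads_identity_quadratic[OF True] by (simp add: sum_distrib_left)
    also have "\<dots> = (\<Sum>d | d dvd n. 21 * real d ^ 5 + 10 * real d ^ 3 - real d ^ 1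
      - 30 * (real n * real d ^ 3))"
    proof (rule sum.cong)
      fix d assume "d \<in> {d. d dvd n}"
      with True have "d > 0" by (auto intro!: Nat.gr0I)
      then show "30 * ((\<Sum>a<d. ((real d)\<^sup>2 - real d * real a + (real a)\<^sup>2) ^ 2)
        - ((real d)\<^sup>2) ^ 2 * (real n / real d)) =
        21 * real d ^ 5 + 10 * real d ^ 3 - real d ^ 1 - 30 * (real n * real d ^ 3)"
        using sum_quadratic_2[of "real d" d]
        by (simp add: right_diff_distrib) (simp add: field_simps eval_nat_numeral)
    qed simp
    also have "\<dots> = 21 * eis 5 $ n + 10 * eis 3 $ n - eis 1 $ n - 30 * (real n * eis 3 $ n)"
      by (simp add: eis_nth sum.distrib sum_subtractf sum_distrib_left)
    finally have "120 * ((eis 1 * eis 3) $ n) + 120 * ((eis 3 * eis 1) $ n) =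
        21 * eis 5 $ n + 10 * eis 3 $ n - eis 1 $ n - 30 * (real n * eis 3 $ n)"
      unfolding eis_mult_nth[symmetric] .
    then show ?thesis
      by (simp add: numeral_fps_const mult.commute[of "eis 3" "eis 1"] del: One_nat_def)
  qed (simp add: numeral_fps_const)
qed

text \<open>This is \<open>Q^2 = E_8\<close>. The invariant polynomial is now
  \<open>(a b (a + b))^2\<close>, where \<open>g - h\<close> is \<open>4 a^3 b^3\<close>; its
  partner \<open>h\<close> vanishes for \<open>a = b\<close>, so no derivative term arises.\<close>

lemma eis_convolution_3_3: "120 * (eis 3 * eis 3) = eis 7 - eis 3"
proof (rule fps_ext)
  fix n
  show "(120 * (eis 3 * eis 3)) $ n = (eis 7 - eis 3) $ n"
  proof (cases "n > 0")
    case True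
    define g where "g = (\<lambda>a b. (real a)\<^sup>2 * (real b)\<^sup>2 * (real a
      + real b)\<^sup>2)"
    define h where "h = (\<lambda>a b. (real a)\<^sup>2 * (real b)\<^sup>2 * (real a
      - real b)\<^sup>2)"
    have "120 * (\<Sum>(a, b, x, y)\<in>quads n. real a ^ 3 * real b ^ 3) =
      30 * (\<Sum>(a, b, x, y)\<in>quads n. g a b - h a b)"
      unfolding sum_distrib_left g_def h_def
      by (rule sum.cong) (auto simp: algebra_simps eval_nat_numeral)
    also have "\<dots> = 30 * (\<Sum>d | d dvd n. (\<Sum>a\<in>{1..<d}. g a (d - a))
      - h d d * (real n / real d - 1))"
      by (subst quads_identity[OF True]) (simp_all add: g_def h_def power2_eq_square
        algebra_simps)
    also have "\<dots> = (\<Sum>d | d dvd n. 30 * (\<Sum>a\<in>{1..<d}. g a (d - a)))"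
      by (simp add: sum_distrib_left h_def)
    also have "\<dots> = (\<Sum>d | d dvd n. real d ^ 7 - real d ^ 3)"
    proof (rule sum.cong)
      fix d assume "d \<in> {d. d dvd n}"
      with True have "d > 0" by (auto intro!: Nat.gr0I)
      have "(\<Sum>a\<in>{1..<d}. g a (d - a)) = (\<Sum>a\<in>{1..<d}. (real a)\<^sup>2 * (real d
        - real a)\<^sup>2 * (real d)\<^sup>2)"
        by (rule sum.cong) (auto simp: g_def of_nat_diff)
      also have "\<dots> = (\<Sum>a<d. (real a)\<^sup>2 * (real d
        - real a)\<^sup>2 * (real d)\<^sup>2)"
        using \<open>d > 0\<close> by (simp only: sum_1_lessThan) simp
      finally show "30 * (\<Sum>a\<in>{1..<d}. g a (d - a)) = real d ^ 7 - real d ^ 3"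
        using sum_quartic[where D = "real d" and m =
          d] by (simp add: eval_nat_numeral algebra_simps)
    qed simp
    also have "\<dots> = eis 7 $ n - eis 3 $ n"
      by (simp add: eis_nth sum_subtractf)
    finally show ?thesis
      unfolding eis_mult_nth[symmetric] by (simp add: numeral_fps_const)
  qed (simp add: numeral_fps_const)
qed

lemma eis_convolution_1_5:
  "5040 * (eis 1 * eis 5) + 5880 * (eis 3 * eis 3) =
     249 * eis 7 + 210 * eis 5 - 49 * eis 3 + 10 * eis 1 - 420 * fps_XD (eis 5)"
proof (rule fps_ext)
  fix n
  show "(5040 * (eis 1 * eis 5) + 5880 * (eis 3 * eis 3)) $ n =
     (249 * eis 7 + 210 * eis 5 - 49 * eis 3 + 10 * eis 1 - 420 * fps_XD (eis 5)) $ n"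
  proof (cases "n > 0")
    case True
    have "2520 * (\<Sum>(a, b, x, y)\<in>quads n. real a ^ 1 * real b ^ 5)
        + 2520 * (\<Sum>(a, b, x, y)\<in>quads n. real a ^ 5 * real b ^ 1)
        + 5880 * (\<Sum>(a, b, x, y)\<in>quads n. real a ^ 3 * real b ^ 3) =
      420 * (\<Sum>(a, b, x, y)\<in>quads n. ((real a)\<^sup>2 + real a * real b
        + (real b)\<^sup>2) ^ 3 -
            ((real a)\<^sup>2 - real a * real b + (real b)\<^sup>2) ^ 3)"
      unfolding sum_distrib_left sum.distrib[symmetric]
      by (rule sum.cong) (auto simp: algebra_simps eval_nat_numeral)
    also have "\<dots> = (\<Sum>d | d dvd n. 420 * ((\<Sum>a<d. ((real d)\<^sup>2
      - real d * real a + (real a)\<^sup>2) ^ 3)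
            - ((real d)\<^sup>2) ^ 3 * (real n / real d)))"
      unfolding quads_identity_quadratic[OF True] by (simp add: sum_distrib_left)
    also have "\<dots> = (\<Sum>d | d dvd n. 249 * real d ^ 7 + 210 * real d ^ 5
      - 49 * real d ^ 3 + 10 * real d ^ 1
        - 420 * (real n * real d ^ 5))"
    proof (rule sum.cong)
      fix d assume "d \<in> {d. d dvd n}"
      with True have "d > 0" by (auto intro!: Nat.gr0I)
      then show "420 * ((\<Sum>a<d. ((real d)\<^sup>2 - real d * real a
        + (real a)\<^sup>2) ^ 3) - ((real d)\<^sup>2) ^ 3 * (real n / real d)) =
        249*real d^7 + 210*real d^5 - 49*real d^3 + 10*real d^1 - 420*(real n*real d^5)"
        using sum_quadratic_3[of "real d" d]
        by (simp add: right_diff_distrib) (simp add: field_simps eval_nat_numeral)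
    qed simp
    also have "\<dots> = 249*eis 7 $ n + 210*eis 5 $ n - 49*eis 3 $ n + 10*eis 1 $ n
      - 420*(real n*eis 5 $ n)"
      by (simp add: eis_nth sum.distrib sum_subtractf sum_distrib_left)
    finally have "2520*((eis 1*eis 5) $ n) + 2520*((eis 5*eis 1) $ n) + 5880*((eis 3*eis 3) $ n) =
        249*eis 7 $ n + 210*eis 5 $ n - 49*eis 3 $ n + 10*eis 1 $ n - 420*(real n*eis 5 $ n)"
      unfolding eis_mult_nth[symmetric] .
    then show ?thesis
      by (simp add: numeral_fps_const mult.commute[of "eis 5" "eis 1"] del: One_nat_def)
  qed (simp add: numeral_fps_const)
qed

section \<open>Eisenstein series and the Euler product as formal power series\<close>

lemma fps_XD_mult: "fps_XD (f * g) = fps_XD f * g + f * fps_XD (g :: 'a::comm_ring_1 fps)"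
  by (simp add: fps_XD_def algebra_simps)

lemma fps_XD_diff: "fps_XD (f - g) = fps_XD f - fps_XD (g :: 'a::comm_ring_1 fps)"
  by (simp add: fps_XD_def algebra_simps)

lemma fps_XD_of_nat [simp]: "fps_XD (of_nat n :: 'a::comm_ring_1 fps) = 0"
  by (simp add: fps_XD_def fps_of_nat[symmetric])

lemma fps_XD_numeral [simp]: "fps_XD (numeral n :: 'a::comm_ring_1 fps) = 0"
  by (simp add: fps_XD_def numeral_fps_const)

lemma fps_XD_0 [simp]: "fps_XD (0 :: 'a::comm_ring_1 fps) = 0"
  and fps_XD_1 [simp]: "fps_XD (1 :: 'a::comm_ring_1 fps) = 0"
  by (simp_all add: fps_XD_def)

lemma fps_XD_uminus: "fps_XD (- f) = - fps_XD (f :: 'a::comm_ring_1 fps)"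
  by (simp add: fps_XD_def)

lemma fps_XD_power: "fps_XD (f ^ n) = of_nat n * f ^ (n - 1) * fps_XD (f :: 'a::comm_ring_1 fps)"
  by (simp add: fps_XD_def fps_deriv_power fps_of_nat algebra_simps)

lemma fps_XD_power2: "fps_XD (f ^ 2) = 2 * f * fps_XD (f :: 'a::comm_ring_1 fps)"
  by (simp add: fps_XD_power)

lemma fps_XD_power3: "fps_XD (f ^ 3) = 3 * f ^ 2 * fps_XD (f :: 'a::comm_ring_1 fps)"
  by (simp add: fps_XD_power)

lemma fps_XD_numeral_mult: "fps_XD (numeral n * f) =
  numeral n * fps_XD (f :: 'a::comm_ring_1 fps)"
  by (simp add: fps_XD_mult)

abbreviation dil :: "nat \<Rightarrow> 'a::comm_ring_1 fps \<Rightarrow> 'a fps" where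
  "dil d f \<equiv> f oo fps_X ^ d"

lemma dil_nth: "dil d f $ n = (if d dvd n then f $ (n div d) else 0)"
proof -
  have "dil d f $ n = (\<Sum>i = 0..n. f $ i * (fps_X ^ (d * i)) $ n)"
    unfolding fps_compose_def by (simp add: power_mult)
  also have "\<dots> = (\<Sum>i\<in>(if d dvd n then {n div d} else {}). f $ i * (fps_X ^ (d *
    i)) $ n)"
    by (intro sum.mono_neutral_right) (cases "d = 0"; auto)+
  also have "\<dots> = (if d dvd n then f $ (n div d) else 0)"
    by (cases "d = 0") auto
  finally show ?thesis .
qed

lemma dil_mult: "d > 0 \<Longrightarrow> dil d (f * g) = dil d f * dil d (g :: 'a::idom fps)"
  by (rule fps_compose_mult_distrib) simp

lemma dil_1 [simp]: "dil 1 f = f"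
  by simp

lemma dil_dil:
  assumes "d > 0" "e > 0"
  shows "dil d (dil e f) = dil (d * e) f"
proof (rule fps_ext)
  fix n
  show "dil d (dil e f) $ n = dil (d * e) f $ n"
  proof (cases "d dvd n")
    case True
    then obtain m where "n = d * m" by auto
    then show ?thesis using assms by (simp add: dil_nth)
  next
    case False
    then have "\<not> d * e dvd n" using dvd_mult_left by blast
    with False show ?thesis by (simp add: dil_nth)
  qed
qed

lemma fps_XD_dil: "fps_XD (dil d f) = of_nat d * dil d (fps_XD f)"
  by (rule fps_ext) (auto simp: dil_nth fps_of_nat[symmetric] algebra_simps elim!: dvdE)

text \<open>The normalisations \<open>2 d P(q\<^sup>d)\<close>, \<open>2 d\<^sup>2 Q(q\<^sup>d)\<close>, \<open>2 d\<^sup>3 R(q\<^sup>d)\<close> make Ramanujan's equations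
  independent of \<open>d\<close>.\<close>

definition ramT :: "nat \<Rightarrow> real fps" where
  "ramT d = 2 * of_nat d * (1 - 24 * dil d (eis 1))"

definition ramS :: "nat \<Rightarrow> real fps" where
  "ramS d = 2 * of_nat d ^ 2 * (1 + 240 * dil d (eis 3))"

definition ramU :: "nat \<Rightarrow> real fps" where
  "ramU d = 2 * of_nat d ^ 3 * (1 - 504 * dil d (eis 5))"

section \<open>Ramanujan's differential equations\<close>

lemma fps_numeral_mult_cancel:
  "numeral n * f = numeral n * (g :: real fps) \<Longrightarrow> f = g"
  by (simp add: numeral_fps_const)

lemma XD_eis_1: "6 * fps_XD (eis 1) = eis 1 - 12 * eis 1 ^ 2 + 5 * eis 3"
  using eis_convolution_1_1 by algebra

lemma XD_eis_3: "30 * fps_XD (eis 3) = 21 * eis 5 + 10 * eis 3 - eis 1 - 240 * eis 1 * eis 3"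
  using eis_convolution_1_3 by algebra

text \<open>\<open>eis 7\<close> is eliminated between the two convolutions of weight 8; this
  produces ten times the stated equation.\<close>

lemma XD_eis_5: "42*fps_XD (eis 5) = 20*eis 3 + 21*eis 5 + eis 1 - 504*eis 1*eis 5 + 2400*eis 3^2"
proof (rule fps_numeral_mult_cancel)
  show "10 * (42 * fps_XD (eis 5)) =
      10 * (20 * eis 3 + 21 * eis 5 + eis 1 - 504 * eis 1 * eis 5 + 2400 * eis 3 ^ 2)"
    using eis_convolution_1_5 eis_convolution_3_3 by algebra
qed

context
  fixes d :: nat
  assumes d: "d > 0"
begin

lemmas dil_distribs = fps_compose_add_distrib fps_compose_sub_distrib dil_mult[OF d]
  numeral_compose

text \<open>The constants of this and the next two equations come from
  \<open>12 D P = P^2 - Q\<close>, \<open>3 D Q = P Q - R\<close> and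
  \<open>2 D R = P R - Q^2\<close>. Dilation contributes a factor \<open>d\<close> to
  \<open>D\<close>, which the powers of \<open>d\<close> in the normalisation absorb.\<close>

lemma XD_ramT: "24 * fps_XD (ramT d) = ramT d ^ 2 - 2 * ramS d"
proof -
  have "dil d (6 * fps_XD (eis 1)) = dil d (eis 1 - 12 * (eis 1 * eis 1) + 5 * eis 3)"
    using XD_eis_1 by (simp only: power2_eq_square mult.assoc)
  then have *: "6 * dil d (fps_XD (eis 1)) = dil d (eis 1) - 12 * dil d (eis 1) ^ 2
    + 5 * dil d (eis 3)"
    by (simp only: dil_distribs power2_eq_square)
  have "fps_XD (ramT d) = 2 * of_nat d * (- 24 * (of_nat d * dil d (fps_XD (eis 1))))"
    by (simp add: ramT_def fps_XD_mult fps_XD_diff fps_XD_dil)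
  then show ?thesis using * unfolding ramT_def ramS_def by algebra
qed

lemma XD_ramS: "6 * fps_XD (ramS d) = ramT d * ramS d - 2 * ramU d"
proof -
  have "dil d (30 * fps_XD (eis 3)) = dil d (21 * eis 5 + 10 * eis 3 - eis 1
    - 240 * (eis 1 * eis 3))"
    using XD_eis_3 by (simp only: mult.assoc)
  then have *: "30 * dil d (fps_XD (eis 3)) = 21 * dil d (eis 5) + 10 * dil d (eis 3)
    - dil d (eis 1)
      - 240 * (dil d (eis 1) * dil d (eis 3))"
    by (simp only: dil_distribs)
  have "fps_XD (ramS d) = 2 * of_nat d ^ 2 * (240 * (of_nat d * dil d (fps_XD (eis 3))))"
    by (simp add: ramS_def fps_XD_mult fps_XD_power fps_XD_dil)
  then show ?thesis using * unfolding ramT_def ramS_def ramU_def by algebra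
qed

lemma XD_ramU: "4 * fps_XD (ramU d) = ramT d * ramU d - ramS d ^ 2"
proof -
  have "dil d (42 * fps_XD (eis 5)) = dil d (20 * eis 3 + 21 * eis 5 + eis 1
    - 504 * (eis 1 * eis 5)
      + 2400 * (eis 3 * eis 3))"
    using XD_eis_5 by (simp only: power2_eq_square mult.assoc)
  then have *: "42 * dil d (fps_XD (eis 5)) = 20 * dil d (eis 3) + 21 * dil d (eis 5)
    + dil d (eis 1)
      - 504 * (dil d (eis 1) * dil d (eis 5)) + 2400 * (dil d (eis 3) * dil d (eis 3))"
    by (simp only: dil_distribs)
  have "fps_XD (ramU d) = 2 * of_nat d ^ 3 * (- 504 * (of_nat d * dil d (fps_XD (eis 5))))"
    by (simp add: ramU_def fps_XD_mult fps_XD_power fps_XD_diff fps_XD_dil)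
  then show ?thesis using * unfolding ramT_def ramS_def ramU_def by algebra
qed

end

section \<open>The Euler product and its logarithmic derivative\<close>

definition euler :: "'a::comm_ring_1 fps" where
  "euler = Abs_fps (\<lambda>n. (\<Prod>k<n. 1 - fps_X ^ Suc k) $ n)"

text \<open>The factor with exponent \<open>N + 1\<close> changes no coefficient of order at most
  \<open>N\<close>. Each coefficient of the infinite product is therefore reached after finitely
  many factors, and \<open>euler\<close> needs no limit.\<close>

lemma fps_prod_one_minus_X_power_nth:
  "n \<le> N \<Longrightarrow> (\<Prod>k<N. 1 - fps_X ^ Suc k :: 'a::comm_ring_1 fps) $ n =
    euler $ n"
proof (induction N)
  case (Suc N)
  show ?case
  proof (cases "n = Suc N")
    case False
    with Suc have "n < Suc N" by simp
    then have "((\<Prod>k<N. 1 - fps_X ^ Suc k) * fps_X ^ Suc N :: 'a fps) $ n = 0"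
      unfolding fps_X_power_mult_right_nth by simp
    with Suc \<open>n < Suc N\<close> show ?thesis by (simp add: right_diff_distrib del:
      power_Suc)
  qed (simp add: euler_def)
qed (simp add: euler_def)

lemma euler_nth_0 [simp]: "euler $ 0 = 1"
  by (simp add: euler_def)

text \<open>The Lambert series \<open>(k+1) X^(k+1) / (1 - X^(k+1))\<close>, which is minus the
  logarithmic derivative of \<open>1 - X^(k+1)\<close>.\<close>

definition lambert_term :: "nat \<Rightarrow> real fps" where
  "lambert_term k = Abs_fps (\<lambda>n. if Suc k dvd n \<and> n > 0 then real (Suc k) else 0)"

lemma XD_one_minus_X_power:
  "fps_XD (1 - fps_X ^ Suc k) = - ((1 - fps_X ^ Suc k) * lambert_term k)"
proof (rule fps_ext)
  fix n
  have "((1 - fps_X ^ Suc k) * lambert_term k) $ n =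
      lambert_term k $ n - (if n < Suc k then 0 else lambert_term k $ (n - Suc k))"
    by (simp add: left_diff_distrib fps_X_power_mult_nth del: power_Suc)
  also have "\<dots> = (if n = Suc k then real (Suc k) else 0)"
    by (auto simp: lambert_term_def dvd_minus_self dest: dvd_imp_le)
  finally show "fps_XD (1 - fps_X ^ Suc k) $ n = (- ((1 - fps_X ^ Suc k) * lambert_term k)) $ n"
    by (simp del: power_Suc)
qed

text \<open>Adding the Lambert series of the factors collects in the coefficient of
  \<open>q^m\<close> all divisors of \<open>m\<close>. Since \<open>D\<close> preserves degrees, the
  coefficient \<open>n\<close> may be computed from the first \<open>n\<close> factors
  alone.\<close>

lemma XD_euler: "fps_XD euler = - euler * eis 1"
proof (rule fps_ext)
  fix n :: nat
  define P where "P = (\<lambda>N. \<Prod>k<N. 1 - fps_X ^ Suc k :: real fps)"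
  have P: "fps_XD (P N) = - P N * (\<Sum>k<N. lambert_term k)" for N
  proof (induction N)
    case (Suc N)
    have "fps_XD (P (Suc N)) = fps_XD (P N) * (1 - fps_X ^ Suc N) + P N * fps_XD (1
      - fps_X ^ Suc N)"
      by (simp add: P_def fps_XD_mult)
    also have "\<dots> = - P (Suc N) * (\<Sum>k<Suc N. lambert_term k)"
      unfolding Suc XD_one_minus_X_power by (simp add: P_def algebra_simps del: power_Suc)
    finally show ?case .
  qed (simp add: P_def)
  have s: "(\<Sum>k<n. lambert_term k) $ m = eis 1 $ m" if "m \<le> n" for m
  proof (cases "m = 0")
    case False
    have "(\<Sum>k<n. lambert_term k) $ m = (\<Sum>k<n. if Suc k dvd m then real (Suc k) else 0)"
      using False by (simp add: lambert_term_def fps_sum_nth)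
    also have "\<dots> = (\<Sum>d\<in>{1..n}. if d dvd m then real d else 0)"
      by (rule sum.reindex_bij_witness[where i = "\<lambda>d. d - 1" and j = Suc]) auto
    also have "\<dots> = (\<Sum>d\<in>{d\<in>{1..n}. d dvd m}. real d)"
      by (rule sum.inter_filter[symmetric]) simp
    also have "{d\<in>{1..n}. d dvd m} = {d. d dvd m}"
      using False that by (auto dest: dvd_imp_le intro!: Nat.gr0I Suc_leI)
    finally show ?thesis by (simp add: eis_nth)
  qed (simp add: lambert_term_def fps_sum_nth)
  have "fps_XD euler $ n = fps_XD (P n) $ n"
    by (simp add: P_def fps_prod_one_minus_X_power_nth del: power_Suc)
  also have "\<dots> = - (\<Sum>i = 0..n. euler $ i * eis 1 $ (n - i))"
    unfolding P by (simp add: fps_mult_nth s P_def fps_prod_one_minus_X_power_nth del: power_Suc)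
  also have "\<dots> = (- euler * eis 1) $ n"
    by (simp add: fps_mult_nth)
  finally show "fps_XD euler $ n = (- euler * eis 1) $ n" .
qed

section \<open>Level 14\<close>

text \<open>\<open>lvA\<close>, \<open>lvB\<close>, \<open>lvC\<close> are the combinations of \<open>d P(q\<^sup>d)\<close>, \<open>d | 14\<close>, with the three nontrivial
  sign patterns of the Atkin-Lehner involutions, \<open>lvP\<close> is the (quasimodular) one with trivial
  signs, and \<open>lvH\<close> is the newform of level 14. The sign symmetry explains the similarity of the
  four formulas for \<open>d = 1, 2, 7, 14\<close> below.\<close>

definition lvP :: "real fps" where
  "lvP = 1 - dil 1 (eis 1) - 2 * dil 2 (eis 1) - 7 * dil 7 (eis 1) - 14 * dil 14 (eis 1)"

definition lvA :: "real fps" where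
  "lvA = 1 + 3 * dil 1 (eis 1) - 6 * dil 2 (eis 1) + 21 * dil 7 (eis 1) - 42 * dil 14 (eis 1)"

definition lvB :: "real fps" where
  "lvB = 3 + 4 * dil 1 (eis 1) + 8 * dil 2 (eis 1) - 28 * dil 7 (eis 1) - 56 * dil 14 (eis 1)"

definition lvC :: "real fps" where
  "lvC = 1 - 4 * dil 1 (eis 1) + 8 * dil 2 (eis 1) + 28 * dil 7 (eis 1) - 56 * dil 14 (eis 1)"

definition lvH :: "real fps" where
  "lvH = fps_X * dil 1 euler * dil 2 euler * dil 7 euler * dil 14 euler"

lemma ramT_1: "ramT 1 = - 4 * lvA - 3 * lvB + 3 * lvC + 12 * lvP"
  by (simp only: ramT_def lvP_def lvA_def lvB_def lvC_def of_nat_1 of_nat_numeral) algebra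

lemma ramT_2: "ramT 2 = 4 * lvA - 3 * lvB - 3 * lvC + 12 * lvP"
  by (simp only: ramT_def lvP_def lvA_def lvB_def lvC_def of_nat_1 of_nat_numeral) algebra

lemma ramT_7: "ramT 7 = - 4 * lvA + 3 * lvB - 3 * lvC + 12 * lvP"
  by (simp only: ramT_def lvP_def lvA_def lvB_def lvC_def of_nat_1 of_nat_numeral) algebra

lemma ramT_14: "ramT 14 = 4 * lvA + 3 * lvB + 3 * lvC + 12 * lvP"
  by (simp only: ramT_def lvP_def lvA_def lvB_def lvC_def of_nat_1 of_nat_numeral) algebra

lemmas ramT_eqs = ramT_1 ramT_2 ramT_7 ramT_14

text \<open>The defects: each of the following ten series is zero, which is known only after
  the system of differential equations for them has been set up. The relations and the cofactors
  in the system were found by linear algebra on \<open>q\<close>-expansions.\<close>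

definition defX1 :: "real fps" where
  "defX1 = - 48 * lvA ^ 2 + 7 * lvB ^ 2 - 15 * lvC ^ 2 - 112 * lvH ^ 2"

definition defX2 :: "real fps" where
  "defX2 = - 3 * lvA ^ 2 + 14 * lvB * lvH + 3 * lvC ^ 2 + 7 * lvH ^ 2"

definition defG1 :: "real fps" where
  "defG1 = ramS 1 - (24*lvA*lvB - 120*lvA*lvC - 192*lvA*lvH + 80*lvA^2 - 25*lvB*lvC
    - 80*lvC*lvH + 45*lvC^2)"

definition defG2 :: "real fps" where
  "defG2 = ramS 2 - (- 24*lvA*lvB - 120*lvA*lvC + 192*lvA*lvH + 80*lvA^2 + 25*lvB*lvC
    + 80*lvC*lvH + 45*lvC^2)"

definition defG7 :: "real fps" where
  "defG7 = ramS 7 - (- 24*lvA*lvB + 120*lvA*lvC + 192*lvA*lvH + 80*lvA^2 - 25*lvB*lvC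
    - 80*lvC*lvH + 45*lvC^2)"

definition defG14 :: "real fps" where
  "defG14 = ramS 14 - (24*lvA*lvB + 120*lvA*lvC - 192*lvA*lvH + 80*lvA^2 + 25*lvB*lvC
    + 80*lvC*lvH + 45*lvC^2)"

definition defH1 :: "real fps" where
  "defH1 = ramU 1 - (516*lvA*lvB*lvC - 768*lvA*lvC*lvH - 756*lvA*lvC^2 + 1008*lvA^2*lvC
    - 448*lvA^3 - 513*lvB*lvC^2 + 4704*lvB*lvH^2 - 1176*lvB^2*lvH + 72*lvC^2*lvH + 189*lvC^3)"

definition defH2 :: "real fps" where
  "defH2 = ramU 2 - (516*lvA*lvB*lvC - 768*lvA*lvC*lvH + 756*lvA*lvC^2 - 1008*lvA^2*lvC
    + 448*lvA^3 - 513*lvB*lvC^2 + 4704*lvB*lvH^2 - 1176*lvB^2*lvH + 72*lvC^2*lvH - 189*lvC^3)"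

definition defH7 :: "real fps" where
  "defH7 = ramU 7 - (516*lvA*lvB*lvC - 768*lvA*lvC*lvH - 756*lvA*lvC^2 - 1008*lvA^2*lvC
    - 448*lvA^3 + 513*lvB*lvC^2 - 4704*lvB*lvH^2 + 1176*lvB^2*lvH - 72*lvC^2*lvH - 189*lvC^3)"

definition defH14 :: "real fps" where
  "defH14 = ramU 14 - (516*lvA*lvB*lvC - 768*lvA*lvC*lvH + 756*lvA*lvC^2 + 1008*lvA^2*lvC
    + 448*lvA^3 + 513*lvB*lvC^2 - 4704*lvB*lvH^2 + 1176*lvB^2*lvH - 72*lvC^2*lvH + 189*lvC^3)"

lemmas def_defs = defX1_def defX2_def defG1_def defG2_def defG7_def defG14_def defH1_def
  defH2_def defH7_def defH14_def

lemmas XD_simps = fps_XD_mult fps_XD_add fps_XD_diff fps_XD_uminus fps_XD_power2 fps_XD_power3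
  fps_XD_numeral
  fps_XD_0 fps_XD_1

lemma ramS_eqs:
"ramS 1 = defG1 + (24*lvA*lvB - 120*lvA*lvC - 192*lvA*lvH + 80*lvA^2 - 25*lvB*lvC - 80*lvC*lvH
  + 45*lvC^2)"
  "ramS 2 = defG2 + (- 24*lvA*lvB - 120*lvA*lvC + 192*lvA*lvH + 80*lvA^2 + 25*lvB*lvC
    + 80*lvC*lvH + 45*lvC^2)"
  "ramS 7 = defG7 + (- 24*lvA*lvB + 120*lvA*lvC + 192*lvA*lvH + 80*lvA^2 - 25*lvB*lvC
    - 80*lvC*lvH + 45*lvC^2)"
  "ramS 14 = defG14 + (24*lvA*lvB + 120*lvA*lvC - 192*lvA*lvH + 80*lvA^2 + 25*lvB*lvC
    + 80*lvC*lvH + 45*lvC^2)"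
  by (simp_all add: def_defs)

lemma ramU_eqs:
"ramU 1 = defH1 + (516*lvA*lvB*lvC - 768*lvA*lvC*lvH - 756*lvA*lvC^2 + 1008*lvA^2*lvC
  - 448*lvA^3 - 513*lvB*lvC^2 + 4704*lvB*lvH^2 - 1176*lvB^2*lvH + 72*lvC^2*lvH + 189*lvC^3)"
  "ramU 2 = defH2 + (516*lvA*lvB*lvC - 768*lvA*lvC*lvH + 756*lvA*lvC^2 - 1008*lvA^2*lvC
    + 448*lvA^3 - 513*lvB*lvC^2 + 4704*lvB*lvH^2 - 1176*lvB^2*lvH + 72*lvC^2*lvH - 189*lvC^3)"
  "ramU 7 = defH7 + (516*lvA*lvB*lvC - 768*lvA*lvC*lvH - 756*lvA*lvC^2 - 1008*lvA^2*lvC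
    - 448*lvA^3 + 513*lvB*lvC^2 - 4704*lvB*lvH^2 + 1176*lvB^2*lvH - 72*lvC^2*lvH - 189*lvC^3)"
  "ramU 14 = defH14 + (516*lvA*lvB*lvC - 768*lvA*lvC*lvH + 756*lvA*lvC^2 + 1008*lvA^2*lvC
    + 448*lvA^3 + 513*lvB*lvC^2 - 4704*lvB*lvH^2 + 1176*lvB^2*lvH - 72*lvC^2*lvH + 189*lvC^3)"
  by (simp_all add: def_defs)

section \<open>Derivatives of the level 14 generators up to defects\<close>

lemma XD_dil_euler: "d > 0 \<Longrightarrow> fps_XD (dil d euler) =
  - of_nat d * dil d euler * dil d (eis 1)"
  by (simp add: fps_XD_dil XD_euler dil_mult fps_compose_uminus)

text \<open>Logarithmic differentiation of the product: \<open>fps_X\<close> contributes 1 and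
  \<open>dil d euler\<close> contributes \<open>- d * dil d (eis 1)\<close>, which adds up to
  \<open>lvP\<close>.\<close>

lemma XD_lvH: "fps_XD lvH = lvP * lvH"
proof -
  have X: "fps_XD (fps_X :: real fps) = fps_X" by (simp add: fps_XD_def)
  show ?thesis
    unfolding lvH_def lvP_def by (simp only: XD_simps XD_dil_euler X zero_less_one
      zero_less_numeral
      of_nat_1 of_nat_numeral) algebra
qed

lemma XD_ramT_1: "24 * fps_XD (ramT 1) = ramT 1 ^ 2 - 2 * ramS 1"
  by (rule XD_ramT) simp

lemma XD_ramT_2: "24 * fps_XD (ramT 2) = ramT 2 ^ 2 - 2 * ramS 2"
  by (rule XD_ramT) simp

lemma XD_ramT_7: "24 * fps_XD (ramT 7) = ramT 7 ^ 2 - 2 * ramS 7"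
  by (rule XD_ramT) simp

lemma XD_ramT_14: "24 * fps_XD (ramT 14) = ramT 14 ^ 2 - 2 * ramS 14"
  by (rule XD_ramT) simp

text \<open>\<open>lvA\<close> is a combination of the \<open>ramT\<close>, whose derivatives bring
  in the \<open>ramS\<close>. Each \<open>ramS\<close> is traded for its guessed polynomial plus a
  defect. The factor 576 is a common denominator for all the generators.\<close>

lemma XD_lvA_576: "576*fps_XD lvA = 576*lvA*lvP - 192*lvB*lvC - 960*lvC*lvH + 3*defG1
  - 3*defG14 - 3*defG2 + 3*defG7"
  (is "_ = ?rhs")
proof -
  have "16 * lvA = - ramT 1 + ramT 14 + ramT 2 - ramT 7"
    unfolding ramT_eqs by algebra
  then have "fps_XD (16 * lvA) = fps_XD (- ramT 1 + ramT 14 + ramT 2 - ramT 7)"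
    by (rule arg_cong)
  then have *: "16 * fps_XD lvA = - fps_XD (ramT 1) + fps_XD (ramT 14) + fps_XD (ramT 2)
    - fps_XD (ramT 7)"
    by (simp only: fps_XD_numeral_mult fps_XD_add fps_XD_diff fps_XD_uminus)
  have "2 * (576 * fps_XD lvA) = 72 * (16 * fps_XD lvA)"
    by algebra
  also have "\<dots> = 3 * (0 - (24 * fps_XD (ramT 1)) + (24 * fps_XD (ramT 14))
    + (24 * fps_XD (ramT 2)) - (24 * fps_XD (ramT 7)))"
    unfolding * by algebra
  also have "\<dots> = 2 * ?rhs"
    unfolding XD_ramT_1 XD_ramT_2 XD_ramT_7 XD_ramT_14 unfolding ramT_eqs ramS_eqs by algebra
  finally show ?thesis by (rule fps_numeral_mult_cancel)
qed

lemma XD_lvB_576: "576*fps_XD lvB = - 1728*lvA*lvC + 576*lvB*lvP + 4*defG1 - 4*defG14 + 4*defG2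
  - 4*defG7"
  (is "_ = ?rhs")
proof -
  have "12 * lvB = - ramT 1 + ramT 14 - ramT 2 + ramT 7"
    unfolding ramT_eqs by algebra
  then have "fps_XD (12 * lvB) = fps_XD (- ramT 1 + ramT 14 - ramT 2 + ramT 7)"
    by (rule arg_cong)
  then have *: "12 * fps_XD lvB = - fps_XD (ramT 1) + fps_XD (ramT 14) - fps_XD (ramT 2)
    + fps_XD (ramT 7)"
    by (simp only: fps_XD_numeral_mult fps_XD_add fps_XD_diff fps_XD_uminus)
  have "2 * (576 * fps_XD lvB) = 96 * (12 * fps_XD lvB)"
    by algebra
  also have "\<dots> = 4 * (0 - (24 * fps_XD (ramT 1)) + (24 * fps_XD (ramT 14))
    - (24 * fps_XD (ramT 2)) + (24 * fps_XD (ramT 7)))"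
    unfolding * by algebra
  also have "\<dots> = 2 * ?rhs"
    unfolding XD_ramT_1 XD_ramT_2 XD_ramT_7 XD_ramT_14 unfolding ramT_eqs ramS_eqs by algebra
  finally show ?thesis by (rule fps_numeral_mult_cancel)
qed

lemma XD_lvC_576: "576*fps_XD lvC = - 192*lvA*lvB + 3072*lvA*lvH + 576*lvC*lvP - 4*defG1
  - 4*defG14 + 4*defG2 + 4*defG7"
  (is "_ = ?rhs")
proof -
  have "12 * lvC = ramT 1 + ramT 14 - ramT 2 - ramT 7"
    unfolding ramT_eqs by algebra
  then have "fps_XD (12 * lvC) = fps_XD (ramT 1 + ramT 14 - ramT 2 - ramT 7)"
    by (rule arg_cong)
  then have *: "12 * fps_XD lvC = fps_XD (ramT 1) + fps_XD (ramT 14) - fps_XD (ramT 2)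
    - fps_XD (ramT 7)"
    by (simp only: fps_XD_numeral_mult fps_XD_add fps_XD_diff fps_XD_uminus)
  have "2 * (576 * fps_XD lvC) = 96 * (12 * fps_XD lvC)"
    by algebra
  also have "\<dots> = 4 * ((24 * fps_XD (ramT 1)) + (24 * fps_XD (ramT 14))
    - (24 * fps_XD (ramT 2)) - (24 * fps_XD (ramT 7)))"
    unfolding * by algebra
  also have "\<dots> = 2 * ?rhs"
    unfolding XD_ramT_1 XD_ramT_2 XD_ramT_7 XD_ramT_14 unfolding ramT_eqs ramS_eqs by algebra
  finally show ?thesis by (rule fps_numeral_mult_cancel)
qed

lemma XD_lvH_576: "576 * fps_XD lvH = 576 * lvH * lvP"
  unfolding XD_lvH by algebra

lemmas XD_576 = XD_lvA_576 XD_lvB_576 XD_lvC_576 XD_lvH_576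

section \<open>The linear system satisfied by the defects\<close>

lemma XD_ramS_1: "6 * fps_XD (ramS 1) = ramT 1 * ramS 1 - 2 * ramU 1"
  by (rule XD_ramS) simp

lemma XD_ramU_1: "4 * fps_XD (ramU 1) = ramT 1 * ramU 1 - ramS 1 ^ 2"
  by (rule XD_ramU) simp

lemma XD_ramS_2: "6 * fps_XD (ramS 2) = ramT 2 * ramS 2 - 2 * ramU 2"
  by (rule XD_ramS) simp

lemma XD_ramU_2: "4 * fps_XD (ramU 2) = ramT 2 * ramU 2 - ramS 2 ^ 2"
  by (rule XD_ramU) simp

lemma XD_ramS_7: "6 * fps_XD (ramS 7) = ramT 7 * ramS 7 - 2 * ramU 7"
  by (rule XD_ramS) simp

lemma XD_ramU_7: "4 * fps_XD (ramU 7) = ramT 7 * ramU 7 - ramS 7 ^ 2"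
  by (rule XD_ramU) simp

lemma XD_ramS_14: "6 * fps_XD (ramS 14) = ramT 14 * ramS 14 - 2 * ramU 14"
  by (rule XD_ramS) simp

lemma XD_ramU_14: "4 * fps_XD (ramU 14) = ramT 14 * ramU 14 - ramS 14 ^ 2"
  by (rule XD_ramU) simp

text \<open>The chain rule reduces the derivative to those of the generators, and what remains after
  inserting them lies in the ideal of the defects. \<open>lvP\<close> enters only as
  \<open>2 * lvP * defX1\<close>, because differentiation of a form of weight \<open>2k\<close>
  contributes \<open>k * lvP\<close>.\<close>

lemma XD_defX1:
  "72*fps_XD defX1 = (144*lvP)*defX1 + (- 36*lvA + 7*lvB + 15*lvC)*defG1 + (36*lvA + 7*lvB
    - 15*lvC)*defG2 + (- 36*lvA - 7*lvB - 15*lvC)*defG7 + (36*lvA - 7*lvB + 15*lvC)*defG14"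
  (is "_ = ?rhs")
proof -
  have d: "576*fps_XD defX1 = (- 96*lvA)*(576*fps_XD lvA) + (14*lvB)*(576*fps_XD lvB)
    + (- 30*lvC)*(576*fps_XD lvC) + (- 224*lvH)*(576*fps_XD lvH)"
    unfolding defX1_def by (simp only: XD_simps) algebra
  have "576 * (72 * fps_XD defX1) = 72 * (576 * fps_XD defX1)"
    by (rule mult.left_commute)
  also have "\<dots> = 576 * ?rhs"
    unfolding d XD_576  unfolding ramT_eqs ramU_eqs ramS_eqs unfolding defX1_def defX2_def by
      algebra
  finally show ?thesis by (rule fps_numeral_mult_cancel)
qed

lemma XD_defX2:
  "288*fps_XD defX2 = (576*lvP)*defX2 + (- 9*lvA - 12*lvC + 28*lvH)*defG1 + (9*lvA + 12*lvC
    + 28*lvH)*defG2 + (- 9*lvA + 12*lvC - 28*lvH)*defG7 + (9*lvA - 12*lvC - 28*lvH)*defG14"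
  (is "_ = ?rhs")
proof -
  have d: "576*fps_XD defX2 = (- 6*lvA)*(576*fps_XD lvA) + (14*lvH)*(576*fps_XD lvB)
    + (6*lvC)*(576*fps_XD lvC) + (14*lvB + 14*lvH)*(576*fps_XD lvH)"
    unfolding defX2_def by (simp only: XD_simps) algebra
  have "576 * (288 * fps_XD defX2) = 288 * (576 * fps_XD defX2)"
    by (rule mult.left_commute)
  also have "\<dots> = 576 * ?rhs"
    unfolding d XD_576  unfolding ramT_eqs ramU_eqs ramS_eqs unfolding defX1_def defX2_def by
      algebra
  finally show ?thesis by (rule fps_numeral_mult_cancel)
qed

text \<open>Differentiating \<open>ramS 1\<close> brings in \<open>- ramU 1 / 3\<close>, hence the
  cofactor \<open>- 336\<close> of \<open>defH1\<close> against 1008. The pure polynomial part is a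
  combination of the two quadratic relations.\<close>

lemma XD_defG1:
  "1008*fps_XD defG1 = (- 2928*lvA + 2952*lvC - 8064*lvH)*defX1 + (14592*lvA + 32256*lvB
    + 1152*lvC - 129024*lvH)*defX2 + (- 2520*lvA - 805*lvB + 1939*lvC + 448*lvH
    + 2016*lvP)*defG1 + (1512*lvA + 301*lvB - 1085*lvC - 448*lvH)*defG2 + (168*lvA + 49*lvB
    - 175*lvC + 1568*lvH)*defG7 + (168*lvA - 49*lvB - 175*lvC - 1568*lvH)*defG14 + (- 336)*defH1"
  (is "_ = ?rhs")
proof -
  have d: "576*fps_XD defG1 = 96*(6*fps_XD (ramS 1)) + (- 160*lvA - 24*lvB + 120*lvC
    + 192*lvH)*(576*fps_XD lvA) + (- 24*lvA + 25*lvC)*(576*fps_XD lvB) + (120*lvA + 25*lvB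
    - 90*lvC + 80*lvH)*(576*fps_XD lvC) + (192*lvA + 80*lvC)*(576*fps_XD lvH)"
    unfolding defG1_def by (simp only: XD_simps) algebra
  have "576 * (1008 * fps_XD defG1) = 1008 * (576 * fps_XD defG1)"
    by (rule mult.left_commute)
  also have "\<dots> = 576 * ?rhs"
    unfolding d XD_576 XD_ramS_1 unfolding ramT_eqs ramU_eqs ramS_eqs unfolding defX1_def
      defX2_def by algebra
  finally show ?thesis by (rule fps_numeral_mult_cancel)
qed

lemma XD_defG2:
  "1008*fps_XD defG2 = (2928*lvA - 2952*lvC - 8064*lvH)*defX1 + (- 14592*lvA + 32256*lvB
    - 1152*lvC - 129024*lvH)*defX2 + (- 1512*lvA + 301*lvB + 1085*lvC - 448*lvH)*defG1
    + (2520*lvA - 805*lvB - 1939*lvC + 448*lvH + 2016*lvP)*defG2 + (- 168*lvA - 49*lvB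
    + 175*lvC - 1568*lvH)*defG7 + (- 168*lvA + 49*lvB + 175*lvC + 1568*lvH)*defG14
    + (- 336)*defH2"
  (is "_ = ?rhs")
proof -
  have d: "576*fps_XD defG2 = 96*(6*fps_XD (ramS 2)) + (- 160*lvA + 24*lvB + 120*lvC
    - 192*lvH)*(576*fps_XD lvA) + (24*lvA - 25*lvC)*(576*fps_XD lvB) + (120*lvA - 25*lvB
    - 90*lvC - 80*lvH)*(576*fps_XD lvC) + (- 192*lvA - 80*lvC)*(576*fps_XD lvH)"
    unfolding defG2_def by (simp only: XD_simps) algebra
  have "576 * (1008 * fps_XD defG2) = 1008 * (576 * fps_XD defG2)"
    by (rule mult.left_commute)
  also have "\<dots> = 576 * ?rhs"
    unfolding d XD_576 XD_ramS_2 unfolding ramT_eqs ramU_eqs ramS_eqs unfolding defX1_def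
      defX2_def by algebra
  finally show ?thesis by (rule fps_numeral_mult_cancel)
qed

lemma XD_defG7:
  "1008*fps_XD defG7 = (- 2928*lvA - 2952*lvC + 8064*lvH)*defX1 + (14592*lvA - 32256*lvB
    - 1152*lvC + 129024*lvH)*defX2 + (168*lvA - 49*lvB + 175*lvC - 1568*lvH)*defG1 + (168*lvA
    + 49*lvB + 175*lvC + 1568*lvH)*defG2 + (- 2520*lvA + 805*lvB - 1939*lvC - 448*lvH
    + 2016*lvP)*defG7 + (1512*lvA - 301*lvB + 1085*lvC + 448*lvH)*defG14 + (- 336)*defH7"
  (is "_ = ?rhs")
proof -
  have d: "576*fps_XD defG7 = 96*(6*fps_XD (ramS 7)) + (- 160*lvA + 24*lvB - 120*lvC
    - 192*lvH)*(576*fps_XD lvA) + (24*lvA + 25*lvC)*(576*fps_XD lvB) + (- 120*lvA + 25*lvB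
    - 90*lvC + 80*lvH)*(576*fps_XD lvC) + (- 192*lvA + 80*lvC)*(576*fps_XD lvH)"
    unfolding defG7_def by (simp only: XD_simps) algebra
  have "576 * (1008 * fps_XD defG7) = 1008 * (576 * fps_XD defG7)"
    by (rule mult.left_commute)
  also have "\<dots> = 576 * ?rhs"
    unfolding d XD_576 XD_ramS_7 unfolding ramT_eqs ramU_eqs ramS_eqs unfolding defX1_def
      defX2_def by algebra
  finally show ?thesis by (rule fps_numeral_mult_cancel)
qed

lemma XD_defG14:
  "1008*fps_XD defG14 = (2928*lvA + 2952*lvC + 8064*lvH)*defX1 + (- 14592*lvA - 32256*lvB
    + 1152*lvC + 129024*lvH)*defX2 + (- 168*lvA + 49*lvB - 175*lvC + 1568*lvH)*defG1
    + (- 168*lvA - 49*lvB - 175*lvC - 1568*lvH)*defG2 + (- 1512*lvA - 301*lvB - 1085*lvC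
    + 448*lvH)*defG7 + (2520*lvA + 805*lvB + 1939*lvC - 448*lvH + 2016*lvP)*defG14
    + (- 336)*defH14"
  (is "_ = ?rhs")
proof -
  have d: "576*fps_XD defG14 = 96*(6*fps_XD (ramS 14)) + (- 160*lvA - 24*lvB - 120*lvC
    + 192*lvH)*(576*fps_XD lvA) + (- 24*lvA - 25*lvC)*(576*fps_XD lvB) + (- 120*lvA - 25*lvB
    - 90*lvC - 80*lvH)*(576*fps_XD lvC) + (192*lvA - 80*lvC)*(576*fps_XD lvH)"
    unfolding defG14_def by (simp only: XD_simps) algebra
  have "576 * (1008 * fps_XD defG14) = 1008 * (576 * fps_XD defG14)"
    by (rule mult.left_commute)
  also have "\<dots> = 576 * ?rhs"
    unfolding d XD_576 XD_ramS_14 unfolding ramT_eqs ramU_eqs ramS_eqs unfolding defX1_def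
      defX2_def by algebra
  finally show ?thesis by (rule fps_numeral_mult_cancel)
qed

text \<open>Ramanujan's third equation contains the square of \<open>ramS 1\<close>, which is
  \<open>ramS 1 * defG1\<close> plus its guess times \<open>ramS 1\<close>. This is why one cofactor
  contains \<open>ramS 1\<close> itself; it is still a known series, so the system stays linear in
  the defects.\<close>

lemma XD_defH1:
  "336*fps_XD defH1 = (- 20592*lvA*lvC - 8064*lvA*lvH + 11712*lvA^2 - 6048*lvB*lvH
    + 6048*lvC*lvH + 8856*lvC^2)*defX1 + (32256*lvA*lvB - 57600*lvA*lvC - 129024*lvA*lvH
    - 58368*lvA^2 - 24192*lvB*lvC - 96768*lvB*lvH + 24192*lvB^2 + 96768*lvC*lvH
    + 3456*lvC^2)*defX2 + (- 812*lvA*lvB + 1820*lvA*lvC + 14336*lvA*lvH - 2016*lvA^2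
    - 1197*lvB*lvC + 5488*lvB*lvH + 8400*lvC*lvH + 63*lvC^2 - 10976*lvH^2 - 84*ramS 1)*defG1
    + (- 1204*lvA*lvB + 5852*lvA*lvC + 1792*lvA*lvH - 4704*lvA^2 + 3297*lvB*lvC + 5488*lvB*lvH
    - 1680*lvC*lvH - 1449*lvC^2 - 10976*lvH^2)*defG2 + (- 1204*lvA*lvB + 1204*lvA*lvC
    + 1792*lvA*lvH + 1491*lvB*lvC - 5488*lvB*lvH + 1008*lvC*lvH - 1197*lvC^2
    + 10976*lvH^2)*defG7 + (1204*lvA*lvB + 1204*lvA*lvC - 1792*lvA*lvH - 1491*lvB*lvC
    - 5488*lvB*lvH - 1008*lvC*lvH - 1197*lvC^2 + 10976*lvH^2)*defG14 + (- 336*lvA - 252*lvB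
    + 252*lvC + 1008*lvP)*defH1"
  (is "_ = ?rhs")
proof -
  have d: "576*fps_XD defH1 = 144*(4*fps_XD (ramU 1)) + (- 2016*lvA*lvC + 1344*lvA^2
    - 516*lvB*lvC + 768*lvC*lvH + 756*lvC^2)*(576*fps_XD lvA) + (- 516*lvA*lvC + 2352*lvB*lvH
    + 513*lvC^2 - 4704*lvH^2)*(576*fps_XD lvB) + (- 516*lvA*lvB + 1512*lvA*lvC + 768*lvA*lvH
    - 1008*lvA^2 + 1026*lvB*lvC - 144*lvC*lvH - 567*lvC^2)*(576*fps_XD lvC) + (768*lvA*lvC
    - 9408*lvB*lvH + 1176*lvB^2 - 72*lvC^2)*(576*fps_XD lvH)"
    unfolding defH1_def by (simp only: XD_simps) algebra
  have "576 * (336 * fps_XD defH1) = 336 * (576 * fps_XD defH1)"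
    by (rule mult.left_commute)
  also have "\<dots> = 576 * ?rhs"
    unfolding d XD_576 XD_ramU_1 unfolding ramT_eqs ramU_eqs ramS_eqs unfolding defX1_def
      defX2_def by algebra
  finally show ?thesis by (rule fps_numeral_mult_cancel)
qed

lemma XD_defH2:
  "336*fps_XD defH2 = (- 20592*lvA*lvC + 8064*lvA*lvH + 11712*lvA^2 - 6048*lvB*lvH
    - 6048*lvC*lvH + 8856*lvC^2)*defX1 + (- 32256*lvA*lvB - 57600*lvA*lvC + 129024*lvA*lvH
    - 58368*lvA^2 + 24192*lvB*lvC - 96768*lvB*lvH + 24192*lvB^2 - 96768*lvC*lvH
    + 3456*lvC^2)*defX2 + (1204*lvA*lvB + 5852*lvA*lvC - 1792*lvA*lvH - 4704*lvA^2
    - 3297*lvB*lvC + 5488*lvB*lvH + 1680*lvC*lvH - 1449*lvC^2 - 10976*lvH^2)*defG1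
    + (812*lvA*lvB + 1820*lvA*lvC - 14336*lvA*lvH - 2016*lvA^2 + 1197*lvB*lvC + 5488*lvB*lvH
    - 8400*lvC*lvH + 63*lvC^2 - 10976*lvH^2 - 84*ramS 2)*defG2 + (- 1204*lvA*lvB + 1204*lvA*lvC
    + 1792*lvA*lvH + 1491*lvB*lvC - 5488*lvB*lvH + 1008*lvC*lvH - 1197*lvC^2
    + 10976*lvH^2)*defG7 + (1204*lvA*lvB + 1204*lvA*lvC - 1792*lvA*lvH - 1491*lvB*lvC
    - 5488*lvB*lvH - 1008*lvC*lvH - 1197*lvC^2 + 10976*lvH^2)*defG14 + (336*lvA - 252*lvB
    - 252*lvC + 1008*lvP)*defH2"
  (is "_ = ?rhs")
proof -
  have d: "576*fps_XD defH2 = 144*(4*fps_XD (ramU 2)) + (2016*lvA*lvC - 1344*lvA^2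
    - 516*lvB*lvC + 768*lvC*lvH - 756*lvC^2)*(576*fps_XD lvA) + (- 516*lvA*lvC + 2352*lvB*lvH
    + 513*lvC^2 - 4704*lvH^2)*(576*fps_XD lvB) + (- 516*lvA*lvB - 1512*lvA*lvC + 768*lvA*lvH
    + 1008*lvA^2 + 1026*lvB*lvC - 144*lvC*lvH + 567*lvC^2)*(576*fps_XD lvC) + (768*lvA*lvC
    - 9408*lvB*lvH + 1176*lvB^2 - 72*lvC^2)*(576*fps_XD lvH)"
    unfolding defH2_def by (simp only: XD_simps) algebra
  have "576 * (336 * fps_XD defH2) = 336 * (576 * fps_XD defH2)"
    by (rule mult.left_commute)
  also have "\<dots> = 576 * ?rhs"
    unfolding d XD_576 XD_ramU_2 unfolding ramT_eqs ramU_eqs ramS_eqs unfolding defX1_def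
      defX2_def by algebra
  finally show ?thesis by (rule fps_numeral_mult_cancel)
qed

lemma XD_defH7:
  "336*fps_XD defH7 = (20592*lvA*lvC + 8064*lvA*lvH + 11712*lvA^2 - 6048*lvB*lvH + 6048*lvC*lvH
    + 8856*lvC^2)*defX1 + (- 32256*lvA*lvB + 57600*lvA*lvC + 129024*lvA*lvH - 58368*lvA^2
    - 24192*lvB*lvC - 96768*lvB*lvH + 24192*lvB^2 + 96768*lvC*lvH + 3456*lvC^2)*defX2
    + (1204*lvA*lvB - 1204*lvA*lvC - 1792*lvA*lvH + 1491*lvB*lvC - 5488*lvB*lvH + 1008*lvC*lvH
    - 1197*lvC^2 + 10976*lvH^2)*defG1 + (- 1204*lvA*lvB - 1204*lvA*lvC + 1792*lvA*lvH
    - 1491*lvB*lvC - 5488*lvB*lvH - 1008*lvC*lvH - 1197*lvC^2 + 10976*lvH^2)*defG2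
    + (812*lvA*lvB - 1820*lvA*lvC - 14336*lvA*lvH - 2016*lvA^2 - 1197*lvB*lvC + 5488*lvB*lvH
    + 8400*lvC*lvH + 63*lvC^2 - 10976*lvH^2 - 84*ramS 7)*defG7 + (1204*lvA*lvB - 5852*lvA*lvC
    - 1792*lvA*lvH - 4704*lvA^2 + 3297*lvB*lvC + 5488*lvB*lvH - 1680*lvC*lvH - 1449*lvC^2
    - 10976*lvH^2)*defG14 + (- 336*lvA + 252*lvB - 252*lvC + 1008*lvP)*defH7"
  (is "_ = ?rhs")
proof -
  have d: "576*fps_XD defH7 = 144*(4*fps_XD (ramU 7)) + (2016*lvA*lvC + 1344*lvA^2
    - 516*lvB*lvC + 768*lvC*lvH + 756*lvC^2)*(576*fps_XD lvA) + (- 516*lvA*lvC - 2352*lvB*lvH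
    - 513*lvC^2 + 4704*lvH^2)*(576*fps_XD lvB) + (- 516*lvA*lvB + 1512*lvA*lvC + 768*lvA*lvH
    + 1008*lvA^2 - 1026*lvB*lvC + 144*lvC*lvH + 567*lvC^2)*(576*fps_XD lvC) + (768*lvA*lvC
    + 9408*lvB*lvH - 1176*lvB^2 + 72*lvC^2)*(576*fps_XD lvH)"
    unfolding defH7_def by (simp only: XD_simps) algebra
  have "576 * (336 * fps_XD defH7) = 336 * (576 * fps_XD defH7)"
    by (rule mult.left_commute)
  also have "\<dots> = 576 * ?rhs"
    unfolding d XD_576 XD_ramU_7 unfolding ramT_eqs ramU_eqs ramS_eqs unfolding defX1_def
      defX2_def by algebra
  finally show ?thesis by (rule fps_numeral_mult_cancel)
qed

lemma XD_defH14:
  "336*fps_XD defH14 = (20592*lvA*lvC - 8064*lvA*lvH + 11712*lvA^2 - 6048*lvB*lvH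
    - 6048*lvC*lvH + 8856*lvC^2)*defX1 + (32256*lvA*lvB + 57600*lvA*lvC - 129024*lvA*lvH
    - 58368*lvA^2 + 24192*lvB*lvC - 96768*lvB*lvH + 24192*lvB^2 - 96768*lvC*lvH
    + 3456*lvC^2)*defX2 + (1204*lvA*lvB - 1204*lvA*lvC - 1792*lvA*lvH + 1491*lvB*lvC
    - 5488*lvB*lvH + 1008*lvC*lvH - 1197*lvC^2 + 10976*lvH^2)*defG1 + (- 1204*lvA*lvB
    - 1204*lvA*lvC + 1792*lvA*lvH - 1491*lvB*lvC - 5488*lvB*lvH - 1008*lvC*lvH - 1197*lvC^2
    + 10976*lvH^2)*defG2 + (- 1204*lvA*lvB - 5852*lvA*lvC + 1792*lvA*lvH - 4704*lvA^2
    - 3297*lvB*lvC + 5488*lvB*lvH + 1680*lvC*lvH - 1449*lvC^2 - 10976*lvH^2)*defG7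
    + (- 812*lvA*lvB - 1820*lvA*lvC + 14336*lvA*lvH - 2016*lvA^2 + 1197*lvB*lvC + 5488*lvB*lvH
    - 8400*lvC*lvH + 63*lvC^2 - 10976*lvH^2 - 84*ramS 14)*defG14 + (336*lvA + 252*lvB + 252*lvC
    + 1008*lvP)*defH14"
  (is "_ = ?rhs")
proof -
  have d: "576*fps_XD defH14 = 144*(4*fps_XD (ramU 14)) + (- 2016*lvA*lvC - 1344*lvA^2
    - 516*lvB*lvC + 768*lvC*lvH - 756*lvC^2)*(576*fps_XD lvA) + (- 516*lvA*lvC - 2352*lvB*lvH
    - 513*lvC^2 + 4704*lvH^2)*(576*fps_XD lvB) + (- 516*lvA*lvB - 1512*lvA*lvC + 768*lvA*lvH
    - 1008*lvA^2 - 1026*lvB*lvC + 144*lvC*lvH - 567*lvC^2)*(576*fps_XD lvC) + (768*lvA*lvC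
    + 9408*lvB*lvH - 1176*lvB^2 + 72*lvC^2)*(576*fps_XD lvH)"
    unfolding defH14_def by (simp only: XD_simps) algebra
  have "576 * (336 * fps_XD defH14) = 336 * (576 * fps_XD defH14)"
    by (rule mult.left_commute)
  also have "\<dots> = 576 * ?rhs"
    unfolding d XD_576 XD_ramU_14 unfolding ramT_eqs ramU_eqs ramS_eqs unfolding defX1_def
      defX2_def by algebra
  finally show ?thesis by (rule fps_numeral_mult_cancel)
qed

text \<open>This turns the differential system into a recursion: as long as a defect has no earlier
  nonzero coefficient, only the constant term of its cofactor counts.\<close>

lemma fps_mult_nth_low:
  fixes f g :: "real fps"
  assumes "\<forall>j<n. g $ j = 0"
  shows "(f * g) $ n = f $ 0 * g $ n"
proof -
  have "(f * g) $ n = (\<Sum>i\<in>{0..n}. f $ i * g $ (n - i))" by (rule fps_mult_nth)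
  also have "\<dots> = (\<Sum>i\<in>{0}. f $ i * g $ (n - i))"
    by (rule sum.mono_neutral_right) (use assms in auto)
  finally show ?thesis by simp
qed

text \<open>Truncated power series with integer coefficients are represented by lists, on which
  polynomial expressions can be evaluated.\<close>

definition agrees :: "real fps \<Rightarrow> int list \<Rightarrow> bool" where
  "agrees f l \<longleftrightarrow> (\<forall>i<length l. f $ i = of_int (l ! i))"

definition lconv :: "int list \<Rightarrow> int list \<Rightarrow> int list" where
  "lconv l m = map (\<lambda>n. \<Sum>i\<leftarrow>[0..<Suc n]. l ! i * m ! (n
    - i)) [0..<min (length l) (length m)]"

lemma agrees_add: "agrees f l \<Longrightarrow> agrees g m \<Longrightarrow> agrees (f
  + g) (map2 (+) l m)"
  by (simp add: agrees_def)

lemma agrees_diff: "agrees f l \<Longrightarrow> agrees g m \<Longrightarrow> agrees (f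
  - g) (map2 (-) l m)"
  by (simp add: agrees_def)

lemma agrees_scale: "agrees f l \<Longrightarrow> agrees (numeral k * f) (map ((*) (numeral k))
  l)"
  by (simp add: agrees_def numeral_fps_const)

lemma agrees_1: "agrees 1 (1 # replicate N 0)"
  by (auto simp: agrees_def nth_Cons')

lemma agrees_numeral: "agrees (numeral k) (numeral k # replicate N 0)"
  by (auto simp: agrees_def nth_Cons' numeral_fps_const)

lemma agrees_mult:
  assumes "agrees f l" "agrees g m"
  shows "agrees (f * g) (lconv l m)"
  unfolding agrees_def
proof (intro allI impI)
  fix n assume "n < length (lconv l m)"
  then have n: "n < length l" "n < length m" by (auto simp: lconv_def)
  have "(f * g) $ n = (\<Sum>i\<in>{0..<Suc n}. of_int (l ! i) * of_int (m ! (n - i)))"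
    unfolding fps_mult_nth using n assms by (intro sum.cong) (auto simp: agrees_def)
  also have "\<dots> = of_int (\<Sum>i\<leftarrow>[0..<Suc n]. l ! i * m ! (n - i))"
    by (subst interv_sum_list_conv_sum_set_nat) simp
  finally show "(f * g) $ n = of_int (lconv l m ! n)" using n by (simp add: lconv_def)
qed

lemma agrees_eis:
  "agrees (eis k) (map (\<lambda>n. \<Sum>d\<leftarrow>filter (\<lambda>d. d dvd n) [1..<Suc n].
    int d ^ k) [0..<N])"
  unfolding agrees_def
proof (intro allI impI)
  fix n assume "n < length (map (\<lambda>n. \<Sum>d\<leftarrow>filter (\<lambda>d. d dvd n)
    [1..<Suc n]. int d ^ k) [0..<N])"
  then have n: "n < N" by simp
  have "(\<Sum>d\<leftarrow>filter (\<lambda>d. d dvd n) [1..<Suc n]. int d ^ k) =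
    (\<Sum>d\<in>{d\<in>{1..<Suc n}. d dvd n}. int d ^ k)"
    by (subst sum_list_distinct_conv_sum_set) (auto intro!: sum.cong)
  also have "real_of_int \<dots> = eis k $ n"
  proof (cases "n = 0")
    case False
    then have "{d\<in>{1..<Suc n}. d dvd n} = {d. d dvd n}"
      by (auto dest: dvd_imp_le intro!: Nat.gr0I Suc_leI simp: less_Suc_eq_le)
    then show ?thesis by (simp add: eis_nth)
  qed simp
  finally show "eis k $ n = of_int (map (\<lambda>n. \<Sum>d\<leftarrow>filter (\<lambda>d. d dvd
    n) [1..<Suc n]. int d ^ k) [0..<N] ! n)"
    using n by (simp del: upt_Suc)
qed

lemma agrees_dil:
  assumes "agrees f l" "d > 0"
  shows "agrees (dil d f) (map (\<lambda>n. if d dvd n then l ! (n div d) else 0) [0..<length l])"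
  using assms by (auto simp: agrees_def dil_nth elim!: dvdE) (metis le_less_trans mult_le_mono1
    One_nat_def Suc_leI nat_mult_1 nonzero_mult_div_cancel_left less_not_refl)

lemma agrees_X_mult: "agrees f l \<Longrightarrow> agrees (fps_X * f) (0 # l)"
  by (auto simp: agrees_def nth_Cons' fps_X_mult_nth)

definition leuler :: "nat \<Rightarrow> nat \<Rightarrow> int list" where
  "leuler N K = foldl (\<lambda>l k. map (\<lambda>n. l ! n - (if n < Suc k then 0 else l ! (n
    - Suc k))) [0..<Suc N])
     (1 # replicate N 0) [0..<K]"

lemma agrees_prod_one_minus_X_power:
  "agrees (\<Prod>k<K. 1 - fps_X ^ Suc k) (leuler N K) \<and> length (leuler N K) = Suc N"
proof (induction K)
  case 0
  then show ?case using agrees_1[of N] by (simp add: leuler_def)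
next
  case (Suc K)
  have "leuler N (Suc K) =
      map (\<lambda>n. leuler N K ! n - (if n < Suc K then 0 else leuler N K ! (n
        - Suc K))) [0..<Suc N]"
    by (simp add: leuler_def)
  then show ?case using Suc
    by (auto simp: agrees_def right_diff_distrib fps_X_power_mult_right_nth simp del: power_Suc
      upt_Suc)
qed

lemma agrees_euler: "agrees euler (leuler N N)"
  using agrees_prod_one_minus_X_power[of N N]
  by (auto simp: agrees_def fps_prod_one_minus_X_power_nth less_Suc_eq_le simp del: power_Suc)

text \<open>Separates two tasks: the introduction rules build an unevaluated list from the shape of
  the series, and its equality with the literal list is then left to evaluation.\<close>

lemma agrees_cong: "agrees f l \<Longrightarrow> l = m \<Longrightarrow> agrees f m"
  by simp

section \<open>Coefficients of order less than 15 of the generators and the defects\<close>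

lemma prefix_eis_1: "agrees (eis 1) [0, 1, 3, 4, 7, 6, 12, 8, 15, 13, 18, 12, 28, 14, 24]"
  by (rule agrees_cong[OF agrees_eis[of 1 15]]) code_simp

lemma prefix_eis_1_1: "agrees (dil 1 (eis 1)) [0, 1, 3, 4, 7, 6, 12, 8, 15, 13, 18, 12, 28, 14,
  24]"
  by (rule agrees_cong[OF agrees_dil[OF prefix_eis_1]]) (simp, code_simp)

lemma prefix_eis_1_2: "agrees (dil 2 (eis 1)) [0, 0, 1, 0, 3, 0, 4, 0, 7, 0, 6, 0, 12, 0, 8]"
  by (rule agrees_cong[OF agrees_dil[OF prefix_eis_1]]) (simp, code_simp)

lemma prefix_eis_1_7: "agrees (dil 7 (eis 1)) [0, 0, 0, 0, 0, 0, 0, 1, 0, 0, 0, 0, 0, 0, 3]"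
  by (rule agrees_cong[OF agrees_dil[OF prefix_eis_1]]) (simp, code_simp)

lemma prefix_eis_1_14: "agrees (dil 14 (eis 1)) [0, 0, 0, 0, 0, 0, 0, 0, 0, 0, 0, 0, 0, 0, 1]"
  by (rule agrees_cong[OF agrees_dil[OF prefix_eis_1]]) (simp, code_simp)

lemma prefix_eis_3: "agrees (eis 3) [0, 1, 9, 28, 73, 126, 252, 344, 585, 757, 1134, 1332, 2044,
  2198, 3096]"
  by (rule agrees_cong[OF agrees_eis[of 3 15]]) code_simp

lemma prefix_eis_3_1: "agrees (dil 1 (eis 3)) [0, 1, 9, 28, 73, 126, 252, 344, 585, 757, 1134,
  1332, 2044, 2198, 3096]"
  by (rule agrees_cong[OF agrees_dil[OF prefix_eis_3]]) (simp, code_simp)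

lemma prefix_eis_3_2: "agrees (dil 2 (eis 3)) [0, 0, 1, 0, 9, 0, 28, 0, 73, 0, 126, 0, 252, 0,
  344]"
  by (rule agrees_cong[OF agrees_dil[OF prefix_eis_3]]) (simp, code_simp)

lemma prefix_eis_3_7: "agrees (dil 7 (eis 3)) [0, 0, 0, 0, 0, 0, 0, 1, 0, 0, 0, 0, 0, 0, 9]"
  by (rule agrees_cong[OF agrees_dil[OF prefix_eis_3]]) (simp, code_simp)

lemma prefix_eis_3_14: "agrees (dil 14 (eis 3)) [0, 0, 0, 0, 0, 0, 0, 0, 0, 0, 0, 0, 0, 0, 1]"
  by (rule agrees_cong[OF agrees_dil[OF prefix_eis_3]]) (simp, code_simp)

lemma prefix_eis_5: "agrees (eis 5) [0, 1, 33, 244, 1057, 3126, 8052, 16808, 33825, 59293,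
  103158, 161052, 257908, 371294, 554664]"
  by (rule agrees_cong[OF agrees_eis[of 5 15]]) code_simp

lemma prefix_eis_5_1: "agrees (dil 1 (eis 5)) [0, 1, 33, 244, 1057, 3126, 8052, 16808, 33825,
  59293, 103158, 161052, 257908, 371294, 554664]"
  by (rule agrees_cong[OF agrees_dil[OF prefix_eis_5]]) (simp, code_simp)

lemma prefix_eis_5_2: "agrees (dil 2 (eis 5)) [0, 0, 1, 0, 33, 0, 244, 0, 1057, 0, 3126, 0, 8052,
  0, 16808]"
  by (rule agrees_cong[OF agrees_dil[OF prefix_eis_5]]) (simp, code_simp)

lemma prefix_eis_5_7: "agrees (dil 7 (eis 5)) [0, 0, 0, 0, 0, 0, 0, 1, 0, 0, 0, 0, 0, 0, 33]"
  by (rule agrees_cong[OF agrees_dil[OF prefix_eis_5]]) (simp, code_simp)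

lemma prefix_eis_5_14: "agrees (dil 14 (eis 5)) [0, 0, 0, 0, 0, 0, 0, 0, 0, 0, 0, 0, 0, 0, 1]"
  by (rule agrees_cong[OF agrees_dil[OF prefix_eis_5]]) (simp, code_simp)

lemma prefix_euler: "agrees euler [1, -1, -1, 0, 0, 1, 0, 1, 0, 0, 0, 0, -1, 0, 0]"
  by (rule agrees_cong[OF agrees_euler[of 14]]) code_simp

lemma prefix_euler_1: "agrees (dil 1 euler) [1, -1, -1, 0, 0, 1, 0, 1, 0, 0, 0, 0, -1, 0, 0]"
  by (rule agrees_cong[OF agrees_dil[OF prefix_euler]]) (simp, code_simp)

lemma prefix_euler_2: "agrees (dil 2 euler) [1, 0, -1, 0, -1, 0, 0, 0, 0, 0, 1, 0, 0, 0, 1]"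
  by (rule agrees_cong[OF agrees_dil[OF prefix_euler]]) (simp, code_simp)

lemma prefix_euler_7: "agrees (dil 7 euler) [1, 0, 0, 0, 0, 0, 0, -1, 0, 0, 0, 0, 0, 0, -1]"
  by (rule agrees_cong[OF agrees_dil[OF prefix_euler]]) (simp, code_simp)

lemma prefix_euler_14: "agrees (dil 14 euler) [1, 0, 0, 0, 0, 0, 0, 0, 0, 0, 0, 0, 0, 0, -1]"
  by (rule agrees_cong[OF agrees_dil[OF prefix_euler]]) (simp, code_simp)

lemmas agrees_intros = agrees_add agrees_diff agrees_scale agrees_mult agrees_1[of 14]
  agrees_numeral[of _ 14]

lemma prefix_lvA: "agrees lvA [1, 3, 3, 12, 3, 18, 12, 45, 3, 39, 18, 36, 12, 42, 45]"
  unfolding lvA_def by (rule agrees_cong, (rule agrees_intros prefix_eis_1_1 prefix_eis_1_2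
    prefix_eis_1_7 prefix_eis_1_14)+) code_simp

lemma prefix_lvB: "agrees lvB [3, 4, 20, 16, 52, 24, 80, 4, 116, 52, 120, 48, 208, 56, 20]"
  unfolding lvB_def by (rule agrees_cong, (rule agrees_intros prefix_eis_1_1 prefix_eis_1_2
    prefix_eis_1_7 prefix_eis_1_14)+) code_simp

lemma prefix_lvC: "agrees lvC [1, -4, -4, -16, -4, -24, -16, -4, -4, -52, -24, -48, -16, -56, -4]"
  unfolding lvC_def by (rule agrees_cong, (rule agrees_intros prefix_eis_1_1 prefix_eis_1_2
    prefix_eis_1_7 prefix_eis_1_14)+) code_simp

lemma prefix_lvH: "agrees lvH [0, 1, -1, -2, 1, 0, 2, 1, -1, 1, 0, 0, -2, -4, -1, 0]"
proof -
  have "agrees (fps_X * (dil 1 euler * (dil 2 euler * (dil 7 euler * dil 14 euler)))) [0, 1, -1,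
    -2, 1, 0, 2, 1, -1, 1, 0, 0, -2, -4, -1, 0]"
    by (rule agrees_cong, (rule agrees_X_mult agrees_intros prefix_euler_1 prefix_euler_2
      prefix_euler_7 prefix_euler_14)+) code_simp
  then show ?thesis unfolding lvH_def by (simp only: mult.assoc)
qed

lemma prefix_ramS_1: "agrees (ramS 1) [2, 480, 4320, 13440, 35040, 60480, 120960, 165120, 280800,
  363360, 544320, 639360, 981120, 1055040, 1486080]"
proof -
  have "agrees (2 * (1 + 240 * dil 1 (eis 3))) [2, 480, 4320, 13440, 35040, 60480, 120960,
    165120, 280800, 363360, 544320, 639360, 981120, 1055040, 1486080]"
    by (rule agrees_cong, (rule agrees_intros prefix_eis_3_1)+) code_simp
  then show ?thesis by (simp add: ramS_def)
qed

lemma prefix_ramU_1: "agrees (ramU 1) [2, -1008, -33264, -245952, -1065456, -3151008, -8116416,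
  -16942464, -34095600, -59767344, -103983264, -162340416, -259971264, -374264352, -559101312]"
proof -
  have "agrees (2 * (1 - 504 * dil 1 (eis 5))) [2, -1008, -33264, -245952, -1065456, -3151008,
    -8116416, -16942464, -34095600, -59767344, -103983264, -162340416, -259971264, -374264352,
    -559101312]"
    by (rule agrees_cong, (rule agrees_intros prefix_eis_5_1)+) code_simp
  then show ?thesis by (simp add: ramU_def)
qed

lemma prefix_ramS_2: "agrees (ramS 2) [8, 0, 1920, 0, 17280, 0, 53760, 0, 140160, 0, 241920, 0,
  483840, 0, 660480]"
proof -
  have "agrees (8 * (1 + 240 * dil 2 (eis 3))) [8, 0, 1920, 0, 17280, 0, 53760, 0, 140160, 0,
    241920, 0, 483840, 0, 660480]"
    by (rule agrees_cong, (rule agrees_intros prefix_eis_3_2)+) code_simp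
  then show ?thesis by (simp add: ramS_def)
qed

lemma prefix_ramU_2: "agrees (ramU 2) [16, 0, -8064, 0, -266112, 0, -1967616, 0, -8523648, 0,
  -25208064, 0, -64931328, 0, -135539712]"
proof -
  have "agrees (16 * (1 - 504 * dil 2 (eis 5))) [16, 0, -8064, 0, -266112, 0, -1967616, 0,
    -8523648, 0, -25208064, 0, -64931328, 0, -135539712]"
    by (rule agrees_cong, (rule agrees_intros prefix_eis_5_2)+) code_simp
  then show ?thesis by (simp add: ramU_def)
qed

lemma prefix_ramS_7: "agrees (ramS 7) [98, 0, 0, 0, 0, 0, 0, 23520, 0, 0, 0, 0, 0, 0, 211680]"
proof -
  have "agrees (98 * (1 + 240 * dil 7 (eis 3))) [98, 0, 0, 0, 0, 0, 0, 23520, 0, 0, 0, 0, 0, 0,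
    211680]"
    by (rule agrees_cong, (rule agrees_intros prefix_eis_3_7)+) code_simp
  then show ?thesis by (simp add: ramS_def)
qed

lemma prefix_ramU_7: "agrees (ramU 7) [686, 0, 0, 0, 0, 0, 0, -345744, 0, 0, 0, 0, 0, 0,
  -11409552]"
proof -
  have "agrees (686 * (1 - 504 * dil 7 (eis 5))) [686, 0, 0, 0, 0, 0, 0, -345744, 0, 0, 0, 0, 0,
    0, -11409552]"
    by (rule agrees_cong, (rule agrees_intros prefix_eis_5_7)+) code_simp
  then show ?thesis by (simp add: ramU_def)
qed

lemma prefix_ramS_14: "agrees (ramS 14) [392, 0, 0, 0, 0, 0, 0, 0, 0, 0, 0, 0, 0, 0, 94080]"
proof -
  have "agrees (392 * (1 + 240 * dil 14 (eis 3))) [392, 0, 0, 0, 0, 0, 0, 0, 0, 0, 0, 0, 0, 0,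
    94080]"
    by (rule agrees_cong, (rule agrees_intros prefix_eis_3_14)+) code_simp
  then show ?thesis by (simp add: ramS_def)
qed

lemma prefix_ramU_14: "agrees (ramU 14) [5488, 0, 0, 0, 0, 0, 0, 0, 0, 0, 0, 0, 0, 0, -2765952]"
proof -
  have "agrees (5488 * (1 - 504 * dil 14 (eis 5))) [5488, 0, 0, 0, 0, 0, 0, 0, 0, 0, 0, 0, 0, 0,
    -2765952]"
    by (rule agrees_cong, (rule agrees_intros prefix_eis_5_14)+) code_simp
  then show ?thesis by (simp add: ramU_def)
qed

text \<open>The defect is first rearranged so that it begins with a positive term and contains
  products instead of powers, which is the shape that the \<open>agrees\<close> rules can
  follow.\<close>

lemma prefix_defX1: "agrees defX1 (replicate 15 0)"
proof -
  have "defX1 = 7*(lvB*lvB) - 48*(lvA*lvA) - 15*(lvC*lvC) - 112*(lvH*lvH)" (is "_ = ?r")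
    unfolding defX1_def by algebra
  moreover have "agrees ?r (replicate 15 0)"
    by (rule agrees_cong, (rule agrees_intros prefix_lvA prefix_lvB prefix_lvC prefix_lvH)+)
      code_simp
  ultimately show ?thesis by simp
qed

lemma prefix_defX2: "agrees defX2 (replicate 15 0)"
proof -
  have "defX2 = 14*(lvB*lvH) + 3*(lvC*lvC) + 7*(lvH*lvH) - 3*(lvA*lvA)" (is "_ = ?r")
    unfolding defX2_def by algebra
  moreover have "agrees ?r (replicate 15 0)"
    by (rule agrees_cong, (rule agrees_intros prefix_lvA prefix_lvB prefix_lvC prefix_lvH)+)
      code_simp
  ultimately show ?thesis by simp
qed

lemma prefix_defG1: "agrees defG1 (replicate 15 0)"
proof -
  have "defG1 = ramS 1 - (24*(lvA*lvB) + 80*(lvA*lvA) + 45*(lvC*lvC) - 120*(lvA*lvC)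
    - 192*(lvA*lvH) - 25*(lvB*lvC) - 80*(lvC*lvH))" (is "_ = ?r")
    unfolding defG1_def by algebra
  moreover have "agrees ?r (replicate 15 0)"
    by (rule agrees_cong, (rule agrees_intros prefix_lvA prefix_lvB prefix_lvC prefix_lvH
      prefix_ramS_1)+) code_simp
  ultimately show ?thesis by simp
qed

lemma prefix_defG2: "agrees defG2 (replicate 15 0)"
proof -
  have "defG2 = ramS 2 - (192*(lvA*lvH) + 80*(lvA*lvA) + 25*(lvB*lvC) + 80*(lvC*lvH)
    + 45*(lvC*lvC) - 24*(lvA*lvB) - 120*(lvA*lvC))" (is "_ = ?r")
    unfolding defG2_def by algebra
  moreover have "agrees ?r (replicate 15 0)"
    by (rule agrees_cong, (rule agrees_intros prefix_lvA prefix_lvB prefix_lvC prefix_lvH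
      prefix_ramS_2)+) code_simp
  ultimately show ?thesis by simp
qed

lemma prefix_defG7: "agrees defG7 (replicate 15 0)"
proof -
  have "defG7 = ramS 7 - (120*(lvA*lvC) + 192*(lvA*lvH) + 80*(lvA*lvA) + 45*(lvC*lvC)
    - 24*(lvA*lvB) - 25*(lvB*lvC) - 80*(lvC*lvH))" (is "_ = ?r")
    unfolding defG7_def by algebra
  moreover have "agrees ?r (replicate 15 0)"
    by (rule agrees_cong, (rule agrees_intros prefix_lvA prefix_lvB prefix_lvC prefix_lvH
      prefix_ramS_7)+) code_simp
  ultimately show ?thesis by simp
qed

lemma prefix_defG14: "agrees defG14 (replicate 15 0)"
proof -
  have "defG14 = ramS 14 - (24*(lvA*lvB) + 120*(lvA*lvC) + 80*(lvA*lvA) + 25*(lvB*lvC)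
    + 80*(lvC*lvH) + 45*(lvC*lvC) - 192*(lvA*lvH))" (is "_ = ?r")
    unfolding defG14_def by algebra
  moreover have "agrees ?r (replicate 15 0)"
    by (rule agrees_cong, (rule agrees_intros prefix_lvA prefix_lvB prefix_lvC prefix_lvH
      prefix_ramS_14)+) code_simp
  ultimately show ?thesis by simp
qed

lemma prefix_defH1: "agrees defH1 (replicate 15 0)"
proof -
  have "defH1 = ramU 1 - (516*(lvA*lvB*lvC) + 1008*(lvA*lvA*lvC) + 4704*(lvB*lvH*lvH)
    + 72*(lvC*lvC*lvH) + 189*(lvC*lvC*lvC) - 768*(lvA*lvC*lvH) - 756*(lvA*lvC*lvC)
    - 448*(lvA*lvA*lvA) - 513*(lvB*lvC*lvC) - 1176*(lvB*lvB*lvH))" (is "_ = ?r")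
    unfolding defH1_def by algebra
  moreover have "agrees ?r (replicate 15 0)"
    by (rule agrees_cong, (rule agrees_intros prefix_lvA prefix_lvB prefix_lvC prefix_lvH
      prefix_ramU_1)+) code_simp
  ultimately show ?thesis by simp
qed

lemma prefix_defH2: "agrees defH2 (replicate 15 0)"
proof -
  have "defH2 = ramU 2 - (516*(lvA*lvB*lvC) + 756*(lvA*lvC*lvC) + 448*(lvA*lvA*lvA)
    + 4704*(lvB*lvH*lvH) + 72*(lvC*lvC*lvH) - 768*(lvA*lvC*lvH) - 1008*(lvA*lvA*lvC)
    - 513*(lvB*lvC*lvC) - 1176*(lvB*lvB*lvH) - 189*(lvC*lvC*lvC))" (is "_ = ?r")
    unfolding defH2_def by algebra
  moreover have "agrees ?r (replicate 15 0)"
    by (rule agrees_cong, (rule agrees_intros prefix_lvA prefix_lvB prefix_lvC prefix_lvH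
      prefix_ramU_2)+) code_simp
  ultimately show ?thesis by simp
qed

lemma prefix_defH7: "agrees defH7 (replicate 15 0)"
proof -
  have "defH7 = ramU 7 - (516*(lvA*lvB*lvC) + 513*(lvB*lvC*lvC) + 1176*(lvB*lvB*lvH)
    - 768*(lvA*lvC*lvH) - 756*(lvA*lvC*lvC) - 1008*(lvA*lvA*lvC) - 448*(lvA*lvA*lvA)
    - 4704*(lvB*lvH*lvH) - 72*(lvC*lvC*lvH) - 189*(lvC*lvC*lvC))" (is "_ = ?r")
    unfolding defH7_def by algebra
  moreover have "agrees ?r (replicate 15 0)"
    by (rule agrees_cong, (rule agrees_intros prefix_lvA prefix_lvB prefix_lvC prefix_lvH
      prefix_ramU_7)+) code_simp
  ultimately show ?thesis by simp
qed

lemma prefix_defH14: "agrees defH14 (replicate 15 0)"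
proof -
  have "defH14 = ramU 14 - (516*(lvA*lvB*lvC) + 756*(lvA*lvC*lvC) + 1008*(lvA*lvA*lvC)
    + 448*(lvA*lvA*lvA) + 513*(lvB*lvC*lvC) + 1176*(lvB*lvB*lvH) + 189*(lvC*lvC*lvC)
    - 768*(lvA*lvC*lvH) - 4704*(lvB*lvH*lvH) - 72*(lvC*lvC*lvH))" (is "_ = ?r")
    unfolding defH14_def by algebra
  moreover have "agrees ?r (replicate 15 0)"
    by (rule agrees_cong, (rule agrees_intros prefix_lvA prefix_lvB prefix_lvC prefix_lvH
      prefix_ramU_14)+) code_simp
  ultimately show ?thesis by simp
qed

text \<open>The constant matrix \<open>M(0)\<close> has only the eigenvalues 0, 1, 2, 7, 14, so a solution of the
  system is determined by its coefficients of order less than 15. The functionals in the proof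
  form a flag of left generalised eigenvectors of \<open>M(0)\<close>.\<close>

lemma level14_indicial:
  fixes n y0 y1 y2 y3 y4 y5 y6 y7 y8 y9 :: real
  assumes e0: "72 * (n * y0) = 144 * y0 + 42 * y3 - 72 * y4 + 30 * y5"
    and e1: "288 * (n * y1) = 576 * y1 - 21 * y2 + 21 * y3 + 3 * y4 - 3 * y5"
    and e2: "1008*(n*y2) = 24*y0 + 112512*y1 - 980*y2 + 1330*y3 + 140*y4 - 154*y5 - 336*y6"
    and e3: "1008*(n*y3) = - 24*y0 + 81024*y1 + 476*y2 + 182*y3 - 140*y4 + 154*y5 - 336*y7"
    and e4: "1008*(n*y4) = - 5880*y0 - 83328*y1 + 196*y2 + 490*y3 - 28*y4 + 1694*y5 - 336*y8"
    and e5: "1008*(n*y5) = 5880*y0 - 110208*y1 - 196*y2 - 490*y3 - 3500*y4 + 8890*y5 - 336*y9"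
    and e6: "336*(n*y6) = - 24*y0 + 129408*y1 - 6328*y2 + 5978*y3 + 868*y4 - 854*y5 + 168*y6"
    and e7: "336*(n*y7) = - 24*y0 + 81024*y1 - 6580*y2 + 5222*y3 + 868*y4 - 854*y5 + 336*y7"
    and e8: "336*(n*y8) = 41160*y0 + 51072*y1 + 5684*y2 - 10486*y3 - 13160*y4 + 1498*y5 + 1176*y8"
    and e9: "336*(n*y9) = 41160*y0 + 389760*y1 + 5684*y2 - 10486*y3 - 25508*y4 - 35546*y5
      + 2352*y9"
    and n: "n \<ge> 15"
  shows "y0 = 0 \<and> y1 = 0 \<and> y2 = 0 \<and> y3 = 0 \<and> y4 = 0 \<and> y5 = 0 \<and> y6 =
    0 \<and> y7 = 0 \<and> y8 = 0 \<and> y9 = 0"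
proof -
  have "n * (864 * y1 - 6 * y2 + 3 * y3 - 4 * y6 + y7) = 0"
    using e0 e1 e2 e3 e4 e5 e6 e7 e8 e9 unfolding left_diff_distrib right_diff_distrib
      distrib_left by linarith
  then have f0: "864 * y1 - 6 * y2 + 3 * y3 - 4 * y6 + y7 =
    0" using n by (simp only: mult_eq_0_iff) linarith
  have "n * (- 63 * y0 + 27792 * y1 - 147 * y2 + 21 * y4 - 98 * y6 + 2 * y8) = 0"
    using e0 e1 e2 e3 e4 e5 e6 e7 e8 e9 f0 unfolding left_diff_distrib right_diff_distrib
      distrib_left by linarith
  then have f1: "- 63*y0 + 27792*y1 - 147*y2 + 21*y4 - 98*y6 + 2*y8 =
    0" using n by (simp only: mult_eq_0_iff) linarith
  have "n * (- 126 * y0 + 54720 * y1 - 294 * y2 + 21 * y5 - 196 * y6 + y9) = 0"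
    using e0 e1 e2 e3 e4 e5 e6 e7 e8 e9 f0 f1 unfolding left_diff_distrib right_diff_distrib
      distrib_left by linarith
  then have f2: "- 126 * y0 + 54720 * y1 - 294 * y2 + 21 * y5 - 196 * y6 + y9 =
    0" using n by (simp only: mult_eq_0_iff) linarith
  have "n * (- 2880 * y1 + 27 * y2 - 3 * y3 + 10 * y6) = 0"
    using e0 e1 e2 e3 e4 e5 e6 e7 e8 e9 f0 f1 f2 unfolding left_diff_distrib right_diff_distrib
      distrib_left by linarith
  then have f3: "- 2880 * y1 + 27 * y2 - 3 * y3 + 10 * y6 =
    0" using n by (simp only: mult_eq_0_iff) linarith
  have "n * (- 15 * y0 - 39600 * y1 + 308 * y2 - 2 * y4 + 140 * y6) = 0"
    using e0 e1 e2 e3 e4 e5 e6 e7 e8 e9 f0 f1 f2 f3 unfolding left_diff_distrib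
      right_diff_distrib distrib_left by linarith
  then have f4: "- 15 * y0 - 39600 * y1 + 308 * y2 - 2 * y4 + 140 * y6 =
    0" using n by (simp only: mult_eq_0_iff) linarith
  have "n * (- 45 * y0 - 257040 * y1 + 1953 * y2 - 3 * y5 + 910 * y6) = 0"
    using e0 e1 e2 e3 e4 e5 e6 e7 e8 e9 f0 f1 f2 f3 f4 unfolding left_diff_distrib
      right_diff_distrib distrib_left by linarith
  then have f5: "- 45 * y0 - 257040 * y1 + 1953 * y2 - 3 * y5 + 910 * y6 =
    0" using n by (simp only: mult_eq_0_iff) linarith
  have "(n - 1) * (3 * y0 - 6096 * y1 - 42 * y2 + 28 * y6) = 0"
    using e0 e1 e2 e3 e4 e5 e6 e7 e8 e9 f0 f1 f2 f3 f4 f5 unfolding left_diff_distrib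
      right_diff_distrib distrib_left by linarith
  then have f6: "3 * y0 - 6096 * y1 - 42 * y2 + 28 * y6 =
    0" using n by (simp only: mult_eq_0_iff) linarith
  have "(n - 2) * (- 288 * y1 - 3 * y3 + y7) = 0"
    using e0 e1 e2 e3 e4 e5 e6 e7 e8 e9 f0 f1 f2 f3 f4 f5 f6 unfolding left_diff_distrib
      right_diff_distrib distrib_left by linarith
  then have f7: "- 288 * y1 - 3 * y3 + y7 = 0" using n by (simp only: mult_eq_0_iff) linarith
  have "(n - 7) * (147 * y0 + 816 * y1 - 42 * y4 + 4 * y8) = 0"
    using e0 e1 e2 e3 e4 e5 e6 e7 e8 e9 f0 f1 f2 f3 f4 f5 f6 f7 unfolding left_diff_distrib
      right_diff_distrib distrib_left by linarith
  then have f8: "147 * y0 + 816 * y1 - 42 * y4 + 4 * y8 =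
    0" using n by (simp only: mult_eq_0_iff) linarith
  have "(n - 14) * (288 * y1 - 21 * y5 + y9) = 0"
    using e0 e1 e2 e3 e4 e5 e6 e7 e8 e9 f0 f1 f2 f3 f4 f5 f6 f7 f8 unfolding left_diff_distrib
      right_diff_distrib distrib_left by linarith
  then have f9: "288 * y1 - 21 * y5 + y9 = 0" using n by (simp only: mult_eq_0_iff) linarith
  \<comment> \<open>The ten functionals are linearly independent, so their common zero is the zero
    vector.\<close>
  show ?thesis using f0 f1 f2 f3 f4 f5 f6 f7 f8 f9 by (intro conjI) linarith+
qed

section \<open>Vanishing of the level 14 defects\<close>

lemma XD_nth: "fps_XD f $ n = real n * f $ n" for f :: "real fps"
  by simp

lemma fps_numeral_mult_nth: "(numeral k * f) $ n = numeral k * f $ n" for f :: "real fps"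
  by (simp add: numeral_fps_const)

lemma lv_nth_0: "lvP $ 0 = 1" "lvA $ 0 = 1" "lvB $ 0 = 3" "lvC $ 0 = 1" "lvH $ 0 =
  0" "ramS 1 $ 0 = 2" "ramS 2 $ 0 = 8" "ramS 7 $ 0 = 98" "ramS 14 $ 0 = 392"
  by (simp_all add: lvP_def lvA_def lvB_def lvC_def lvH_def ramS_def dil_nth numeral_fps_const
    fps_of_nat[symmetric])

lemma level14_defects_nth:
  "defX1 $ n = 0 \<and> defX2 $ n = 0 \<and> defG1 $ n = 0 \<and> defG2 $ n = 0
    \<and> defG7 $ n = 0 \<and> defG14 $ n = 0 \<and> defH1 $ n = 0 \<and> defH2 $ n = 0
    \<and> defH7 $ n = 0 \<and> defH14 $ n = 0"
proof (induction n rule: less_induct)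
  case (less n)
  show ?case
  proof (cases "n < 15")
    case True
    then show ?thesis
      using prefix_defX1 prefix_defX2 prefix_defG1 prefix_defG2 prefix_defG7 prefix_defG14
        prefix_defH1 prefix_defH2 prefix_defH7 prefix_defH14
      unfolding agrees_def by simp
  next
    case False
    have low0: "\<forall>j<n. defX1 $ j = 0" using less by blast
    have low1: "\<forall>j<n. defX2 $ j = 0" using less by blast
    have low2: "\<forall>j<n. defG1 $ j = 0" using less by blast
    have low3: "\<forall>j<n. defG2 $ j = 0" using less by blast
    have low4: "\<forall>j<n. defG7 $ j = 0" using less by blast
    have low5: "\<forall>j<n. defG14 $ j = 0" using less by blast
    have low6: "\<forall>j<n. defH1 $ j = 0" using less by blast
    have low7: "\<forall>j<n. defH2 $ j = 0" using less by blast
    have low8: "\<forall>j<n. defH7 $ j = 0" using less by blast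
    have low9: "\<forall>j<n. defH14 $ j = 0" using less by blast
    note lows = fps_mult_nth_low[OF low0] fps_mult_nth_low[OF low1] fps_mult_nth_low[OF low2]
      fps_mult_nth_low[OF low3] fps_mult_nth_low[OF low4] fps_mult_nth_low[OF low5]
      fps_mult_nth_low[OF low6] fps_mult_nth_low[OF low7] fps_mult_nth_low[OF low8]
      fps_mult_nth_low[OF low9]
    \<comment> \<open>From here to \<open>e9\<close>: the rows of the matrix \<open>M(0)\<close>,
      obtained by inserting the constant terms 1, 1, 3, 1, 0 of \<open>lvP\<close>,
      \<open>lvA\<close>, \<open>lvB\<close>, \<open>lvC\<close>, \<open>lvH\<close> (and that of
      \<open>ramS\<close>) into the cofactors.\<close>
    have e0: "72*(real n*defX1 $ n) = 144*defX1 $ n + 42*defG2 $ n - 72*defG7 $ n + 30*defG14 $ n"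
      using arg_cong[OF XD_defX1, of "\<lambda>f. f $ n"]
      unfolding fps_numeral_mult_nth XD_nth fps_add_nth lows
      by (simp add: lv_nth_0 fps_mult_nth_0 numeral_fps_const power2_eq_square del: One_nat_def)
    have e1: "288*(real n*defX2 $ n) = 576*defX2 $ n - 21*defG1 $ n + 21*defG2 $ n
      + 3*defG7 $ n - 3*defG14 $ n"
      using arg_cong[OF XD_defX2, of "\<lambda>f. f $ n"]
      unfolding fps_numeral_mult_nth XD_nth fps_add_nth lows
      by (simp add: lv_nth_0 fps_mult_nth_0 numeral_fps_const power2_eq_square del: One_nat_def)
    have e2: "1008*(real n*defG1 $ n) = 24*defX1 $ n + 112512*defX2 $ n - 980*defG1 $ n
      + 1330*defG2 $ n + 140*defG7 $ n - 154*defG14 $ n - 336*defH1 $ n"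
      using arg_cong[OF XD_defG1, of "\<lambda>f. f $ n"]
      unfolding fps_numeral_mult_nth XD_nth fps_add_nth lows
      by (simp add: lv_nth_0 fps_mult_nth_0 numeral_fps_const power2_eq_square del: One_nat_def)
    have e3: "1008*(real n*defG2 $ n) = - 24*defX1 $ n + 81024*defX2 $ n + 476*defG1 $ n
      + 182*defG2 $ n - 140*defG7 $ n + 154*defG14 $ n - 336*defH2 $ n"
      using arg_cong[OF XD_defG2, of "\<lambda>f. f $ n"]
      unfolding fps_numeral_mult_nth XD_nth fps_add_nth lows
      by (simp add: lv_nth_0 fps_mult_nth_0 numeral_fps_const power2_eq_square del: One_nat_def)
    have e4: "1008*(real n*defG7 $ n) = - 5880*defX1 $ n - 83328*defX2 $ n + 196*defG1 $ n
      + 490*defG2 $ n - 28*defG7 $ n + 1694*defG14 $ n - 336*defH7 $ n"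
      using arg_cong[OF XD_defG7, of "\<lambda>f. f $ n"]
      unfolding fps_numeral_mult_nth XD_nth fps_add_nth lows
      by (simp add: lv_nth_0 fps_mult_nth_0 numeral_fps_const power2_eq_square del: One_nat_def)
    have e5: "1008*(real n*defG14 $ n) = 5880*defX1 $ n - 110208*defX2 $ n - 196*defG1 $ n
      - 490*defG2 $ n - 3500*defG7 $ n + 8890*defG14 $ n - 336*defH14 $ n"
      using arg_cong[OF XD_defG14, of "\<lambda>f. f $ n"]
      unfolding fps_numeral_mult_nth XD_nth fps_add_nth lows
      by (simp add: lv_nth_0 fps_mult_nth_0 numeral_fps_const power2_eq_square del: One_nat_def)
    have e6: "336*(real n*defH1 $ n) = - 24*defX1 $ n + 129408*defX2 $ n - 6328*defG1 $ n
      + 5978*defG2 $ n + 868*defG7 $ n - 854*defG14 $ n + 168*defH1 $ n"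
      using arg_cong[OF XD_defH1, of "\<lambda>f. f $ n"]
      unfolding fps_numeral_mult_nth XD_nth fps_add_nth lows
      by (simp add: lv_nth_0 fps_mult_nth_0 numeral_fps_const power2_eq_square del: One_nat_def)
    have e7: "336*(real n*defH2 $ n) = - 24*defX1 $ n + 81024*defX2 $ n - 6580*defG1 $ n
      + 5222*defG2 $ n + 868*defG7 $ n - 854*defG14 $ n + 336*defH2 $ n"
      using arg_cong[OF XD_defH2, of "\<lambda>f. f $ n"]
      unfolding fps_numeral_mult_nth XD_nth fps_add_nth lows
      by (simp add: lv_nth_0 fps_mult_nth_0 numeral_fps_const power2_eq_square del: One_nat_def)
    have e8: "336*(real n*defH7 $ n) = 41160*defX1 $ n + 51072*defX2 $ n + 5684*defG1 $ n
      - 10486*defG2 $ n - 13160*defG7 $ n + 1498*defG14 $ n + 1176*defH7 $ n"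
      using arg_cong[OF XD_defH7, of "\<lambda>f. f $ n"]
      unfolding fps_numeral_mult_nth XD_nth fps_add_nth lows
      by (simp add: lv_nth_0 fps_mult_nth_0 numeral_fps_const power2_eq_square del: One_nat_def)
    have e9: "336*(real n*defH14 $ n) = 41160*defX1 $ n + 389760*defX2 $ n + 5684*defG1 $ n
      - 10486*defG2 $ n - 25508*defG7 $ n - 35546*defG14 $ n + 2352*defH14 $ n"
      using arg_cong[OF XD_defH14, of "\<lambda>f. f $ n"]
      unfolding fps_numeral_mult_nth XD_nth fps_add_nth lows
      by (simp add: lv_nth_0 fps_mult_nth_0 numeral_fps_const power2_eq_square del: One_nat_def)
    show ?thesis
      by (rule level14_indicial[OF e0 e1 e2 e3 e4 e5 e6 e7 e8 e9]) (use False in simp)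
  qed
qed

lemma level14_defects: "defX1 = 0" "defX2 = 0" "defG1 = 0" "defG2 = 0" "defG7 = 0" "defG14 =
  0" "defH1 = 0" "defH2 = 0" "defH7 = 0" "defH14 = 0"
  using level14_defects_nth by (auto intro!: fps_ext)

section \<open>Level 28\<close>

lemma lvX1: "- 48 * lvA ^ 2 + 7 * lvB ^ 2 - 15 * lvC ^ 2 - 112 * lvH ^ 2 = 0"
  using level14_defects(1) unfolding defX1_def .

lemma lvX2: "- 3 * lvA ^ 2 + 14 * lvB * lvH + 3 * lvC ^ 2 + 7 * lvH ^ 2 = 0"
  using level14_defects(2) unfolding defX2_def .

lemma XD_lvA: "3 * fps_XD lvA = 3 * lvP * lvA - lvB * lvC - 5 * lvC * lvH"
  using XD_lvA_576 unfolding level14_defects by algebra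

lemma XD_lvB: "fps_XD lvB = lvP * lvB - 3 * lvA * lvC"
  using XD_lvB_576 unfolding level14_defects by algebra

lemma XD_lvC: "3 * fps_XD lvC = 3 * lvP * lvC - lvA * lvB + 16 * lvA * lvH"
  using XD_lvC_576 unfolding level14_defects by algebra

text \<open>In the sum over the four \<open>d\<close> every product of two series with different
  sign patterns cancels, and only squares survive.\<close>

lemma XD_lvP: "32 * fps_XD lvP = 16 * lvP ^ 2 - 16 * lvA ^ 2 + lvB ^ 2 - 9 * lvC ^ 2"
proof -
  have "48 * lvP = ramT 1 + ramT 2 + ramT 7 + ramT 14"
    unfolding ramT_eqs by algebra
  then have "fps_XD (48 * lvP) = fps_XD (ramT 1 + ramT 2 + ramT 7 + ramT 14)"
    by (rule arg_cong)
  then have *: "48 * fps_XD lvP = fps_XD (ramT 1) + fps_XD (ramT 2) + fps_XD (ramT 7)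
    + fps_XD (ramT 14)"
    by (simp only: fps_XD_numeral_mult fps_XD_add)
  have "36 * (32 * fps_XD lvP) = 24 * (48 * fps_XD lvP)"
    by algebra
  also have "\<dots> = 24 * fps_XD (ramT 1) + 24 * fps_XD (ramT 2) + 24 * fps_XD (ramT 7)
    + 24 * fps_XD (ramT 14)"
    unfolding * by algebra
  also have "\<dots> = 36 * (16 * lvP ^ 2 - 16 * lvA ^ 2 + lvB ^ 2 - 9 * lvC ^ 2)"
    unfolding XD_ramT_1 XD_ramT_2 XD_ramT_7 XD_ramT_14 unfolding ramT_eqs ramS_eqs
      level14_defects by algebra
  finally show ?thesis by (rule fps_numeral_mult_cancel)
qed

text \<open>The substitution of \<open>- q\<close> for \<open>q\<close>. It is a ring homomorphism
  that commutes with \<open>D\<close> and fixes exactly the even series, so it separates even from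
  odd parts.\<close>

definition alt :: "real fps \<Rightarrow> real fps" where
  "alt f = Abs_fps (\<lambda>n. (- 1) ^ n * f $ n)"

lemma alt_nth: "alt f $ n = (- 1) ^ n * f $ n"
  by (simp add: alt_def)

lemma alt_mult: "alt (f * g) = alt f * alt g"
proof (rule fps_ext)
  fix n
  have "alt (f * g) $ n = (\<Sum>i = 0..n. ((- 1) ^ n) * (f $ i * g $ (n - i)))"
    by (simp add: alt_nth fps_mult_nth sum_distrib_left)
  also have "\<dots> = (\<Sum>i = 0..n. ((- 1) ^ i * f $ i) * ((- 1) ^ (n - i) * g $ (n - i)))"
    by (rule sum.cong) (auto simp: ac_simps simp flip: power_add)
  finally show "alt (f * g) $ n = (alt f * alt g) $ n"
    by (simp add: alt_nth fps_mult_nth)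
qed

lemma alt_add: "alt (f + g) = alt f + alt g"
  by (rule fps_ext) (simp add: alt_nth algebra_simps)

lemma alt_diff: "alt (f - g) = alt f - alt g"
  by (rule fps_ext) (simp add: alt_nth algebra_simps)

lemma alt_0: "alt 0 = 0"
  by (rule fps_ext) (simp add: alt_nth)

lemma alt_numeral: "alt (numeral k) = numeral k"
  by (rule fps_ext) (simp add: alt_nth numeral_fps_const)

lemma alt_power2: "alt (f ^ 2) = alt f ^ 2"
  by (simp add: power2_eq_square alt_mult)

lemma alt_XD: "alt (fps_XD f) = fps_XD (alt f)"
  by (rule fps_ext) (simp add: alt_nth)

lemma alt_dil_2: "alt (dil 2 f) = dil 2 f"
  by (rule fps_ext) (auto simp: alt_nth dil_nth)

text \<open>\<open>ev\<close> marks the level 14 forms at \<open>q\<^sup>2\<close>, which are even in \<open>q\<close>; together with the odd series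
  \<open>odR\<close>, \<open>odS\<close>, \<open>odK\<close> they generate the weight 2 forms of level 28.\<close>

definition evP :: "real fps" where "evP = dil 2 lvP"
definition evA :: "real fps" where "evA = dil 2 lvA"
definition evB :: "real fps" where "evB = dil 2 lvB"
definition evC :: "real fps" where "evC = dil 2 lvC"
definition evH :: "real fps" where "evH = dil 2 lvH"

lemmas ev_defs = evP_def evA_def evB_def evC_def evH_def

text \<open>The odd part of \<open>eis 1\<close>; as a modular form it is the eta quotient
  \<open>eta(4z)^8 / eta(2z)^4\<close>.\<close>

definition odR :: "real fps" where
  "odR = Abs_fps (\<lambda>n. if odd n then eis 1 $ n else 0)"

definition odS :: "real fps" where "odS = dil 7 odR"

text \<open>The newform \<open>lvH\<close> has Hecke eigenvalue \<open>- 1\<close> at 2, so its even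
  part is \<open>- evH\<close> and this sum is its odd part.\<close>

definition odK :: "real fps" where "odK = lvH + evH"

lemma alt_ev: "alt evP = evP" "alt evA = evA" "alt evB = evB" "alt evC = evC" "alt evH = evH"
  by (simp_all add: ev_defs alt_dil_2)

lemma alt_odR: "alt odR = - odR"
  by (rule fps_ext) (simp add: alt_nth odR_def)

lemma alt_odS: "alt odS = - odS"
  by (rule fps_ext) (auto simp: alt_nth odS_def odR_def dil_nth elim!: dvdE)

text \<open>For even exponents this is the Hecke relation
  \<open>sigma(2m) = 3 sigma(m) - 2 sigma(m/2)\<close>. Even divisors of \<open>2m\<close> are the
  doubled divisors of \<open>m\<close>, and the odd divisors of \<open>m\<close> do not change when
  \<open>m\<close> is halved; \<open>od\<close> sums these odd divisors.\<close>

lemma eis_1_even_odd: "eis 1 = odR + 3 * dil 2 (eis 1) - 2 * dil 4 (eis 1)"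
proof (rule fps_ext)
  fix n :: nat
  define od where "od = (\<lambda>m :: nat. \<Sum>d | d dvd m \<and> odd d. real d)"
  have split: "eis 1 $ (2 * m) = 2 * eis 1 $ m + od m" if "m > 0" for m
  proof -
    have "{d. d dvd 2 * m} = (\<lambda>d. 2 * d) ` {d. d dvd m} \<union> {d. d dvd m
      \<and> odd d}" (is "_ = ?E \<union> ?O")
    proof (intro equalityI subsetI)
      fix d assume d: "d \<in> {d. d dvd 2 * m}"
      show "d \<in> ?E \<union> ?O"
      proof (cases "even d")
        case True
        then obtain e where "d = 2 * e" by auto
        with d show ?thesis by auto
      next
        case False
        then have "coprime d 2" by simp
        with d False show ?thesis by (simp add: coprime_dvd_mult_right_iff)
      qed
    qed auto
    then have "eis 1 $ (2 * m) = sum real (?E \<union> ?O)"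
      by (simp add: eis_nth)
    also have "\<dots> = sum real ?E + sum real ?O"
      using that by (intro sum.union_disjoint) auto
    also have "sum real ?E = 2 * eis 1 $ m"
      by (subst sum.reindex) (auto simp: inj_on_def eis_nth sum_distrib_left)
    finally show ?thesis by (simp add: od_def)
  qed
  have od: "od m = (if even m then od (m div 2) else eis 1 $ m)" if "m > 0" for m
  proof (cases "even m")
    case True
    then have "{d. d dvd m \<and> odd d} = {d. d dvd m div 2 \<and> odd d}"
      by (auto elim!: evenE simp: coprime_dvd_mult_right_iff)
    with True show ?thesis by (simp add: od_def)
  next
    case False
    then have "{d. d dvd m \<and> odd d} = {d. d dvd m}" by auto
    with False show ?thesis by (simp add: od_def eis_nth)
  qed
  consider "odd n" | "n = 0" | m where "n = 2 * m" "m > 0"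
    by (cases "odd n"; cases "n = 0"; force elim: evenE)
  then show "eis 1 $ n = (odR + 3 * dil 2 (eis 1) - 2 * dil 4 (eis 1)) $ n"
  proof cases
    case 1
    then have "\<not> 4 dvd n" by auto
    with 1 show ?thesis by (simp add: odR_def dil_nth numeral_fps_const)
  next
    case 2
    then show ?thesis by (simp add: odR_def dil_nth numeral_fps_const)
  next
    case 3
    show ?thesis
    proof (cases "even m")
      case True
      then obtain j where j: "m = 2 * j" by auto
      with 3 have "j > 0" by simp
      have "eis 1 $ n = 2 * eis 1 $ m + od m" using split 3 by simp
      also have "od m = eis 1 $ m - 2 * eis 1 $ j"
        using od[of m] split[of j] 3 j \<open>j > 0\<close> by simp
      finally show ?thesis using 3 j by (simp add: odR_def dil_nth numeral_fps_const)
    next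
      case False
      then have "\<not> 4 dvd n" using 3 by presburger
      then show ?thesis using 3 False split[of m] od[of m]
        by (simp add: odR_def dil_nth numeral_fps_const)
    qed
  qed
qed

lemma dil_7_eis_1_even_odd: "dil 7 (eis 1) = odS + 3 * dil 14 (eis 1) - 2 * dil 28 (eis 1)"
proof -
  have "dil 7 (eis 1) = dil 7 (odR + 3 * dil 2 (eis 1) - 2 * dil 4 (eis 1))"
    using eis_1_even_odd by (rule arg_cong)
  also have "\<dots> = odS + 3 * dil 7 (dil 2 (eis 1)) - 2 * dil 7 (dil 4 (eis 1))"
    by (simp add: odS_def fps_compose_add_distrib fps_compose_sub_distrib dil_mult del:
      One_nat_def)
  finally show ?thesis by (simp add: dil_dil del: One_nat_def)
qed

lemma dil_2_power2: "dil 2 (f ^ 2) = dil 2 f ^ 2" for f :: "real fps"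
  unfolding power2_eq_square[of f] power2_eq_square[of "dil 2 f"] by (rule dil_mult) simp

lemma dil_2_mult: "dil 2 (f * g) = dil 2 f * dil 2 g" for f g :: "real fps"
  by (rule dil_mult) simp

lemmas dil_2_distribs = fps_compose_add_distrib fps_compose_sub_distrib dil_2_mult numeral_compose
  fps_compose_1

lemma evP_eq: "evP = 1 - dil 2 (eis 1) - 2 * dil 4 (eis 1) - 7 * dil 14 (eis 1)
  - 14 * dil 28 (eis 1)"
  by (simp add: evP_def lvP_def dil_2_distribs dil_dil del: One_nat_def)

lemma evA_eq: "evA = 1 + 3 * dil 2 (eis 1) - 6 * dil 4 (eis 1) + 21 * dil 14 (eis 1)
  - 42 * dil 28 (eis 1)"
  by (simp add: evA_def lvA_def dil_2_distribs dil_dil del: One_nat_def)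

lemma evB_eq: "evB = 3 + 4 * dil 2 (eis 1) + 8 * dil 4 (eis 1) - 28 * dil 14 (eis 1)
  - 56 * dil 28 (eis 1)"
  by (simp add: evB_def lvB_def dil_2_distribs dil_dil del: One_nat_def)

lemma evC_eq: "evC = 1 - 4 * dil 2 (eis 1) + 8 * dil 4 (eis 1) + 28 * dil 14 (eis 1)
  - 56 * dil 28 (eis 1)"
  by (simp add: evC_def lvC_def dil_2_distribs dil_dil del: One_nat_def)

lemma lvP_28: "lvP = - evA + 2 * evP - odR - 7 * odS"
  unfolding lvP_def evP_eq evA_eq evB_eq evC_eq dil_1 using eis_1_even_odd dil_7_eis_1_even_odd
    by algebra

lemma lvA_28: "lvA = evA + 3 * odR + 21 * odS"
  unfolding lvA_def evP_eq evA_eq evB_eq evC_eq dil_1 using eis_1_even_odd dil_7_eis_1_even_odd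
    by algebra

lemma lvB_28: "lvB = 2 * evB - 3 * evC + 4 * odR - 28 * odS"
  unfolding lvB_def evP_eq evA_eq evB_eq evC_eq dil_1 using eis_1_even_odd dil_7_eis_1_even_odd
    by algebra

lemma lvC_28: "lvC = evC - 4 * odR + 28 * odS"
  unfolding lvC_def evP_eq evA_eq evB_eq evC_eq dil_1 using eis_1_even_odd dil_7_eis_1_even_odd
    by algebra

lemma lvH_28: "lvH = odK - evH"
  by (simp add: odK_def)

lemmas lv_28 = lvP_28 lvA_28 lvB_28 lvC_28 lvH_28

lemma XD_ev:
  "16 * fps_XD evP = 16 * evP ^ 2 - 16 * evA ^ 2 + evB ^ 2 - 9 * evC ^ 2"
  "3 * fps_XD evA = 2 * (3 * evP * evA - evB * evC - 5 * evC * evH)"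
  "fps_XD evB = 2 * (evP * evB - 3 * evA * evC)"
  "3 * fps_XD evC = 2 * (3 * evP * evC - evA * evB + 16 * evA * evH)"
  "fps_XD evH = 2 * evP * evH"
proof -
  have "2 * (16 * fps_XD evP) = 2 * dil 2 (32 * fps_XD lvP)"
    by (simp add: evP_def fps_XD_dil dil_2_distribs)
  also have "\<dots> = 2 * (16 * evP ^ 2 - 16 * evA ^ 2 + evB ^ 2 - 9 * evC ^ 2)"
    unfolding XD_lvP by (simp add: ev_defs dil_2_distribs dil_2_power2)
  finally show "16 * fps_XD evP = 16 * evP ^ 2 - 16 * evA ^ 2 + evB ^ 2 - 9 * evC ^ 2"
    by (rule fps_numeral_mult_cancel)
  have "3 * fps_XD evA = 2 * dil 2 (3 * fps_XD lvA)"
    by (simp add: evA_def fps_XD_dil dil_2_distribs)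
  then show "3 * fps_XD evA = 2 * (3 * evP * evA - evB * evC - 5 * evC * evH)"
    unfolding XD_lvA by (simp add: ev_defs dil_2_distribs)
  show "fps_XD evB = 2 * (evP * evB - 3 * evA * evC)"
    by (simp add: ev_defs fps_XD_dil dil_2_distribs XD_lvB)
  have "3 * fps_XD evC = 2 * dil 2 (3 * fps_XD lvC)"
    by (simp add: evC_def fps_XD_dil dil_2_distribs)
  then show "3 * fps_XD evC = 2 * (3 * evP * evC - evA * evB + 16 * evA * evH)"
    unfolding XD_lvC by (simp add: ev_defs dil_2_distribs)
  show "fps_XD evH = 2 * evP * evH"
    by (simp add: ev_defs fps_XD_dil dil_2_distribs XD_lvH)
qed

lemma evX1: "- 48 * evA ^ 2 + 7 * evB ^ 2 - 15 * evC ^ 2 - 112 * evH ^ 2 = 0"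
proof -
  have "dil 2 (- 48 * lvA ^ 2 + 7 * lvB ^ 2 - 15 * lvC ^ 2 - 112 * lvH ^ 2) = dil 2 0"
    by (rule arg_cong) (rule lvX1)
  then show ?thesis
    by (simp add: ev_defs dil_2_distribs dil_2_power2 fps_compose_uminus)
qed

lemma evX2: "- 3 * evA ^ 2 + 14 * evB * evH + 3 * evC ^ 2 + 7 * evH ^ 2 = 0"
proof -
  have "dil 2 (- 3 * lvA ^ 2 + 14 * lvB * lvH + 3 * lvC ^ 2 + 7 * lvH ^ 2) = dil 2 0"
    by (rule arg_cong) (rule lvX2)
  then show ?thesis
    by (simp add: ev_defs dil_2_distribs dil_2_power2 fps_compose_uminus)
qed

text \<open>The formulas for \<open>D lvB\<close> and \<open>D lvP\<close> do not involve \<open>lvH\<close>. Hence they contain only series of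
  known parity, and changing the sign of \<open>q\<close> doubles the number of equations.\<close>

lemma parity_eqs:
  "4*evA*evB - 12*evA*evC - 32*evA*evH - 8*evA * odR + 56*evA * odS + 2*evB * odR
    + 14*evB * odS + 6*evC * odR + 42*evC * odS - 8*evP * odR + 56*evP * odS - 32 * odR^2
    + 1568 * odS^2 + 4*fps_XD odR - 28*fps_XD odS = 0" (is "?e1 = 0")
  "192*evA * odR + 1344*evA * odS - 192*evA^2 + 100*evB*evC - 48*evB * odR + 336*evB * odS
    + 320*evC*evH - 144*evC * odR + 1008*evC * odS - 108*evC^2 + 192*evP * odR + 1344*evP * odS
    + 768 * odR^2 + 37632 * odS^2 - 96*fps_XD odR - 672*fps_XD odS = 0" (is "?e2 = 0")
proof -
  have "fps_XD (2*evB - 3*evC + 4 * odR - 28 * odS) = - 2*evA*evB + 8*evA * odR - 56*evA * odS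
    + 4*evB*evP - 2*evB * odR - 14*evB * odS - 6*evC*evP - 6*evC * odR - 42*evC * odS
    + 8*evP * odR - 56*evP * odS + 32 * odR^2 - 1568 * odS^2"
    (is "_ = ?r") using XD_lvB unfolding lv_28 by algebra
  then have "2 * fps_XD evB - 3 * fps_XD evC + 4 * fps_XD odR - 28 * fps_XD odS = ?r"
    by (simp only: fps_XD_numeral_mult fps_XD_add fps_XD_diff)
  then show "?e1 = 0"
    unfolding XD_ev by algebra
  have "32*fps_XD (- evA + 2*evP - odR - 7 * odS) = 16*(- evA + 2*evP - odR - 7 * odS)^2
    - 16*(evA + 3 * odR + 21 * odS)^2 + (2*evB - 3*evC + 4 * odR - 28 * odS)^2 - 9*(evC
    - 4 * odR + 28 * odS)^2"
    (is "_ = ?s") using XD_lvP unfolding lv_28 .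
  then have "32 * (- fps_XD evA + 2 * fps_XD evP - fps_XD odR - 7 * fps_XD odS) = ?s"
    by (simp only: fps_XD_numeral_mult fps_XD_add fps_XD_diff fps_XD_uminus)
  then have "12*(16*fps_XD evP) - 32*(3*fps_XD evA) - 96*fps_XD odR - 672*fps_XD odS = 3*?s"
    by algebra
  then show "?e2 = 0"
    unfolding XD_ev by algebra
qed

lemma parity_eqs_alt:
  "4*evA*evB - 12*evA*evC - 32*evA*evH + 8*evA * odR - 56*evA * odS - 2*evB * odR
    - 14*evB * odS - 6*evC * odR - 42*evC * odS + 8*evP * odR - 56*evP * odS - 32 * odR^2
    + 1568 * odS^2 - 4*fps_XD odR + 28*fps_XD odS = 0"
  "- 192*evA * odR - 1344*evA * odS - 192*evA^2 + 100*evB*evC + 48*evB * odR - 336*evB * odS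
    + 320*evC*evH + 144*evC * odR - 1008*evC * odS - 108*evC^2 - 192*evP * odR - 1344*evP * odS
    + 768 * odR^2 + 37632 * odS^2 + 96*fps_XD odR + 672*fps_XD odS = 0"
  using arg_cong[OF parity_eqs(1), of alt] arg_cong[OF parity_eqs(2), of alt]
  unfolding alt_add alt_diff alt_mult alt_numeral alt_power2 alt_XD alt_ev alt_odR alt_odS
    alt_0 fps_XD_uminus by (simp_all only: power2_minus) algebra+

text \<open>Subtracting the sign-changed equations leaves the odd parts, two linear equations for
  \<open>fps_XD odR\<close> and \<open>fps_XD odS\<close>; this and the next lemma are their
  solution. Adding them instead leaves the even parts, which give \<open>odR^2\<close> and
  \<open>odS^2\<close> in \<open>rel_rr\<close> and \<open>rel_ss\<close>.\<close>

lemma XD_odR_aux: "- 4*evA * odR + evB * odR + 3*evC * odR - 4*evP * odR + 2*fps_XD odR =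
  0" (is "?t = 0")
proof -
  have "192*?t = 24*(4*evA*evB - 12*evA*evC - 32*evA*evH - 8*evA * odR + 56*evA * odS
    + 2*evB * odR + 14*evB * odS + 6*evC * odR + 42*evC * odS - 8*evP * odR + 56*evP * odS
    - 32 * odR^2 + 1568 * odS^2 + 4*fps_XD odR - 28*fps_XD odS) - 1*(192*evA * odR
    + 1344*evA * odS - 192*evA^2 + 100*evB*evC - 48*evB * odR + 336*evB * odS + 320*evC*evH
    - 144*evC * odR + 1008*evC * odS - 108*evC^2 + 192*evP * odR + 1344*evP * odS + 768 * odR^2
    + 37632 * odS^2 - 96*fps_XD odR - 672*fps_XD odS) - 24*(4*evA*evB - 12*evA*evC - 32*evA*evH
    + 8*evA * odR - 56*evA * odS - 2*evB * odR - 14*evB * odS - 6*evC * odR - 42*evC * odS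
    + 8*evP * odR - 56*evP * odS - 32 * odR^2 + 1568 * odS^2 - 4*fps_XD odR + 28*fps_XD odS)
    + 1*(- 192*evA * odR - 1344*evA * odS - 192*evA^2 + 100*evB*evC + 48*evB * odR
    - 336*evB * odS + 320*evC*evH + 144*evC * odR - 1008*evC * odS - 108*evC^2 - 192*evP * odR
    - 1344*evP * odS + 768 * odR^2 + 37632 * odS^2 + 96*fps_XD odR + 672*fps_XD odS)"
    by algebra
  also have "\<dots> = 192 * 0"
    unfolding parity_eqs parity_eqs_alt evX1 evX2 by simp
  finally show ?thesis by (rule fps_numeral_mult_cancel)
qed

lemma XD_odS_aux: "- 4*evA * odS - evB * odS - 3*evC * odS - 4*evP * odS + 2*fps_XD odS =
  0" (is "?t = 0")
proof -
  have "1344*?t = - 24*(4*evA*evB - 12*evA*evC - 32*evA*evH - 8*evA * odR + 56*evA * odS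
    + 2*evB * odR + 14*evB * odS + 6*evC * odR + 42*evC * odS - 8*evP * odR + 56*evP * odS
    - 32 * odR^2 + 1568 * odS^2 + 4*fps_XD odR - 28*fps_XD odS) - 1*(192*evA * odR
    + 1344*evA * odS - 192*evA^2 + 100*evB*evC - 48*evB * odR + 336*evB * odS + 320*evC*evH
    - 144*evC * odR + 1008*evC * odS - 108*evC^2 + 192*evP * odR + 1344*evP * odS + 768 * odR^2
    + 37632 * odS^2 - 96*fps_XD odR - 672*fps_XD odS) + 24*(4*evA*evB - 12*evA*evC - 32*evA*evH
    + 8*evA * odR - 56*evA * odS - 2*evB * odR - 14*evB * odS - 6*evC * odR - 42*evC * odS
    + 8*evP * odR - 56*evP * odS - 32 * odR^2 + 1568 * odS^2 - 4*fps_XD odR + 28*fps_XD odS)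
    + 1*(- 192*evA * odR - 1344*evA * odS - 192*evA^2 + 100*evB*evC + 48*evB * odR
    - 336*evB * odS + 320*evC*evH + 144*evC * odR - 1008*evC * odS - 108*evC^2 - 192*evP * odR
    - 1344*evP * odS + 768 * odR^2 + 37632 * odS^2 + 96*fps_XD odR + 672*fps_XD odS)"
    by algebra
  also have "\<dots> = 1344 * 0"
    unfolding parity_eqs parity_eqs_alt evX1 evX2 by simp
  finally show ?thesis by (rule fps_numeral_mult_cancel)
qed

lemma rel_rr: "- 24*evA*evB + 72*evA*evC + 192*evA*evH - 48*evA^2 + 25*evB*evC + 80*evC*evH
  - 27*evC^2 + 384 * odR^2 = 0" (is "?t = 0")
proof -
  have "8*?t = - 24*(4*evA*evB - 12*evA*evC - 32*evA*evH - 8*evA * odR + 56*evA * odS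
    + 2*evB * odR + 14*evB * odS + 6*evC * odR + 42*evC * odS - 8*evP * odR + 56*evP * odS
    - 32 * odR^2 + 1568 * odS^2 + 4*fps_XD odR - 28*fps_XD odS) + 1*(192*evA * odR
    + 1344*evA * odS - 192*evA^2 + 100*evB*evC - 48*evB * odR + 336*evB * odS + 320*evC*evH
    - 144*evC * odR + 1008*evC * odS - 108*evC^2 + 192*evP * odR + 1344*evP * odS + 768 * odR^2
    + 37632 * odS^2 - 96*fps_XD odR - 672*fps_XD odS) - 24*(4*evA*evB - 12*evA*evC - 32*evA*evH
    + 8*evA * odR - 56*evA * odS - 2*evB * odR - 14*evB * odS - 6*evC * odR - 42*evC * odS
    + 8*evP * odR - 56*evP * odS - 32 * odR^2 + 1568 * odS^2 - 4*fps_XD odR + 28*fps_XD odS)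
    + 1*(- 192*evA * odR - 1344*evA * odS - 192*evA^2 + 100*evB*evC + 48*evB * odR
    - 336*evB * odS + 320*evC*evH + 144*evC * odR - 1008*evC * odS - 108*evC^2 - 192*evP * odR
    - 1344*evP * odS + 768 * odR^2 + 37632 * odS^2 + 96*fps_XD odR + 672*fps_XD odS)"
    by algebra
  also have "\<dots> = 8 * 0"
    unfolding parity_eqs parity_eqs_alt evX1 evX2 by simp
  finally show ?thesis by (rule fps_numeral_mult_cancel)
qed

lemma rel_ss: "24*evA*evB - 72*evA*evC - 192*evA*evH - 48*evA^2 + 25*evB*evC + 80*evC*evH
  - 27*evC^2 + 18816 * odS^2 = 0" (is "?t = 0")
proof -
  have "8*?t = 24*(4*evA*evB - 12*evA*evC - 32*evA*evH - 8*evA * odR + 56*evA * odS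
    + 2*evB * odR + 14*evB * odS + 6*evC * odR + 42*evC * odS - 8*evP * odR + 56*evP * odS
    - 32 * odR^2 + 1568 * odS^2 + 4*fps_XD odR - 28*fps_XD odS) + 1*(192*evA * odR
    + 1344*evA * odS - 192*evA^2 + 100*evB*evC - 48*evB * odR + 336*evB * odS + 320*evC*evH
    - 144*evC * odR + 1008*evC * odS - 108*evC^2 + 192*evP * odR + 1344*evP * odS + 768 * odR^2
    + 37632 * odS^2 - 96*fps_XD odR - 672*fps_XD odS) + 24*(4*evA*evB - 12*evA*evC - 32*evA*evH
    + 8*evA * odR - 56*evA * odS - 2*evB * odR - 14*evB * odS - 6*evC * odR - 42*evC * odS
    + 8*evP * odR - 56*evP * odS - 32 * odR^2 + 1568 * odS^2 - 4*fps_XD odR + 28*fps_XD odS)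
    + 1*(- 192*evA * odR - 1344*evA * odS - 192*evA^2 + 100*evB*evC + 48*evB * odR
    - 336*evB * odS + 320*evC*evH + 144*evC * odR - 1008*evC * odS - 108*evC^2 - 192*evP * odR
    - 1344*evP * odS + 768 * odR^2 + 37632 * odS^2 + 96*fps_XD odR + 672*fps_XD odS)"
    by algebra
  also have "\<dots> = 8 * 0"
    unfolding parity_eqs parity_eqs_alt evX1 evX2 by simp
  finally show ?thesis by (rule fps_numeral_mult_cancel)
qed

text \<open>A logarithmic derivative that is linear in the \<open>P(q^d)\<close>, as befits an eta
  quotient. This makes products with \<open>odR\<close> and \<open>odS\<close> accessible to the
  uniqueness argument \<open>fps_XD_unique\<close>.\<close>

lemma XD_odR: "2 * fps_XD odR = (4 * evP + 4 * evA - evB - 3 * evC) * odR"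
  using XD_odR_aux by algebra

lemma XD_odS: "2 * fps_XD odS = (4 * evP + 4 * evA + evB + 3 * evC) * odS"
  using XD_odS_aux by algebra

lemma ev_nth_0: "evP $ 0 = 1" "evA $ 0 = 1" "evB $ 0 = 3" "evC $ 0 = 1" "evH $ 0 = 0" "odR $ 0 =
  0" "odS $ 0 = 0" "odK $ 0 = 0"
  by (simp_all add: ev_defs dil_nth lv_nth_0 odR_def odS_def odK_def)

lemma odR_nonzero: "odR \<noteq> 0"
proof
  assume "odR = 0"
  then have "odR $ 1 = 0" by simp
  then show False by (simp add: odR_def eis_nth)
qed

text \<open>At the first order \<open>n\<close> where \<open>f\<close> and \<open>g\<close> could
  differ the equation reads \<open>(n - m) (f - g)_n = 0\<close>, so the coefficient
  \<open>m\<close> is the only free one. For an eta quotient \<open>m\<close> is its order of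
  vanishing.\<close>

lemma fps_XD_unique:
  fixes f g :: "real fps"
  assumes f: "numeral k * fps_XD f = M * f" and g: "numeral k * fps_XD g = M * g"
    and M: "M $ 0 = numeral k * real m" and m: "f $ m = g $ m"
  shows "f = g"
proof (rule fps_ext)
  fix n
  show "f $ n = g $ n"
  proof (induction n rule: less_induct)
    case (less n)
    show ?case
    proof (cases "n = m")
      case False
      have "numeral k * fps_XD (f - g) = M * (f - g)"
        using f g by (simp add: fps_XD_diff algebra_simps)
      then have "(numeral k * fps_XD (f - g)) $ n = (M * (f - g)) $ n" by simp
      moreover have "\<forall>j<n. (f - g) $ j = 0" using less by simp
      ultimately have "numeral k * (real n * (f - g) $ n) = numeral k * real m * (f - g) $ n"
        by (simp only: fps_numeral_mult_nth XD_nth fps_mult_nth_low M)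
      then have "numeral k * ((real n - real m) * (f - g) $ n) = 0" by (simp only: algebra_simps)
      with False show ?thesis by simp
    qed (simp add: m)
  qed
qed

lemma XD_lv_6:
  "6 * fps_XD lvA = 2 * (3 * lvP * lvA - lvB * lvC - 5 * lvC * lvH)"
  "6 * fps_XD lvB = 6 * (lvP * lvB - 3 * lvA * lvC)"
  "6 * fps_XD lvC = 2 * (3 * lvP * lvC - lvA * lvB + 16 * lvA * lvH)"
  "6 * fps_XD lvH = 6 * (lvP * lvH)"
proof -
  have 2: "6 * f = 2 * (3 * f)" for f :: "real fps" by algebra
  show "6 * fps_XD lvA = 2 * (3 * lvP * lvA - lvB * lvC - 5 * lvC * lvH)"
    unfolding 2[of "fps_XD lvA"] XD_lvA ..
  show "6 * fps_XD lvC = 2 * (3 * lvP * lvC - lvA * lvB + 16 * lvA * lvH)"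
    unfolding 2[of "fps_XD lvC"] XD_lvC ..
qed (simp_all only: XD_lvB XD_lvH)

lemma XD_odK: "fps_XD odK = evA*evH - evA * odK + evH * odR + 7*evH * odS + 2 * odK*evP
  - odK * odR - 7 * odK * odS"
proof -
  have "fps_XD odK = lvP * lvH + 2 * evP * evH"
    by (simp add: odK_def XD_lvH XD_ev(5) fps_XD_add)
  then show ?thesis unfolding lv_28 by algebra
qed

lemma XD_6:
  "6 * fps_XD evA = 12 * evA * evP - 4 * evB * evC - 20 * evC * evH" (is "?A")
  "6 * fps_XD evB = - 36 * evA * evC + 12 * evB * evP" (is "?B")
  "6 * fps_XD evC = - 4 * evA * evB + 64 * evA * evH + 12 * evC * evP" (is "?C")
  "6 * fps_XD evH = 12 * evH * evP" (is "?h")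
  "6 * fps_XD odR = 12 * evA * odR - 3 * evB * odR - 9 * evC * odR + 12 * evP * odR" (is "?r")
  "6 * fps_XD odS = 12 * evA * odS + 3 * evB * odS + 9 * evC * odS + 12 * evP * odS" (is "?s")
  "6*fps_XD odK = 6*evA*evH - 6*evA * odK + 6*evH * odR + 42*evH * odS + 12 * odK*evP
    - 6 * odK * odR - 42 * odK * odS" (is "?k")
proof -
  have 2: "6 * f = 2 * (3 * f)" and 3: "6 * f = 3 * (2 * f)" for f :: "real fps" by algebra+

  show "?A"
    unfolding 2[of "fps_XD evA"] XD_ev by algebra
  show "?B"
    unfolding XD_ev by algebra
  show "?C"
    unfolding 2[of "fps_XD evC"] XD_ev by algebra
  show "?h"
    unfolding XD_ev by algebra
  show "?r"
    unfolding 3[of "fps_XD odR"] XD_odR by algebra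
  show "?s"
    unfolding 3[of "fps_XD odS"] XD_odS by algebra
  show "?k"
    unfolding XD_odK by algebra
qed

lemma prefix_evA: "agrees evA [1, 0, 3, 0, 3, 0, 12, 0, 3, 0, 18, 0, 12, 0, 45]"
  unfolding evA_def by (rule agrees_cong[OF agrees_dil[OF prefix_lvA]]) (simp, code_simp)

lemma prefix_evB: "agrees evB [3, 0, 4, 0, 20, 0, 16, 0, 52, 0, 24, 0, 80, 0, 4]"
  unfolding evB_def by (rule agrees_cong[OF agrees_dil[OF prefix_lvB]]) (simp, code_simp)

lemma prefix_evC: "agrees evC [1, 0, -4, 0, -4, 0, -16, 0, -4, 0, -24, 0, -16, 0, -4]"
  unfolding evC_def by (rule agrees_cong[OF agrees_dil[OF prefix_lvC]]) (simp, code_simp)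

lemma prefix_evH: "agrees evH [0, 0, 1, 0, -1, 0, -2, 0, 1, 0, 0, 0, 2, 0, 1, 0]"
  unfolding evH_def by (rule agrees_cong[OF agrees_dil[OF prefix_lvH]]) (simp, code_simp)

lemma agrees_nth: "agrees f l \<Longrightarrow> i < length l \<Longrightarrow> f $ i =
  of_int (l ! i)"
  by (simp add: agrees_def)

lemma agrees_odd:
  "agrees f l \<Longrightarrow> agrees (Abs_fps (\<lambda>n. if odd n then f $ n else 0)) (map
    (\<lambda>n. if odd n then l ! n else 0) [0..<length l])"
  by (simp add: agrees_def)

lemma prefix_odR: "agrees odR [0, 1, 0, 4, 0, 6, 0, 8, 0, 13, 0, 12, 0, 14, 0]"
  unfolding odR_def by (rule agrees_cong[OF agrees_odd[OF prefix_eis_1]]) code_simp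

lemma prefix_odS: "agrees odS [0, 0, 0, 0, 0, 0, 0, 1, 0, 0, 0, 0, 0, 0, 0]"
  unfolding odS_def by (rule agrees_cong[OF agrees_dil[OF prefix_odR]]) (simp, code_simp)

lemma prefix_odK: "agrees odK [0, 1, 0, -2, 0, 0, 0, 1, 0, 1, 0, 0, 0, -4, 0, 0]"
  unfolding odK_def by (rule agrees_cong[OF agrees_add[OF prefix_lvH prefix_evH]]) code_simp

text \<open>Every product of two odd series is a quadratic polynomial in the even ones. The relations
  between odd series with even coefficients are obtained by multiplying with \<open>odR\<close>.\<close>

lemma XD_E_rs_aux: "- 1024*evA*evB*evH + 32*evA*evB^2 - 288*evA*evC^2 - 1024*evA*evH^2 =
  0" (is "?t = 0")
proof -
  have "7*?t = (32*evA)*(- 48*evA^2 + 7*evB^2 - 15*evC^2 - 112*evH^2) + (- 512*evA)*(- 3*evA^2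
    + 14*evB*evH + 3*evC^2 + 7*evH^2)"
    by algebra
  also have "\<dots> = 7 * 0"
    unfolding evX1 evX2 by simp
  finally have "?t = 0" by (rule fps_numeral_mult_cancel)
  then show ?thesis .
qed

text \<open>The bracket is the candidate for \<open>384 * odR * odS\<close>, and the factor on the
  right is 48 times the logarithmic derivative of that product. The cubic difference of both sides
  is the one shown to vanish in \<open>XD_E_rs_aux\<close>.\<close>

lemma XD_E_rs: "48*fps_XD (16*(evC*evH) + 3*(evC*evC) + 48*(evH*evH) - (evB*evC)) = (192*evA
  + 192*evP)*(16*(evC*evH) + 3*(evC*evC) + 48*(evH*evH) - (evB*evC))"
  (is "48 * fps_XD ?f = ?L * ?f")
proof -
  have d: "48*fps_XD ?f = 8*((- evC)*(6*fps_XD evB) + (- evB + 6*evC + 16*evH)*(6*fps_XD evC)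
    + (16*evC + 96*evH)*(6*fps_XD evH))"
    by (simp only: XD_simps) algebra
  have "48 * fps_XD ?f - ?L * ?f = 0"
    unfolding d XD_6 by (rule trans[OF _ XD_E_rs_aux]) algebra
  then show ?thesis by simp
qed

lemma prefix_E_rs: "agrees (16*(evC*evH) + 3*(evC*evC) + 48*(evH*evH)
  - (evB*evC)) [0, 0, 0, 0, 0, 0, 0, 0, 384, 0, 1536, 0, 2304, 0, 3072]"
  by (rule agrees_cong, (rule agrees_intros prefix_evB prefix_evC prefix_evH)+) code_simp

text \<open>Both sides of the relation solve the same first order equation. Since
  \<open>odR * odS\<close> begins with \<open>q^8\<close>, comparison of the coefficient 8
  decides.\<close>

lemma rel_rs: "evB * evC - 16 * evC * evH - 3 * evC ^ 2 - 48 * evH ^ 2 + 384 * odR * odS = 0"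
proof -
  have "48*fps_XD (384*(odR * odS)) = 384*24*(odS*(2*fps_XD odR) + odR*(2*fps_XD odS))"
    by (simp only: XD_simps) algebra
  also have "\<dots> = (192 * evA + 192 * evP) * (384 * (odR * odS))"
    unfolding XD_odR XD_odS by algebra
  finally have "48 * fps_XD (384 * (odR * odS)) = (192 * evA + 192 * evP) * (384 * (odR * odS))" .
  moreover have "48*fps_XD (16*(evC*evH) + 3*(evC*evC) + 48*(evH*evH) - (evB*evC)) = (192*evA
    + 192*evP)*(16*(evC*evH) + 3*(evC*evC) + 48*(evH*evH) - (evB*evC))"
    by (rule XD_E_rs)
  moreover have "(192 * evA + 192 * evP) $ 0 = 48 * real 8"
    by (simp add: ev_nth_0 fps_numeral_mult_nth)
  moreover have "agrees (384 * (odR * odS)) [0, 0, 0, 0, 0, 0, 0, 0, 384, 0, 1536, 0, 2304, 0,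
    3072]"
    by (rule agrees_cong, (rule agrees_intros prefix_odR prefix_odS)+) code_simp
  then have "(384*(odR * odS)) $ 8 = (16*(evC*evH) + 3*(evC*evC) + 48*(evH*evH) - (evB*evC)) $ 8"
    using prefix_E_rs by (simp add: agrees_def)
  ultimately have "384*(odR * odS) = 16*(evC*evH) + 3*(evC*evC) + 48*(evH*evH) - (evB*evC)"
    by (rule fps_XD_unique)
  then show ?thesis by algebra
qed

lemma XD_E_kr_aux: "1840*evA*evB*evH - 144*evA*evC*evH + 384*evA*evC^2 - 384*evA*evH * odR
  + 2688*evA*evH * odS + 512*evA*evH^2 + 192*evA^2*evB + 576*evA^2*evC - 384*evA^2*evH
  + 384*evA^2 * odR + 2688*evA^2 * odS - 384*evA^3 - 2752*evB*evC*evH - 192*evB*evC^2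
  - 1680*evB*evH * odR - 11760*evB*evH * odS - 840*evB^2*evH + 48*evC*evH * odR
  + 336*evC*evH * odS - 1280*evC*evH^2 + 72*evC^2*evH - 384*evC^2 * odR - 2688*evC^2 * odS
  - 576*evC^3 - 5376*evH * odR * odS - 768*evH * odR^2 = 0" (is "?t = 0")
proof -
  \<comment> \<open>Multiplication by \<open>odR\<close> turns single odd factors into
    \<open>odR^2\<close> and \<open>odR * odS\<close>, to which \<open>rel_rr\<close> and
    \<open>rel_rs\<close> apply.\<close>
  have "168*(odR*?t) = (- 168*evA*evH + 168*evA^2 - 735*evB*evH + 21*evC*evH - 168*evC^2
    - 336*evH * odR)*(- 24*evA*evB + 72*evA*evC + 192*evA*evH - 48*evA^2 + 25*evB*evC
    + 80*evC*evH - 27*evC^2 + 384 * odR^2) + (1176*evA*evH + 1176*evA^2 - 5145*evB*evH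
    + 147*evC*evH - 1176*evC^2 - 2352*evH * odR)*(evB*evC - 16*evC*evH - 3*evC^2 - 48*evH^2
    + 384 * odR * odS) + (168*evA*evH - 480*evA^2 + 2240*evB*evH - 224*evC*evH + 480*evC^2
    + 1344*evH * odR)*(- 48*evA^2 + 7*evB^2 - 15*evC^2 - 112*evH^2) + (- 1344*evA*evB
    + 4032*evA*evC + 10752*evA*evH + 21504*evA * odR + 4992*evA^2 + 1792*evB*evC + 560*evB*evH
    - 10752*evB * odR - 1120*evB^2 - 2576*evC*evH - 32256*evC * odR - 288*evC^2
    + 5376*evH * odR)*(- 3*evA^2 + 14*evB*evH + 3*evC^2 + 7*evH^2)"
    by algebra
  also have "\<dots> = 168 * 0"
    unfolding rel_rr rel_rs evX1 evX2 by simp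
  finally have "odR * ?t = 0" by (rule fps_numeral_mult_cancel)
  then show ?thesis using odR_nonzero by simp
qed

lemma XD_E_kr: "48*fps_XD (8*(evA*evH) + 8*(evA*evA) + (evC*evH) - 35*(evB*evH) - 8*(evC*evC)
  - 16*(evH * odR)) = (48*evA - 24*evB - 72*evC + 192*evP - 48 * odR - 336 * odS)*(8*(evA*evH)
  + 8*(evA*evA) + (evC*evH) - 35*(evB*evH) - 8*(evC*evC) - 16*(evH * odR))"
  (is "48 * fps_XD ?f = ?L * ?f")
proof -
  have d: "48*fps_XD ?f = 8*((16*evA + 8*evH)*(6*fps_XD evA) + (- 35*evH)*(6*fps_XD evB)
    + (- 16*evC + evH)*(6*fps_XD evC) + (8*evA - 35*evB + evC - 16 * odR)*(6*fps_XD evH)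
    + (- 16*evH)*(6*fps_XD odR))"
    by (simp only: XD_simps) algebra
  have "48 * fps_XD ?f - ?L * ?f = 0"
    unfolding d XD_6 by (rule trans[OF _ XD_E_kr_aux]) algebra
  then show ?thesis by simp
qed

lemma prefix_E_kr: "agrees (8*(evA*evH) + 8*(evA*evA) + (evC*evH) - 35*(evB*evH) - 8*(evC*evC)
  - 16*(evH * odR)) [0, 0, 16, -16, 32, -48, -32, 0, -48, 80, 32, 48, -64, 144, 0]"
  by (rule agrees_cong, (rule agrees_intros prefix_evA prefix_evB prefix_evC prefix_evH
    prefix_odR)+) code_simp

text \<open>The uniqueness argument is applied to \<open>lvH * odR\<close>, because
  \<open>lvH = odK - evH\<close> is an eta product and has \<open>lvP\<close> as logarithmic
  derivative. The extra term \<open>- 16 * evH * odR\<close> of the candidate disappears on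
  returning to \<open>odK\<close>.\<close>

lemma rel_kr: "- 8*evA*evH - 8*evA^2 + 35*evB*evH - evC*evH + 8*evC^2 + 16 * odK * odR = 0"
proof -
  have "48 * fps_XD (16 * (lvH * odR)) = 384 * (2 * odR * fps_XD lvH + lvH * (2 * fps_XD odR))"
    by (simp only: XD_simps) algebra
  also have "\<dots> = (48*evA - 24*evB - 72*evC + 192*evP - 48 * odR
    - 336 * odS)*(16*(lvH * odR))"
    unfolding XD_odR XD_lvH unfolding lv_28 by algebra
  finally have "48*fps_XD (16*(lvH * odR)) = (48*evA - 24*evB - 72*evC + 192*evP - 48 * odR
    - 336 * odS)*(16*(lvH * odR))" .
  moreover note XD_E_kr
  moreover have "(48*evA - 24*evB - 72*evC + 192*evP - 48 * odR - 336 * odS) $ 0 = 48*real 2"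
    by (simp add: ev_nth_0 fps_numeral_mult_nth)
  moreover have "agrees (16 * (lvH * odR)) [0, 0, 16, -16, 32, -48, -32, 0, -48, 80, 32, 48, -64,
    144, 0]"
    by (rule agrees_cong, (rule agrees_intros prefix_lvH prefix_odR)+) code_simp
  then have "(16*(lvH * odR)) $ 2 = (8*(evA*evH) + 8*(evA*evA) + (evC*evH) - 35*(evB*evH)
    - 8*(evC*evC) - 16*(evH * odR)) $ 2"
    using prefix_E_kr by (simp add: agrees_def)
  ultimately have "16*(lvH * odR) = 8*(evA*evH) + 8*(evA*evA) + (evC*evH) - 35*(evB*evH)
    - 8*(evC*evC) - 16*(evH * odR)"
    by (rule fps_XD_unique)
  then show ?thesis unfolding lv_28 by algebra
qed

text \<open>\<open>odR^2 * (odK * odS)\<close> is \<open>(odK * odR) * (odR * odS)\<close>, and both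
  of these products, as well as \<open>odR^2\<close>, are already known in even terms.\<close>

lemma rel_ks: "- 8*evA*evH + 8*evA^2 - 35*evB*evH + evC*evH - 8*evC^2 + 112 * odK * odS =
  0" (is "?t = 0")
proof -
  have "8064*(odR * odR*?t) = (56448 * odR * odS)*(- 8*evA*evH - 8*evA^2 + 35*evB*evH - evC*evH
    + 8*evC^2 + 16 * odK * odR) + (1176*evA*evH + 1176*evA^2 - 5145*evB*evH + 147*evC*evH
    - 1176*evC^2)*(evB*evC - 16*evC*evH - 3*evC^2 - 48*evH^2 + 384 * odR * odS)
    + (- 168*evA*evH + 168*evA^2 - 735*evB*evH + 21*evC*evH - 168*evC^2)*(- 24*evA*evB
    + 72*evA*evC + 192*evA*evH - 48*evA^2 + 25*evB*evC + 80*evC*evH - 27*evC^2 + 384 * odR^2)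
    + (168*evA*evH - 480*evA^2 + 2240*evB*evH - 224*evC*evH + 480*evC^2)*(- 48*evA^2 + 7*evB^2
    - 15*evC^2 - 112*evH^2) + (- 1344*evA*evB + 4032*evA*evC + 10752*evA*evH + 4992*evA^2
    + 1792*evB*evC + 560*evB*evH - 1120*evB^2 - 2576*evC*evH - 288*evC^2)*(- 3*evA^2
    + 14*evB*evH + 3*evC^2 + 7*evH^2)"
    by algebra
  also have "\<dots> = 8064 * 0"
    unfolding rel_kr rel_rs rel_rr evX1 evX2 by simp
  finally have "odR * odR * ?t = 0" by (rule fps_numeral_mult_cancel)
  then show ?thesis using odR_nonzero by simp
qed

text \<open>\<open>odR^2 * odK^2\<close> is the square of \<open>odK * odR\<close>, which is known
  from \<open>rel_kr\<close>.\<close>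

lemma rel_kk: "- evB * evH - 3 * evC * evH + 10 * evH ^ 2 + 6 * odK ^ 2 = 0" (is "?t = 0")
proof -
  have "2688*(odR * odR*?t) = (504*evA*evH + 504*evA^2 - 2205*evB*evH + 63*evC*evH - 504*evC^2
    + 1008 * odK * odR)*(- 8*evA*evH - 8*evA^2 + 35*evB*evH - evC*evH + 8*evC^2
    + 16 * odK * odR) + (- 7*evB*evH - 21*evC*evH + 70*evH^2)*(- 24*evA*evB + 72*evA*evC
    + 192*evA*evH - 48*evA^2 + 25*evB*evC + 80*evC*evH - 27*evC^2 + 384 * odR^2)
    + (- 24*evA*evH - 75*evA^2 + 350*evB*evH + 25*evC*evH + 75*evC^2)*(- 48*evA^2 + 7*evB^2
    - 15*evC^2 - 112*evH^2) + (- 2304*evA*evH - 144*evA^2 + 5600*evB*evH - 175*evB^2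
    - 400*evC*evH + 1719*evC^2)*(- 3*evA^2 + 14*evB*evH + 3*evC^2 + 7*evH^2)"
    by algebra
  also have "\<dots> = 2688 * 0"
    unfolding rel_kr rel_rr evX1 evX2 by simp
  finally have "odR * odR * ?t = 0" by (rule fps_numeral_mult_cancel)
  then show ?thesis using odR_nonzero by simp
qed

section \<open>The Eisenstein series of level 28 in the even and odd generators\<close>

lemma ramT_double: "d > 0 \<Longrightarrow> ramT (2 * d) = 2 * dil 2 (ramT d)"
  by (simp add: ramT_def dil_2_distribs dil_dil fps_of_nat[symmetric] del: One_nat_def)

lemma ramS_double: "d > 0 \<Longrightarrow> ramS (2 * d) = 4 * dil 2 (ramS d)"
  by (simp add: ramS_def dil_2_distribs dil_2_power2 dil_dil fps_of_nat[symmetric]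
    power_mult_distrib del: One_nat_def)

lemma ramS_lv:
  "ramS 1 = 24*lvA*lvB - 120*lvA*lvC - 192*lvA*lvH + 80*lvA^2 - 25*lvB*lvC - 80*lvC*lvH
    + 45*lvC^2"
  "ramS 2 = - 24*lvA*lvB - 120*lvA*lvC + 192*lvA*lvH + 80*lvA^2 + 25*lvB*lvC + 80*lvC*lvH
    + 45*lvC^2"
  "ramS 7 = - 24*lvA*lvB + 120*lvA*lvC + 192*lvA*lvH + 80*lvA^2 - 25*lvB*lvC - 80*lvC*lvH
    + 45*lvC^2"
  "ramS 14 = 24*lvA*lvB + 120*lvA*lvC - 192*lvA*lvH + 80*lvA^2 + 25*lvB*lvC + 80*lvC*lvH
    + 45*lvC^2"
  unfolding ramS_eqs level14_defects by simp_all

lemma ramT_1_28: "ramT 1 = - 16 * evA - 6 * evB + 12 * evC + 24 * evP - 48 * odR"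
  unfolding ramT_eqs lv_28 by algebra

lemma ramS_1_28: "ramS 1 = 48*evA*evB - 192*evA*evC + 192*evA*evH - 192*evA * odK
  + 1056*evA * odR - 672*evA * odS + 80*evA^2 - 50*evB*evC + 344*evB * odR - 392*evB * odS
  + 80*evC*evH - 80*evC * odK - 1336*evC * odR + 1288*evC * odS + 120*evC^2 + 256*evH * odR
  + 6272*evH * odS - 256 * odK * odR - 6272 * odK * odS - 5600 * odR * odS + 3568 * odR^2
  + 5488 * odS^2"
  unfolding ramS_lv lv_28 by algebra

lemma ramT_7_28: "ramT 7 = - 16 * evA + 6 * evB - 12 * evC + 24 * evP - 336 * odS"
  unfolding ramT_eqs lv_28 by algebra

lemma ramS_7_28: "ramS 7 = - 48*evA*evB + 192*evA*evC - 192*evA*evH + 192*evA * odK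
  - 96*evA * odR + 7392*evA * odS + 80*evA^2 - 50*evB*evC + 56*evB * odR - 2408*evB * odS
  + 80*evC*evH - 80*evC * odK - 184*evC * odR + 9352*evC * odS + 120*evC^2 - 896*evH * odR
  - 1792*evH * odS + 896 * odK * odR + 1792 * odK * odS - 5600 * odR * odS + 112 * odR^2
  + 174832 * odS^2"
  unfolding ramS_lv lv_28 by algebra

text \<open>\<open>ramT 2\<close> is even in \<open>q\<close>. Computing it as a dilation of
  \<open>ramT 1\<close> yields an expression in even generators only, unlike a substitution of
  \<open>lv_28\<close>.\<close>

lemma ramT_2_28: "ramT 2 = - 8 * evA - 6 * evB + 6 * evC + 24 * evP"
  (is "_ = ?r")
proof -
  have "ramT 2 = 2 * dil 2 (ramT 1)" using ramT_double[of 1] by simp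
  also have "\<dots> = ?r"
    unfolding ramT_eqs dil_2_distribs fps_compose_uminus ev_defs[symmetric] by algebra
  finally show ?thesis .
qed

lemma ramS_2_28: "ramS 2 = 96*evA*evB - 480*evA*evC - 768*evA*evH + 320*evA^2 - 100*evB*evC
  - 320*evC*evH + 180*evC^2"
  (is "_ = ?r")
proof -
  have "ramS 2 = 4 * dil 2 (ramS 1)" using ramS_double[of 1] by simp
  also have "\<dots> = ?r"
    unfolding ramS_lv dil_2_distribs dil_2_power2 fps_compose_uminus ev_defs[symmetric] by algebra
  finally show ?thesis .
qed

lemma ramT_4_28: "ramT 4 = 8 * evA - 6 * evB - 6 * evC + 24 * evP"
  (is "_ = ?r")
proof -
  have "ramT 4 = 2 * dil 2 (ramT 2)" using ramT_double[of 2] by simp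
  also have "\<dots> = ?r"
    unfolding ramT_eqs dil_2_distribs fps_compose_uminus ev_defs[symmetric] by algebra
  finally show ?thesis .
qed

lemma ramS_4_28: "ramS 4 = - 96*evA*evB - 480*evA*evC + 768*evA*evH + 320*evA^2 + 100*evB*evC
  + 320*evC*evH + 180*evC^2"
  (is "_ = ?r")
proof -
  have "ramS 4 = 4 * dil 2 (ramS 2)" using ramS_double[of 2] by simp
  also have "\<dots> = ?r"
    unfolding ramS_lv dil_2_distribs dil_2_power2 fps_compose_uminus ev_defs[symmetric] by algebra
  finally show ?thesis .
qed

lemma ramT_14_28: "ramT 14 = - 8 * evA + 6 * evB - 6 * evC + 24 * evP"
  (is "_ = ?r")
proof -
  have "ramT 14 = 2 * dil 2 (ramT 7)" using ramT_double[of 7] by simp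
  also have "\<dots> = ?r"
    unfolding ramT_eqs dil_2_distribs fps_compose_uminus ev_defs[symmetric] by algebra
  finally show ?thesis .
qed

lemma ramS_14_28: "ramS 14 = - 96*evA*evB + 480*evA*evC + 768*evA*evH + 320*evA^2 - 100*evB*evC
  - 320*evC*evH + 180*evC^2"
  (is "_ = ?r")
proof -
  have "ramS 14 = 4 * dil 2 (ramS 7)" using ramS_double[of 7] by simp
  also have "\<dots> = ?r"
    unfolding ramS_lv dil_2_distribs dil_2_power2 fps_compose_uminus ev_defs[symmetric] by algebra
  finally show ?thesis .
qed

lemma ramT_28_28: "ramT 28 = 8 * evA + 6 * evB + 6 * evC + 24 * evP"
  (is "_ = ?r")
proof -
  have "ramT 28 = 2 * dil 2 (ramT 14)" using ramT_double[of 14] by simp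
  also have "\<dots> = ?r"
    unfolding ramT_eqs dil_2_distribs fps_compose_uminus ev_defs[symmetric] by algebra
  finally show ?thesis .
qed

lemma ramS_28_28: "ramS 28 = 96*evA*evB + 480*evA*evC - 768*evA*evH + 320*evA^2 + 100*evB*evC
  + 320*evC*evH + 180*evC^2"
  (is "_ = ?r")
proof -
  have "ramS 28 = 4 * dil 2 (ramS 14)" using ramS_double[of 14] by simp
  also have "\<dots> = ?r"
    unfolding ramS_lv dil_2_distribs dil_2_power2 fps_compose_uminus ev_defs[symmetric] by algebra
  finally show ?thesis .
qed

lemmas ram_28 = ramT_1_28 ramT_2_28 ramT_4_28 ramT_7_28 ramT_14_28 ramT_28_28 ramS_1_28 ramS_2_28
  ramS_4_28 ramS_7_28 ramS_14_28 ramS_28_28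

text \<open>A list of pairs \<open>(d, k)\<close> encodes the product of the \<open>\<eta>(d z)\<^sup>k\<close> without its power of \<open>q\<close>.\<close>

definition eprod :: "(nat \<times> nat) list \<Rightarrow> 'a::comm_ring_1 fps" where
  "eprod us = (\<Prod>(d, k)\<leftarrow>us. dil d euler ^ k)"

text \<open>\<open>m\<close> stands for the total power of \<open>q\<close>, that is one 24th of the
  difference of the sums of the \<open>d k\<close>. The coefficient field stays open because the
  identities are proved over the reals and the convergence over the complex numbers.\<close>

definition etaq :: "nat \<Rightarrow> (nat \<times> nat) list \<Rightarrow> (nat \<times> nat)
  list \<Rightarrow> 'a::field fps" where
  "etaq m us vs = fps_X ^ m * (eprod us * inverse (eprod vs))"

lemma eprod_Nil [simp]: "eprod [] = 1"
  and eprod_Cons: "eprod ((d, k) # us) = dil d euler ^ k * eprod us"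
  by (simp_all add: eprod_def)

lemma eprod_nth_0: "\<forall>u\<in>set us. fst u > 0 \<Longrightarrow> eprod us $ 0 =
  (1 :: 'a::comm_ring_1)"
  by (induction us) (auto simp: eprod_Cons fps_power_zeroth dil_nth)

text \<open>48 times the logarithmic derivative of \<open>eprod us\<close>:
  \<open>ramT d - 2 d\<close> is \<open>- 48 d * dil d (eis 1)\<close>.\<close>

definition elog :: "(nat \<times> nat) list \<Rightarrow> real fps" where
  "elog us = (\<Sum>(d, k)\<leftarrow>us. of_nat k * (ramT d - 2 * of_nat d))"

lemma elog_Nil [simp]: "elog [] = 0"
  and elog_Cons: "elog ((d, k) # us) = of_nat k * (ramT d - 2 * of_nat d) + elog us"
  by (simp_all add: elog_def)

lemma XD_dil_euler_power: "d > 0 \<Longrightarrow> 48 * fps_XD (dil d euler ^ k) =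
  of_nat k * (ramT d - 2 * of_nat d) * dil d euler ^ k"
proof (cases k)
  case (Suc j)
  assume "d > 0"
  have "fps_XD (dil d euler ^ Suc j :: real fps) =
    of_nat (Suc j) * dil d euler ^ j * fps_XD (dil d euler)"
    by (subst fps_XD_power) simp
  with Suc \<open>d > 0\<close> show ?thesis
    by (simp add: XD_dil_euler ramT_def algebra_simps del: of_nat_Suc)
qed simp

lemma XD_eprod:
  "\<forall>u\<in>set us. fst u > 0 \<Longrightarrow> 48 * fps_XD (eprod us) = elog us * eprod us"
proof (induction us)
  case (Cons u us)
  obtain d k where u: "u = (d, k)" by fastforce
  have "48 * fps_XD (eprod (u # us)) =
      (48 * fps_XD (dil d euler ^ k)) * eprod us + dil d euler ^ k * (48 * fps_XD (eprod us))"
    by (simp add: u eprod_Cons fps_XD_mult algebra_simps)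
  also have "\<dots> = elog (u # us) * eprod (u # us)"
    using Cons by (subst XD_dil_euler_power) (auto simp: u eprod_Cons elog_Cons algebra_simps)
  finally show ?case .
qed simp

lemma XD_etaq:
  assumes us: "\<forall>u\<in>set us. fst u > 0" and vs: "\<forall>u\<in>set vs. fst u > 0"
  shows "48 * fps_XD (etaq m us vs) = (of_nat (48 * m) + elog us - elog vs) * etaq m us vs"
proof -
  have v: "eprod vs $ 0 = (1 :: real)" using vs by (rule eprod_nth_0)
  then have inv: "inverse (eprod vs) * eprod vs = (1 :: real fps)"
    by (intro inverse_mult_eq_1) simp
  have "fps_XD (inverse (eprod vs :: real fps)) = - fps_XD (eprod vs) * inverse (eprod vs) ^ 2"
    using v by (simp add: fps_XD_def fps_inverse_deriv)
  then have "48 * fps_XD (inverse (eprod vs :: real fps)) =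
    - (48 * fps_XD (eprod vs)) * inverse (eprod vs) ^ 2"
    by simp
  also have "\<dots> = - elog vs * inverse (eprod vs) * (inverse (eprod vs) * eprod vs)"
    unfolding XD_eprod[OF vs] by (simp add: power2_eq_square algebra_simps)
  finally have i: "48 * fps_XD (inverse (eprod vs :: real fps)) = - elog vs * inverse (eprod vs)"
    by (simp add: inv)
  have x: "fps_XD (fps_X ^ m :: real fps) = of_nat m * fps_X ^ m"
    by (rule fps_ext) (simp add: fps_of_nat[symmetric])
  have "48 * fps_XD (etaq m us vs) = 48 * fps_XD (fps_X ^ m) * (eprod us * inverse (eprod vs)) +
     fps_X ^ m * ((48 * fps_XD (eprod us)) * inverse (eprod vs)
       + eprod us * (48 * fps_XD (inverse (eprod vs))))"
    by (simp add: etaq_def fps_XD_mult algebra_simps)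
  also have "\<dots> = (of_nat (48 * m) + elog us - elog vs) * etaq m us vs"
    unfolding x i XD_eprod[OF us] by (simp add: etaq_def algebra_simps)
  finally show ?thesis .
qed

lemma etaq_nth:
  assumes us: "\<forall>u\<in>set us. fst u > 0" and vs: "\<forall>u\<in>set vs. fst u > 0"
  shows "etaq m us vs $ m = (1 :: 'a::field)"
  using eprod_nth_0[OF us, where 'a = 'a] eprod_nth_0[OF vs, where 'a = 'a]
  by (simp add: etaq_def fps_X_power_mult_nth)

section \<open>The nine eta quotients as quadratic polynomials in weight 2 forms\<close>

definition qC1 :: "'a::field fps" where
  "qC1 = etaq 1 [(1, 5), (7, 5)] [(2, 1), (14, 1)]"

lemma XD_qC1: "48 * fps_XD qC1 = (- 48 * lvA + 96 * lvP) * qC1"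
  (is "_ = ?L * _")
proof -
  have "48 * fps_XD qC1 = (of_nat (48 * 1) + elog [(1, 5), (7, 5)]
    - elog [(2, 1), (14, 1)]) * qC1"
    unfolding qC1_def by (rule XD_etaq) auto
  also have "of_nat (48 * 1) + elog [(1, 5), (7, 5)] - elog [(2, 1), (14, 1)] = ?L"
    unfolding elog_Cons elog_Nil ramT_eqs of_nat_numeral of_nat_1 of_nat_mult by algebra
  finally show ?thesis .
qed

text \<open>The candidate is \<open>lvH\<close> times \<open>lvB + 3 * lvC - 16 * lvH\<close>; the
  second factor is six times \<open>eta(z)^4 eta(7z)^4 / (eta(2z)^2 eta(14z)^2)\<close>, the
  quotient of \<open>C1\<close> by \<open>lvH\<close>.\<close>

lemma XD_quad_C1: "48*fps_XD ((lvB*lvH) + 3*(lvC*lvH) - 16*(lvH*lvH)) = (- 48*lvA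
  + 96*lvP)*((lvB*lvH) + 3*(lvC*lvH) - 16*(lvH*lvH))"
  (is "48 * fps_XD ?f = ?L * ?f")
proof -
  have "48*fps_XD ?f = 8*((lvH)*(6*fps_XD lvB) + (3*lvH)*(6*fps_XD lvC) + (lvB + 3*lvC
    - 32*lvH)*(6*fps_XD lvH))"
    by (simp only: XD_simps) algebra
  then have "2 * (48 * fps_XD ?f - ?L * ?f) = 0"
    unfolding XD_lv_6 by algebra
  also have "\<dots> = 2 * 0"
    unfolding lvX1 lvX2 by simp
  finally have "48 * fps_XD ?f - ?L * ?f = 0"
    by (rule fps_numeral_mult_cancel)
  then show ?thesis by simp
qed

lemma prefix_quad_C1: "agrees ((lvB * lvH) + 3 * (lvC * lvH)
  - 16 * (lvH * lvH)) [0, 6, -30, 36, 30, -48, -36, -42, 114, 150, -192, -144, 132, 120, 210]"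
  by (rule agrees_cong, (rule agrees_intros prefix_lvB prefix_lvC prefix_lvH)+) code_simp

text \<open>The factor 6 is the leading coefficient of the integral polynomial, whereas an eta
  quotient has leading coefficient 1.\<close>

lemma qC1_eq: "6 * qC1 = (lvB * lvH) + 3 * (lvC * lvH) - 16 * (lvH * lvH)" (is "?f = ?g")
proof (rule fps_XD_unique)
  show "48 * fps_XD ?f = (- 48 * lvA + 96 * lvP) * ?f"
    using XD_qC1 by (simp only: fps_XD_numeral_mult mult.left_commute)
  show "48 * fps_XD ?g = (- 48 * lvA + 96 * lvP) * ?g"
    by (rule XD_quad_C1)
  show "(- 48 * lvA + 96 * lvP) $ 0 = 48 * real 1"
    by (simp add: lv_nth_0 fps_numeral_mult_nth)
  have "qC1 $ 1 = (1 :: real)"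
    unfolding qC1_def by (rule etaq_nth) auto
  then have "?f $ 1 = (6 :: real)"
    by (simp only: fps_numeral_mult_nth)
  also have "\<dots> = real_of_int ([0, 6, -30, 36, 30, -48, -36, -42, 114, 150, -192, -144, 132,
    120, 210] ! 1)"
    by simp
  also have "\<dots> = ?g $ 1"
    by (rule agrees_nth[OF prefix_quad_C1, symmetric]) simp
  finally show "?f $ 1 = ?g $ 1" .
qed

definition qC2 :: "'a::field fps" where
  "qC2 = etaq 2 [(1, 2), (2, 2), (7, 2), (14, 2)] []"

lemma XD_qC2: "48 * fps_XD qC2 = (96 * lvP) * qC2"
  (is "_ = ?L * _")
proof -
  have "48 * fps_XD qC2 = (of_nat (48 * 2) + elog [(1, 2), (2, 2), (7, 2), (14, 2)]
    - elog []) * qC2"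
    unfolding qC2_def by (rule XD_etaq) auto
  also have "of_nat (48 * 2) + elog [(1, 2), (2, 2), (7, 2), (14, 2)] - elog [] = ?L"
    unfolding elog_Cons elog_Nil ramT_eqs of_nat_numeral of_nat_1 of_nat_mult by algebra
  finally show ?thesis .
qed

lemma XD_quad_C2: "48 * fps_XD ((lvH * lvH)) = (96 * lvP) * ((lvH * lvH))"
  (is "48 * fps_XD ?f = ?L * ?f")
proof -
  have "48 * fps_XD ?f = 8 * ((2 * lvH) * (6 * fps_XD lvH))"
    by (simp only: XD_simps) algebra
  then have "2 * (48 * fps_XD ?f - ?L * ?f) = 0"
    unfolding XD_lv_6 by algebra
  also have "\<dots> = 2 * 0"
    unfolding lvX1 lvX2 by simp
  finally have "48 * fps_XD ?f - ?L * ?f = 0"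
    by (rule fps_numeral_mult_cancel)
  then show ?thesis by simp
qed

lemma prefix_quad_C2: "agrees ((lvH * lvH)) [0, 0, 1, -2, -3, 6, 2, 0, -1, -12, 4, 4, -2, 2, -7,
  16]"
  by (rule agrees_cong, (rule agrees_intros prefix_lvH)+) code_simp

lemma qC2_eq: "qC2 = (lvH * lvH)" (is "?f = ?g")
proof (rule fps_XD_unique)
  show "48 * fps_XD ?f = (96 * lvP) * ?f"
    using XD_qC2 .
  show "48 * fps_XD ?g = (96 * lvP) * ?g"
    by (rule XD_quad_C2)
  show "(96 * lvP) $ 0 = 48 * real 2"
    by (simp add: lv_nth_0 fps_numeral_mult_nth)
  have "qC2 $ 2 = (1 :: real)"
    unfolding qC2_def by (rule etaq_nth) auto
  then have "?f $ 2 = (1 :: real)"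
    by simp
  also have "\<dots> = real_of_int ([0, 0, 1, -2, -3, 6, 2, 0, -1, -12, 4, 4, -2, 2, -7, 16] ! 2)"
    by simp
  also have "\<dots> = ?g $ 2"
    by (rule agrees_nth[OF prefix_quad_C2, symmetric]) simp
  finally show "?f $ 2 = ?g $ 2" .
qed

definition qC3 :: "'a::field fps" where
  "qC3 = etaq 3 [(1, 6), (14, 6)] [(2, 2), (7, 2)]"

lemma XD_qC3: "48 * fps_XD qC3 = (48 * lvC + 96 * lvP) * qC3"
  (is "_ = ?L * _")
proof -
  have "48 * fps_XD qC3 = (of_nat (48 * 3) + elog [(1, 6), (14, 6)]
    - elog [(2, 2), (7, 2)]) * qC3"
    unfolding qC3_def by (rule XD_etaq) auto
  also have "of_nat (48 * 3) + elog [(1, 6), (14, 6)] - elog [(2, 2), (7, 2)] = ?L"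
    unfolding elog_Cons elog_Nil ramT_eqs of_nat_numeral of_nat_1 of_nat_mult by algebra
  finally show ?thesis .
qed

lemma XD_quad_C3: "48*fps_XD ((lvB*lvH) + 5*(lvH*lvH) - 3*(lvA*lvH)) = (48*lvC
  + 96*lvP)*((lvB*lvH) + 5*(lvH*lvH) - 3*(lvA*lvH))"
  (is "48 * fps_XD ?f = ?L * ?f")
proof -
  have "48*fps_XD ?f = 8*((- 3*lvH)*(6*fps_XD lvA) + (lvH)*(6*fps_XD lvB) + (- 3*lvA + lvB
    + 10*lvH)*(6*fps_XD lvH))"
    by (simp only: XD_simps) algebra
  then have "2 * (48 * fps_XD ?f - ?L * ?f) = 0"
    unfolding XD_lv_6 by algebra
  also have "\<dots> = 2 * 0"
    unfolding lvX1 lvX2 by simp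
  finally have "48 * fps_XD ?f - ?L * ?f = 0"
    by (rule fps_numeral_mult_cancel)
  then show ?thesis by simp
qed

lemma prefix_quad_C3: "agrees ((lvB * lvH) + 5 * (lvH * lvH)
  - 3 * (lvA * lvH)) [0, 0, 0, 6, -36, 66, -12, -42, -60, 36, 204, -180, 96, -90, -84]"
  by (rule agrees_cong, (rule agrees_intros prefix_lvA prefix_lvB prefix_lvH)+) code_simp

lemma qC3_eq: "6 * qC3 = (lvB * lvH) + 5 * (lvH * lvH) - 3 * (lvA * lvH)" (is "?f = ?g")
proof (rule fps_XD_unique)
  show "48 * fps_XD ?f = (48 * lvC + 96 * lvP) * ?f"
    using XD_qC3 by (simp only: fps_XD_numeral_mult mult.left_commute)
  show "48 * fps_XD ?g = (48 * lvC + 96 * lvP) * ?g"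
    by (rule XD_quad_C3)
  show "(48 * lvC + 96 * lvP) $ 0 = 48 * real 3"
    by (simp add: lv_nth_0 fps_numeral_mult_nth)
  have "qC3 $ 3 = (1 :: real)"
    unfolding qC3_def by (rule etaq_nth) auto
  then have "?f $ 3 = (6 :: real)"
    by (simp only: fps_numeral_mult_nth)
  also have "\<dots> = real_of_int ([0, 0, 0, 6, -36, 66, -12, -42, -60, 36, 204, -180, 96, -90,
    -84] ! 3)"
    by simp
  also have "\<dots> = ?g $ 3"
    by (rule agrees_nth[OF prefix_quad_C3, symmetric]) simp
  finally show "?f $ 3 = ?g $ 3" .
qed

definition qC4 :: "'a::field fps" where
  "qC4 = etaq 1 [(2, 6), (7, 6)] [(1, 2), (14, 2)]"

lemma XD_qC4: "48 * fps_XD qC4 = (- 48 * lvC + 96 * lvP) * qC4"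
  (is "_ = ?L * _")
proof -
  have "48 * fps_XD qC4 = (of_nat (48 * 1) + elog [(2, 6), (7, 6)]
    - elog [(1, 2), (14, 2)]) * qC4"
    unfolding qC4_def by (rule XD_etaq) auto
  also have "of_nat (48 * 1) + elog [(2, 6), (7, 6)] - elog [(1, 2), (14, 2)] = ?L"
    unfolding elog_Cons elog_Nil ramT_eqs of_nat_numeral of_nat_1 of_nat_mult by algebra
  finally show ?thesis .
qed

text \<open>The Atkin-Lehner involution at 2, which changes the signs of \<open>lvA\<close> and
  \<open>lvC\<close>, takes the candidate and the equation for \<open>qC3\<close> to these.\<close>

lemma XD_quad_C4: "48*fps_XD (3*(lvA*lvH) + (lvB*lvH) + 5*(lvH*lvH)) = (- 48*lvC
  + 96*lvP)*(3*(lvA*lvH) + (lvB*lvH) + 5*(lvH*lvH))"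
  (is "48 * fps_XD ?f = ?L * ?f")
proof -
  have "48*fps_XD ?f = 8*((3*lvH)*(6*fps_XD lvA) + (lvH)*(6*fps_XD lvB) + (3*lvA + lvB
    + 10*lvH)*(6*fps_XD lvH))"
    by (simp only: XD_simps) algebra
  then have "2 * (48 * fps_XD ?f - ?L * ?f) = 0"
    unfolding XD_lv_6 by algebra
  also have "\<dots> = 2 * 0"
    unfolding lvX1 lvX2 by simp
  finally have "48 * fps_XD ?f - ?L * ?f = 0"
    by (rule fps_numeral_mult_cancel)
  then show ?thesis by simp
qed

lemma prefix_quad_C4: "agrees (3 * (lvA * lvH) + (lvB * lvH)
  + 5 * (lvH * lvH)) [0, 6, 12, -6, -12, -6, -36, 0, -12, -102, 60, 108, 48, 246, 0]"
  by (rule agrees_cong, (rule agrees_intros prefix_lvA prefix_lvB prefix_lvH)+) code_simp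

lemma qC4_eq: "6 * qC4 = 3 * (lvA * lvH) + (lvB * lvH) + 5 * (lvH * lvH)" (is "?f = ?g")
proof (rule fps_XD_unique)
  show "48 * fps_XD ?f = (- 48 * lvC + 96 * lvP) * ?f"
    using XD_qC4 by (simp only: fps_XD_numeral_mult mult.left_commute)
  show "48 * fps_XD ?g = (- 48 * lvC + 96 * lvP) * ?g"
    by (rule XD_quad_C4)
  show "(- 48 * lvC + 96 * lvP) $ 0 = 48 * real 1"
    by (simp add: lv_nth_0 fps_numeral_mult_nth)
  have "qC4 $ 1 = (1 :: real)"
    unfolding qC4_def by (rule etaq_nth) auto
  then have "?f $ 1 = (6 :: real)"
    by (simp only: fps_numeral_mult_nth)
  also have "\<dots> = real_of_int ([0, 6, 12, -6, -12, -6, -36, 0, -12, -102, 60, 108, 48, 246,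
    0] ! 1)"
    by simp
  also have "\<dots> = ?g $ 1"
    by (rule agrees_nth[OF prefix_quad_C4, symmetric]) simp
  finally show "?f $ 1 = ?g $ 1" .
qed

definition qC5 :: "'a::field fps" where
  "qC5 = etaq 5 [(4, 2), (14, 4), (28, 2)] []"

lemma XD_qC5: "48 * fps_XD qC5 = (24 * evB - 24 * evC + 192 * evP) * qC5"
  (is "_ = ?L * _")
proof -
  have "48 * fps_XD qC5 = (of_nat (48 * 5) + elog [(4, 2), (14, 4), (28, 2)] - elog []) * qC5"
    unfolding qC5_def by (rule XD_etaq) auto
  also have "of_nat (48 * 5) + elog [(4, 2), (14, 4), (28, 2)] - elog [] = ?L"
    unfolding elog_Cons elog_Nil ram_28 of_nat_numeral of_nat_1 of_nat_mult by algebra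
  finally show ?thesis .
qed

text \<open>The candidate for \<open>qC5\<close> satisfies its equation only by virtue of relations
  between odd and even series. They become available after multiplication by \<open>odR\<close>,
  through \<open>rel_rr\<close>, \<open>rel_rs\<close>, \<open>rel_kr\<close> and
  \<open>rel_ks\<close>.\<close>

lemma XD_quad_C5_aux: "48*evA*evH * odK + 96*evA*evH * odR - 96*evA*evH * odS - 48*evA*evH^2
  + 24*evB*evH * odK - 48*evB*evH * odR - 24*evC*evH * odK - 48*evC*evH * odR
  - 96*evC*evH * odS + 48*evH * odK * odR + 336*evH * odK * odS - 48*evH^2 * odR
  - 336*evH^2 * odS = 0" (is "?t = 0")
proof -
  have "56*(odR*?t) = (14*evA*evH - 7*evB*evH - 7*evC*evH - 7*evH^2)*(- 24*evA*evB + 72*evA*evC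
    + 192*evA*evH - 48*evA^2 + 25*evB*evC + 80*evC*evH - 27*evC^2 + 384 * odR^2)
    + (- 14*evA*evH - 14*evC*evH - 49*evH^2)*(evB*evC - 16*evC*evH - 3*evC^2 - 48*evH^2
    + 384 * odR * odS) + (168*evA*evH + 84*evB*evH - 84*evC*evH + 168*evH * odR)*(- 8*evA*evH
    - 8*evA^2 + 35*evB*evH - evC*evH + 8*evC^2 + 16 * odK * odR) + (168*evH * odR)*(- 8*evA*evH
    + 8*evA^2 - 35*evB*evH + evC*evH - 8*evC^2 + 112 * odK * odS) + (- 24*evA*evH + 3*evA^2
    - 14*evB*evH + 25*evC*evH - 3*evC^2 + 21*evH^2)*(- 48*evA^2 + 7*evB^2 - 15*evC^2
    - 112*evH^2) + (- 288*evA*evH - 48*evA^2 - 224*evB*evH + 7*evB^2 + 272*evC*evH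
    - 15*evC^2)*(- 3*evA^2 + 14*evB*evH + 3*evC^2 + 7*evH^2)"
    by algebra
  also have "\<dots> = 56 * 0"
    unfolding rel_rr rel_rs rel_kr rel_ks evX1 evX2 by simp
  finally have "odR * ?t = 0" by (rule fps_numeral_mult_cancel)
  then show ?thesis using odR_nonzero by simp
qed

lemma XD_quad_C5: "48*fps_XD ((evH * odR) - (evH * odK) - (evH * odS)) = (24*evB - 24*evC
  + 192*evP)*((evH * odR) - (evH * odK) - (evH * odS))"
  (is "48 * fps_XD ?f = ?L * ?f")
proof -
  have d: "48*fps_XD ?f = 8*((- odK + odR - odS)*(6*fps_XD evH) + (evH)*(6*fps_XD odR)
    + (- evH)*(6*fps_XD odS) + (- evH)*(6*fps_XD odK))"
    by (simp only: XD_simps) algebra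
  have "48 * fps_XD ?f - ?L * ?f = 0"
    unfolding d XD_6 by (rule trans[OF _ XD_quad_C5_aux]) algebra
  then show ?thesis by simp
qed

lemma prefix_quad_C5: "agrees ((evH * odR) - (evH * odK)
  - (evH * odS)) [0, 0, 0, 0, 0, 6, 0, 0, 0, -12, 0, 0, 0, -6, 0]"
  by (rule agrees_cong, (rule agrees_intros prefix_evH prefix_odK prefix_odR prefix_odS)+)
    code_simp

lemma qC5_eq: "6 * qC5 = (evH * odR) - (evH * odK) - (evH * odS)" (is "?f = ?g")
proof (rule fps_XD_unique)
  show "48 * fps_XD ?f = (24 * evB - 24 * evC + 192 * evP) * ?f"
    using XD_qC5 by (simp only: fps_XD_numeral_mult mult.left_commute)
  show "48 * fps_XD ?g = (24 * evB - 24 * evC + 192 * evP) * ?g"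
    by (rule XD_quad_C5)
  show "(24 * evB - 24 * evC + 192 * evP) $ 0 = 48 * real 5"
    by (simp add: ev_nth_0 fps_numeral_mult_nth)
  have "qC5 $ 5 = (1 :: real)"
    unfolding qC5_def by (rule etaq_nth) auto
  then have "?f $ 5 = (6 :: real)"
    by (simp only: fps_numeral_mult_nth)
  also have "\<dots> = real_of_int ([0, 0, 0, 0, 0, 6, 0, 0, 0, -12, 0, 0, 0, -6, 0] ! 5)"
    by simp
  also have "\<dots> = ?g $ 5"
    by (rule agrees_nth[OF prefix_quad_C5, symmetric]) simp
  finally show "?f $ 5 = ?g $ 5" .
qed

definition qC6 :: "'a::field fps" where
  "qC6 = etaq 6 [(2, 6), (28, 6)] [(4, 2), (14, 2)]"

lemma XD_qC6: "48 * fps_XD qC6 = (96 * evC + 192 * evP) * qC6"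
  (is "_ = ?L * _")
proof -
  have "48 * fps_XD qC6 = (of_nat (48 * 6) + elog [(2, 6), (28, 6)]
    - elog [(4, 2), (14, 2)]) * qC6"
    unfolding qC6_def by (rule XD_etaq) auto
  also have "of_nat (48 * 6) + elog [(2, 6), (28, 6)] - elog [(4, 2), (14, 2)] = ?L"
    unfolding elog_Cons elog_Nil ram_28 of_nat_numeral of_nat_1 of_nat_mult by algebra
  finally show ?thesis .
qed

text \<open>\<open>qC6\<close> is \<open>qC3\<close> at \<open>q^2\<close>; both the candidate and
  the equation are dilations of those for \<open>qC3\<close>.\<close>

lemma XD_quad_C6: "48*fps_XD ((evB*evH) + 5*(evH*evH) - 3*(evA*evH)) = (96*evC
  + 192*evP)*((evB*evH) + 5*(evH*evH) - 3*(evA*evH))"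
  (is "48 * fps_XD ?f = ?L * ?f")
proof -
  have d: "48*fps_XD ?f = 8*((- 3*evH)*(6*fps_XD evA) + (evH)*(6*fps_XD evB) + (- 3*evA + evB
    + 10*evH)*(6*fps_XD evH))"
    by (simp only: XD_simps) algebra
  have "48 * fps_XD ?f - ?L * ?f = 0"
    unfolding d XD_6 by algebra
  then show ?thesis by simp
qed

lemma prefix_quad_C6: "agrees ((evB * evH) + 5 * (evH * evH)
  - 3 * (evA * evH)) [0, 0, 0, 0, 0, 0, 6, 0, -36, 0, 66, 0, -12, 0, -42]"
  by (rule agrees_cong, (rule agrees_intros prefix_evA prefix_evB prefix_evH)+) code_simp

lemma qC6_eq: "6 * qC6 = (evB * evH) + 5 * (evH * evH) - 3 * (evA * evH)" (is "?f = ?g")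
proof (rule fps_XD_unique)
  show "48 * fps_XD ?f = (96 * evC + 192 * evP) * ?f"
    using XD_qC6 by (simp only: fps_XD_numeral_mult mult.left_commute)
  show "48 * fps_XD ?g = (96 * evC + 192 * evP) * ?g"
    by (rule XD_quad_C6)
  show "(96 * evC + 192 * evP) $ 0 = 48 * real 6"
    by (simp add: ev_nth_0 fps_numeral_mult_nth)
  have "qC6 $ 6 = (1 :: real)"
    unfolding qC6_def by (rule etaq_nth) auto
  then have "?f $ 6 = (6 :: real)"
    by (simp only: fps_numeral_mult_nth)
  also have "\<dots> = real_of_int ([0, 0, 0, 0, 0, 0, 6, 0, -36, 0, 66, 0, -12, 0, -42] ! 6)"
    by simp
  also have "\<dots> = ?g $ 6"
    by (rule agrees_nth[OF prefix_quad_C6, symmetric]) simp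
  finally show "?f $ 6 = ?g $ 6" .
qed

definition qC7 :: "'a::field fps" where
  "qC7 = etaq 7 [(2, 4), (28, 6)] [(4, 2)]"

lemma XD_qC7: "48 * fps_XD qC7 = (24 * evB + 72 * evC + 192 * evP) * qC7"
  (is "_ = ?L * _")
proof -
  have "48 * fps_XD qC7 = (of_nat (48 * 7) + elog [(2, 4), (28, 6)] - elog [(4, 2)]) * qC7"
    unfolding qC7_def by (rule XD_etaq) auto
  also have "of_nat (48 * 7) + elog [(2, 4), (28, 6)] - elog [(4, 2)] = ?L"
    unfolding elog_Cons elog_Nil ram_28 of_nat_numeral of_nat_1 of_nat_mult by algebra
  finally show ?thesis .
qed

text \<open>The candidate is a product of eta quotients: \<open>odS\<close> is
  \<open>eta(28z)^8 / eta(14z)^4\<close>, and the other factor is the quotient of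
  \<open>6 * C1\<close> by \<open>lvH\<close>, taken at \<open>q^2\<close>.\<close>

lemma XD_quad_C7: "48*fps_XD ((evB * odS) + 3*(evC * odS) - 16*(evH * odS)) = (24*evB + 72*evC
  + 192*evP)*((evB * odS) + 3*(evC * odS) - 16*(evH * odS))"
  (is "48 * fps_XD ?f = ?L * ?f")
proof -
  have d: "48*fps_XD ?f = 8*((odS)*(6*fps_XD evB) + (3 * odS)*(6*fps_XD evC)
    + (- 16 * odS)*(6*fps_XD evH) + (evB + 3*evC - 16*evH)*(6*fps_XD odS))"
    by (simp only: XD_simps) algebra
  have "48 * fps_XD ?f - ?L * ?f = 0"
    unfolding d XD_6 by algebra
  then show ?thesis by simp
qed

lemma prefix_quad_C7: "agrees ((evB * odS) + 3 * (evC * odS)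
  - 16 * (evH * odS)) [0, 0, 0, 0, 0, 0, 0, 6, 0, -24, 0, 24, 0, 0, 0]"
  by (rule agrees_cong, (rule agrees_intros prefix_evB prefix_evC prefix_evH prefix_odS)+)
    code_simp

lemma qC7_eq: "6 * qC7 = (evB * odS) + 3 * (evC * odS) - 16 * (evH * odS)" (is "?f = ?g")
proof (rule fps_XD_unique)
  show "48 * fps_XD ?f = (24 * evB + 72 * evC + 192 * evP) * ?f"
    using XD_qC7 by (simp only: fps_XD_numeral_mult mult.left_commute)
  show "48 * fps_XD ?g = (24 * evB + 72 * evC + 192 * evP) * ?g"
    by (rule XD_quad_C7)
  show "(24 * evB + 72 * evC + 192 * evP) $ 0 = 48 * real 7"
    by (simp add: ev_nth_0 fps_numeral_mult_nth)
  have "qC7 $ 7 = (1 :: real)"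
    unfolding qC7_def by (rule etaq_nth) auto
  then have "?f $ 7 = (6 :: real)"
    by (simp only: fps_numeral_mult_nth)
  also have "\<dots> = real_of_int ([0, 0, 0, 0, 0, 0, 0, 6, 0, -24, 0, 24, 0, 0, 0] ! 7)"
    by simp
  also have "\<dots> = ?g $ 7"
    by (rule agrees_nth[OF prefix_quad_C7, symmetric]) simp
  finally show "?f $ 7 = ?g $ 7" .
qed

definition qC8 :: "'a::field fps" where
  "qC8 = etaq 8 [(1, 1), (2, 1), (7, 1), (28, 8)] [(14, 3)]"

lemma XD_qC8: "48*fps_XD qC8 = (48*evA + 24*evB + 72*evC + 192*evP - 48 * odR - 336 * odS) * qC8"
  (is "_ = ?L * _")
proof -
  have "48 * fps_XD qC8 = (of_nat (48 * 8) + elog [(1, 1), (2, 1), (7, 1), (28, 8)]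
    - elog [(14, 3)]) * qC8"
    unfolding qC8_def by (rule XD_etaq) auto
  also have "of_nat (48 * 8) + elog [(1, 1), (2, 1), (7, 1), (28, 8)] - elog [(14, 3)] = ?L"
    unfolding elog_Cons elog_Nil ram_28 of_nat_numeral of_nat_1 of_nat_mult by algebra
  finally show ?thesis .
qed

text \<open>The candidate is \<open>odS * lvH\<close>, the product of
  \<open>eta(28z)^8 / eta(14z)^4\<close> with the newform.\<close>

lemma XD_quad_C8: "48*fps_XD ((odK * odS) - (evH * odS)) = (48*evA + 24*evB + 72*evC + 192*evP
  - 48 * odR - 336 * odS)*((odK * odS) - (evH * odS))"
  (is "48 * fps_XD ?f = ?L * ?f")
proof -
  have d: "48*fps_XD ?f = 8*((- odS)*(6*fps_XD evH) + (- evH + odK)*(6*fps_XD odS)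
    + (odS)*(6*fps_XD odK))"
    by (simp only: XD_simps) algebra
  have "48 * fps_XD ?f - ?L * ?f = 0"
    unfolding d XD_6 by algebra
  then show ?thesis by simp
qed

lemma prefix_quad_C8: "agrees ((odK * odS) - (evH * odS)) [0, 0, 0, 0, 0, 0, 0, 0, 1, -1, -2, 1,
  0, 2, 1]"
  by (rule agrees_cong, (rule agrees_intros prefix_evH prefix_odK prefix_odS)+) code_simp

lemma qC8_eq: "qC8 = (odK * odS) - (evH * odS)" (is "?f = ?g")
proof (rule fps_XD_unique)
  show "48 * fps_XD ?f = (48 * evA + 24 * evB + 72 * evC + 192 * evP - 48 * odR - 336 * odS) * ?f"
    using XD_qC8 .
  show "48 * fps_XD ?g = (48 * evA + 24 * evB + 72 * evC + 192 * evP - 48 * odR - 336 * odS) * ?g"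
    by (rule XD_quad_C8)
  show "(48 * evA + 24 * evB + 72 * evC + 192 * evP - 48 * odR - 336 * odS) $ 0 = 48 * real 8"
    by (simp add: ev_nth_0 fps_numeral_mult_nth)
  have "qC8 $ 8 = (1 :: real)"
    unfolding qC8_def by (rule etaq_nth) auto
  then have "?f $ 8 = (1 :: real)"
    by simp
  also have "\<dots> = real_of_int ([0, 0, 0, 0, 0, 0, 0, 0, 1, -1, -2, 1, 0, 2, 1] ! 8)"
    by simp
  also have "\<dots> = ?g $ 8"
    by (rule agrees_nth[OF prefix_quad_C8, symmetric]) simp
  finally show "?f $ 8 = ?g $ 8" .
qed

definition qC9 :: "'a::field fps" where
  "qC9 = etaq 9 [(2, 1), (4, 1), (28, 9)] [(14, 3)]"

lemma XD_qC9: "48 * fps_XD qC9 = (96 * evA + 24 * evB + 72 * evC + 192 * evP) * qC9"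
  (is "_ = ?L * _")
proof -
  have "48 * fps_XD qC9 = (of_nat (48 * 9) + elog [(2, 1), (4, 1), (28, 9)]
    - elog [(14, 3)]) * qC9"
    unfolding qC9_def by (rule XD_etaq) auto
  also have "of_nat (48 * 9) + elog [(2, 1), (4, 1), (28, 9)] - elog [(14, 3)] = ?L"
    unfolding elog_Cons elog_Nil ram_28 of_nat_numeral of_nat_1 of_nat_mult by algebra
  finally show ?thesis .
qed

text \<open>Here \<open>odS\<close> is multiplied with the newform at \<open>q^2\<close>,
  \<open>eta(2z) eta(4z) eta(14z) eta(28z)\<close>.\<close>

lemma XD_quad_C9: "48*fps_XD ((evH * odS)) = (96*evA + 24*evB + 72*evC + 192*evP)*((evH * odS))"
  (is "48 * fps_XD ?f = ?L * ?f")
proof -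
  have d: "48 * fps_XD ?f = 8 * ((odS) * (6 * fps_XD evH) + (evH) * (6 * fps_XD odS))"
    by (simp only: XD_simps) algebra
  have "48 * fps_XD ?f - ?L * ?f = 0"
    unfolding d XD_6 by algebra
  then show ?thesis by simp
qed

lemma prefix_quad_C9: "agrees ((evH * odS)) [0, 0, 0, 0, 0, 0, 0, 0, 0, 1, 0, -1, 0, -2, 0]"
  by (rule agrees_cong, (rule agrees_intros prefix_evH prefix_odS)+) code_simp

lemma qC9_eq: "qC9 = (evH * odS)" (is "?f = ?g")
proof (rule fps_XD_unique)
  show "48 * fps_XD ?f = (96 * evA + 24 * evB + 72 * evC + 192 * evP) * ?f"
    using XD_qC9 .
  show "48 * fps_XD ?g = (96 * evA + 24 * evB + 72 * evC + 192 * evP) * ?g"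
    by (rule XD_quad_C9)
  show "(96 * evA + 24 * evB + 72 * evC + 192 * evP) $ 0 = 48 * real 9"
    by (simp add: ev_nth_0 fps_numeral_mult_nth)
  have "qC9 $ 9 = (1 :: real)"
    unfolding qC9_def by (rule etaq_nth) auto
  then have "?f $ 9 = (1 :: real)"
    by simp
  also have "\<dots> = real_of_int ([0, 0, 0, 0, 0, 0, 0, 0, 0, 1, 0, -1, 0, -2, 0] ! 9)"
    by simp
  also have "\<dots> = ?g $ 9"
    by (rule agrees_nth[OF prefix_quad_C9, symmetric]) simp
  finally show "?f $ 9 = ?g $ 9" .
qed

section \<open>The five convolution identities for power series\<close>

lemma XD_ramT_eis: "fps_XD (ramT d) = - 48 * of_nat d * fps_XD (dil d (eis 1))"
  by (simp add: ramT_def fps_XD_mult fps_XD_diff)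

lemma XD_ramT_4: "24 * fps_XD (ramT 4) = ramT 4 ^ 2 - 2 * ramS 4"
  by (rule XD_ramT) simp

lemma XD_ramT_28: "24 * fps_XD (ramT 28) = ramT 28 ^ 2 - 2 * ramS 28"
  by (rule XD_ramT) simp

text \<open>This polynomial is what the claimed identity becomes in the generators of level 28. The
  available relations contain only even products, so its odd part, which mixes even with odd series,
  is reached through multiplication by \<open>odR\<close>.\<close>

lemma conv_poly_1_28: "- 72000*evA*evB + 216000*evA*evC - 7820160*evA*evH + 581760*evA * odK
  - 74880*evA * odR - 524160*evA * odS + 20160*evA^2 + 62400*evB*evC + 1844320*evB*evH
  + 440480*evB * odK - 127200*evB * odR - 467040*evB * odS - 36000*evB^2 + 1120800*evC*evH
  - 965280*evC * odK - 481440*evC * odR - 702240*evC * odS + 116640*evC^2 - 1803520*evH * odK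
  - 1129600*evH * odR + 21481600*evH * odS + 10968320*evH^2 + 3844480 * odK * odR
  + 90634880 * odK * odS - 455680 * odK^2 - 2486400 * odR * odS + 1104960 * odR^2
  - 2304960 * odS^2 = 0" (is "?t = 0")
proof -
  have "84*(odR*?t) = (- 16380*evA - 27825*evB - 105315*evC - 247100*evH
    + 241710 * odR)*(- 24*evA*evB + 72*evA*evC + 192*evA*evH - 48*evA^2 + 25*evB*evC
    + 80*evC*evH - 27*evC^2 + 384 * odR^2) + (- 114660*evA - 102165*evB - 153615*evC
    + 4699100*evH - 543900 * odR)*(evB*evC - 16*evC*evH - 3*evC^2 - 48*evH^2 + 384 * odR * odS)
    + (- 10290 * odR)*(24*evA*evB - 72*evA*evC - 192*evA*evH - 48*evA^2 + 25*evB*evC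
    + 80*evC*evH - 27*evC^2 + 18816 * odS^2) + (3054240*evA + 2312520*evB - 5067720*evC
    - 9468480*evH + 20183520 * odR)*(- 8*evA*evH - 8*evA^2 + 35*evB*evH - evC*evH + 8*evC^2
    + 16 * odK * odR) + (67976160 * odR)*(- 8*evA*evH + 8*evA^2 - 35*evB*evH + evC*evH
    - 8*evC^2 + 112 * odK * odS) + (- 6379520 * odR)*(- evB*evH - 3*evC*evH + 10*evH^2
    + 6 * odK^2) + (- 95400*evA + 113970*evC - 381640*evH - 432000 * odR)*(- 48*evA^2 + 7*evB^2
    - 15*evC^2 - 112*evH^2) + (- 6356160*evA - 5590480*evB + 12982320*evC + 26116160*evH
    + 130091840 * odR)*(- 3*evA^2 + 14*evB*evH + 3*evC^2 + 7*evH^2)"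
    by algebra
  also have "\<dots> = 84 * 0"
    unfolding rel_rr rel_rs rel_ss rel_kr rel_ks rel_kk evX1 evX2 by simp
  finally have "odR * ?t = 0" by (rule fps_numeral_mult_cancel)
  then show ?thesis using odR_nonzero by simp
qed

text \<open>The claimed formula times the common denominator
  \<open>32256000 = 500 * 2 * 56 * 24^2\<close>. By Ramanujan's equation the two derivative terms
  complete a square: the quadratic part in the \<open>ramT\<close> is
  \<open>- 250 * (ramT 1 - ramT 28)^2\<close>, in which \<open>evP\<close> cancels. Everything else
  has weight 4 and is modular. The other four convolutions have the same structure.\<close>

lemma conv_1_28:
  "32256000*(dil 1 (eis 1)*dil 28 (eis 1)) = 13440*dil 1 (eis 3) + 40320*dil 2 (eis 3)
    + 215040*dil 4 (eis 3) + 658560*dil 7 (eis 3) + 1975680*dil 14 (eis 3)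
    + 10536960*dil 28 (eis 3) + 1344000*dil 1 (eis 1) + 1344000*dil 28 (eis 1)
    - 288000*fps_XD (dil 1 (eis 1)) - 8064000*fps_XD (dil 28 (eis 1)) + 538080 * qC1
    + 3440160 * qC2 - 252000 * qC3 - 1607520 * qC4 - 16289280 * qC5 - 13708800 * qC6
    + 2096640 * qC7 - 93112320 * qC8 - 109240320 * qC9"
  (is "?l = ?r")
proof -
  have "500*(ramT 1*ramT 28) - 28*ramS 1 - 21*ramS 2 - 28*ramS 4 - 28*ramS 7 - 21*ramS 14
    - 28*ramS 28 - 250*(24*fps_XD (ramT 1)) - 250*(24*fps_XD (ramT 28)) - 89680*(6 * qC1)
    - 3440160 * qC2 + 42000*(6 * qC3) + 267920*(6 * qC4) + 2714880*(6 * qC5)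
    + 2284800*(6 * qC6) - 349440*(6 * qC7) + 93112320 * qC8 + 109240320 * qC9 = 0"
    unfolding qC1_eq qC2_eq qC3_eq qC4_eq qC5_eq qC6_eq qC7_eq qC8_eq qC9_eq XD_ramT_1 XD_ramT_28
      unfolding ram_28 lv_28
    by (rule trans[OF _ conv_poly_1_28]) algebra
  then have "?l - ?r = 0"
    unfolding XD_ramT_eis unfolding ramT_def ramS_def of_nat_numeral of_nat_1 power_one by algebra
  then show ?thesis by simp
qed

lemma conv_poly_4_7: "504000*evA*evB - 1512000*evA*evC - 16821120*evA*evH - 247680*evA * odK
  - 524160*evA * odR - 3669120*evA * odS + 141120*evA^2 + 436800*evB*evC + 5798240*evB*evH
  + 787360*evB * odK + 117600*evB * odR - 245280*evB * odS - 252000*evB^2 + 2685600*evC*evH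
  - 1596960*evC * odK - 346080*evC * odR + 4156320*evC * odS + 816480*evC^2 - 2320640*evH * odK
  - 3651200*evH * odR + 19779200*evH * odS + 34666240*evH^2 + 2495360 * odK * odR
  + 161580160 * odK * odS + 1738240 * odK^2 - 17404800 * odR * odS - 329280 * odR^2
  + 379001280 * odS^2 = 0" (is "?t = 0")
proof -
  have "12*(odR*?t) = (- 16380*evA + 3675*evB - 10815*evC - 114100*evH
    - 10290 * odR)*(- 24*evA*evB + 72*evA*evC + 192*evA*evH - 48*evA^2 + 25*evB*evC
    + 80*evC*evH - 27*evC^2 + 384 * odR^2) + (- 114660*evA - 7665*evB + 129885*evC + 618100*evH
    - 543900 * odR)*(evB*evC - 16*evC*evH - 3*evC^2 - 48*evH^2 + 384 * odR * odS)
    + (241710 * odR)*(24*evA*evB - 72*evA*evC - 192*evA*evH - 48*evA^2 + 25*evB*evC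
    + 80*evC*evH - 27*evC^2 + 18816 * odS^2) + (- 185760*evA + 590520*evB - 1197720*evC
    - 1740480*evH + 1871520 * odR)*(- 8*evA*evH - 8*evA^2 + 35*evB*evH - evC*evH + 8*evC^2
    + 16 * odK * odR) + (17312160 * odR)*(- 8*evA*evH + 8*evA^2 - 35*evB*evH + evC*evH
    - 8*evC^2 + 112 * odK * odS) + (3476480 * odR)*(- evB*evH - 3*evC*evH + 10*evH^2
    + 6 * odK^2) + (12600*evA - 12030*evC + 52360*evH - 432000 * odR)*(- 48*evA^2 + 7*evB^2
    - 15*evC^2 - 112*evH^2) + (555840*evA - 1502480*evB + 3166320*evC + 5076160*evH
    + 43819840 * odR)*(- 3*evA^2 + 14*evB*evH + 3*evC^2 + 7*evH^2)"
    by algebra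
  also have "\<dots> = 12 * 0"
    unfolding rel_rr rel_rs rel_ss rel_kr rel_ks rel_kk evX1 evX2 by simp
  finally have "odR * ?t = 0" by (rule fps_numeral_mult_cancel)
  then show ?thesis using odR_nonzero by simp
qed

lemma conv_4_7:
  "225792000*(dil 4 (eis 1)*dil 7 (eis 1)) = 94080*dil 1 (eis 3) + 282240*dil 2 (eis 3)
    + 1505280*dil 4 (eis 3) + 4609920*dil 7 (eis 3) + 13829760*dil 14 (eis 3)
    + 73758720*dil 28 (eis 3) + 9408000*dil 4 (eis 1) + 9408000*dil 7 (eis 1)
    - 8064000*fps_XD (dil 4 (eis 1)) - 14112000*fps_XD (dil 7 (eis 1)) + 334560 * qC1
    + 1401120 * qC2 - 2268000 * qC3 - 428640 * qC4 + 6935040 * qC5 - 39513600 * qC6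
    + 38868480 * qC7 - 189450240 * qC8 - 76554240 * qC9"
  (is "?l = ?r")
proof -
  have "3500*(ramT 4*ramT 7) - 196*ramS 1 - 147*ramS 2 - 196*ramS 4 - 196*ramS 7 - 147*ramS 14
    - 196*ramS 28 - 1750*(24*fps_XD (ramT 4)) - 1750*(24*fps_XD (ramT 7)) - 55760*(6 * qC1)
    - 1401120 * qC2 + 378000*(6 * qC3) + 71440*(6 * qC4) - 1155840*(6 * qC5)
    + 6585600*(6 * qC6) - 6478080*(6 * qC7) + 189450240 * qC8 + 76554240 * qC9 = 0"
    unfolding qC1_eq qC2_eq qC3_eq qC4_eq qC5_eq qC6_eq qC7_eq qC8_eq qC9_eq XD_ramT_4 XD_ramT_7
      unfolding ram_28 lv_28
    by (rule trans[OF _ conv_poly_4_7]) algebra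
  then have "?l - ?r = 0"
    unfolding XD_ramT_eis unfolding ramT_def ramS_def of_nat_numeral of_nat_1 power_one by algebra
  then show ?thesis by simp
qed

lemma conv_poly_1_14: "23040*lvA^2 + 36480*lvB*lvH - 4500*lvB^2 + 17460*lvC^2 + 90240*lvH^2 =
  0" (is "?t = 0")
proof -
  have "14*?t = (- 9000)*(- 48*lvA^2 + 7*lvB^2 - 15*lvC^2 - 112*lvH^2) + 36480*(- 3*lvA^2
    + 14*lvB*lvH + 3*lvC^2 + 7*lvH^2)"
    by algebra
  also have "\<dots> = 14 * 0"
    unfolding lvX1 lvX2 by simp
  finally show ?thesis by (rule fps_numeral_mult_cancel)
qed

lemma conv_1_14:
  "8064000*(dil 1 (eis 1)*dil 14 (eis 1)) = 13440*dil 1 (eis 3) + 53760*dil 2 (eis 3)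
    + 658560*dil 7 (eis 3) + 2634240*dil 14 (eis 3) + 336000*dil 1 (eis 1)
    + 336000*dil 14 (eis 1) - 144000*fps_XD (dil 1 (eis 1)) - 2016000*fps_XD (dil 14 (eis 1))
    + 92160 * qC2 - 13440 * qC3 - 205440 * qC4"
  (is "?l = ?r")
proof -
  have "250*(ramT 1*ramT 14) - 28*ramS 1 - 28*ramS 2 - 28*ramS 7 - 28*ramS 14
    - 125*(24*fps_XD (ramT 1)) - 125*(24*fps_XD (ramT 14)) - 92160 * qC2 + 2240*(6 * qC3)
    + 34240*(6 * qC4) = 0"
    unfolding qC2_eq qC3_eq qC4_eq XD_ramT_1 XD_ramT_14 unfolding ramT_eqs ramS_lv
    by (rule trans[OF _ conv_poly_1_14]) algebra
  then have "?l - ?r = 0"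
    unfolding XD_ramT_eis unfolding ramT_def ramS_def of_nat_numeral of_nat_1 power_one by algebra
  then show ?thesis by simp
qed

text \<open>The polynomial agrees with the one for \<open>W 1 14\<close>: the Atkin-Lehner
  involution at 2 interchanges \<open>d = 1\<close> with 2, 7 with 14 and \<open>qC3\<close> with
  \<open>qC4\<close>, and the terms that remain are invariant.\<close>

lemma conv_poly_2_7: "23040*lvA^2 + 36480*lvB*lvH - 4500*lvB^2 + 17460*lvC^2 + 90240*lvH^2 =
  0" (is "?t = 0")
proof -
  have "14*?t = (- 9000)*(- 48*lvA^2 + 7*lvB^2 - 15*lvC^2 - 112*lvH^2) + 36480*(- 3*lvA^2
    + 14*lvB*lvH + 3*lvC^2 + 7*lvH^2)"
    by algebra
  also have "\<dots> = 14 * 0"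
    unfolding lvX1 lvX2 by simp
  finally show ?thesis by (rule fps_numeral_mult_cancel)
qed

lemma conv_2_7:
  "8064000*(dil 2 (eis 1)*dil 7 (eis 1)) = 13440*dil 1 (eis 3) + 53760*dil 2 (eis 3)
    + 658560*dil 7 (eis 3) + 2634240*dil 14 (eis 3) + 336000*dil 2 (eis 1)
    + 336000*dil 7 (eis 1) - 288000*fps_XD (dil 2 (eis 1)) - 1008000*fps_XD (dil 7 (eis 1))
    + 92160 * qC2 - 205440 * qC3 - 13440 * qC4"
  (is "?l = ?r")
proof -
  have "250*(ramT 2*ramT 7) - 28*ramS 1 - 28*ramS 2 - 28*ramS 7 - 28*ramS 14
    - 125*(24*fps_XD (ramT 2)) - 125*(24*fps_XD (ramT 7)) - 92160 * qC2 + 34240*(6 * qC3)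
    + 2240*(6 * qC4) = 0"
    unfolding qC2_eq qC3_eq qC4_eq XD_ramT_2 XD_ramT_7 unfolding ramT_eqs ramS_lv
    by (rule trans[OF _ conv_poly_2_7]) algebra
  then have "?l - ?r = 0"
    unfolding XD_ramT_eis unfolding ramT_def ramS_def of_nat_numeral of_nat_1 power_one by algebra
  then show ?thesis by simp
qed

lemma conv_poly_1_7: "5760*lvA^2 + 1920*lvB*lvH - 900*lvB^2 + 2340*lvC^2 + 15360*lvH^2 =
  0" (is "?t = 0")
proof -
  have "14*?t = (- 1800)*(- 48*lvA^2 + 7*lvB^2 - 15*lvC^2 - 112*lvH^2) + 1920*(- 3*lvA^2
    + 14*lvB*lvH + 3*lvC^2 + 7*lvH^2)"
    by algebra
  also have "\<dots> = 14 * 0"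
    unfolding lvX1 lvX2 by simp
  finally show ?thesis by (rule fps_numeral_mult_cancel)
qed

lemma conv_1_7:
  "806400*(dil 1 (eis 1)*dil 7 (eis 1)) = 6720*dil 1 (eis 3) + 329280*dil 7 (eis 3)
    + 33600*dil 1 (eis 1) + 33600*dil 7 (eis 1) - 28800*fps_XD (dil 1 (eis 1))
    - 201600*fps_XD (dil 7 (eis 1)) - 11520 * qC1 - 46080 * qC2"
  (is "?l = ?r")
proof -
  have "50*(ramT 1*ramT 7) - 14*ramS 1 - 14*ramS 7 - 25*(24*fps_XD (ramT 1))
    - 25*(24*fps_XD (ramT 7)) + 1920*(6 * qC1) + 46080 * qC2 = 0"
    unfolding qC1_eq qC2_eq XD_ramT_1 XD_ramT_7 unfolding ramT_eqs ramS_lv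
    by (rule trans[OF _ conv_poly_1_7]) algebra
  then have "?l - ?r = 0"
    unfolding XD_ramT_eis unfolding ramT_def ramS_def of_nat_numeral of_nat_1 power_one by algebra
  then show ?thesis by simp
qed

section \<open>Eta quotients as power series on the unit disc\<close>

text \<open>Serves to show that the eta quotients have integer coefficients, as the integer-valued
  \<open>q_coeff\<close> demands.\<close>

definition of_int_fps :: "int fps \<Rightarrow> 'a::comm_ring_1 fps" where
  "of_int_fps f = Abs_fps (\<lambda>n. of_int (f $ n))"

lemma of_int_fps_nth [simp]: "of_int_fps f $ n = of_int (f $ n)"
  by (simp add: of_int_fps_def)

lemma of_int_fps_1 [simp]: "of_int_fps 1 = 1"
  by (rule fps_ext) simp

lemma of_int_fps_diff: "of_int_fps (f - g) = of_int_fps f - of_int_fps g"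
  by (rule fps_ext) simp

lemma of_int_fps_mult: "of_int_fps (f * g) = of_int_fps f * of_int_fps g"
  by (rule fps_ext) (simp add: fps_mult_nth)

lemma of_int_fps_power: "of_int_fps (f ^ n) = of_int_fps f ^ n"
  by (induction n) (simp_all add: of_int_fps_mult)

lemma of_int_fps_prod: "of_int_fps (\<Prod>k\<in>A. f k) = (\<Prod>k\<in>A. of_int_fps (f k))"
  by (induction A rule: infinite_finite_induct) (simp_all add: of_int_fps_mult)

lemma of_int_fps_X [simp]: "of_int_fps fps_X = fps_X"
  by (rule fps_ext) simp

lemma of_int_fps_dil: "of_int_fps (dil d f) = dil d (of_int_fps f)"
  by (rule fps_ext) (simp add: dil_nth)

lemma of_int_fps_euler: "of_int_fps euler = (euler :: 'a::comm_ring_1 fps)"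
proof (rule fps_ext)
  fix n
  have "of_int_fps euler $ n = of_int_fps (\<Prod>k<n. 1 - fps_X ^ Suc k) $ n"
    by (simp add: euler_def)
  also have "\<dots> = (euler :: 'a fps) $ n"
    unfolding of_int_fps_prod of_int_fps_diff of_int_fps_power by (simp add: euler_def)
  finally show "of_int_fps euler $ n = (euler :: 'a fps) $ n" .
qed

lemma of_int_fps_eprod: "of_int_fps (eprod us) = eprod us"
proof (induction us)
  case (Cons u us)
  then show ?case
    by (cases u) (simp add: eprod_Cons of_int_fps_mult of_int_fps_power of_int_fps_dil
      of_int_fps_euler)
qed simp

text \<open>The denominator has constant coefficient 1 and is therefore invertible over the
  integers; \<open>fps_right_inverse\<close> gives this inverse without division in the coefficient
  ring.\<close>

definition etaq_int :: "nat \<Rightarrow> (nat \<times> nat) list \<Rightarrow> (nat \<times>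
  nat) list \<Rightarrow> int fps" where
  "etaq_int m us vs = fps_X ^ m * (eprod us * fps_right_inverse (eprod vs) 1)"

lemma of_int_fps_etaq_int:
  assumes "\<forall>u\<in>set vs. fst u > 0"
  shows "of_int_fps (etaq_int m us vs) = (etaq m us vs :: 'a::field fps)"
proof -
  define v where "v = fps_right_inverse (eprod vs :: int fps) 1"
  have "eprod vs * v = 1"
    unfolding v_def using eprod_nth_0[OF assms] by (intro fps_right_inverse) simp
  then have "eprod vs * of_int_fps v = (1 :: 'a fps)"
    by (metis of_int_fps_1 of_int_fps_eprod of_int_fps_mult)
  then have "inverse (eprod vs) = (of_int_fps v :: 'a fps)"
    by (rule fps_inverse_unique)
  then show ?thesis
    by (simp add: etaq_def etaq_int_def of_int_fps_mult of_int_fps_power of_int_fps_eprod flip: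
      v_def)
qed

section \<open>The Euler product as a holomorphic function\<close>

definition euler_prod :: "complex \<Rightarrow> complex" where
  "euler_prod q = (\<Prod>n. 1 - q ^ Suc n)"

lemma norm_power_less_1: "norm q < 1 \<Longrightarrow> d > 0 \<Longrightarrow> norm (q ^ d) < 1"
  for q :: complex
  using power_decreasing[of 1 d "norm q"] by (simp add: norm_power)

lemma power_Suc_neq_1: "norm q < 1 \<Longrightarrow> 1 - q ^ Suc n \<noteq> (0 :: complex)"
  using norm_power_less_1[of q "Suc n"] by (auto simp del: power_Suc)

lemma convergent_euler_prod: "norm q < 1 \<Longrightarrow> convergent_prod (\<lambda>n. 1
  - q ^ Suc n :: complex)"
  by (intro abs_convergent_prod_imp_convergent_prod summable_imp_abs_convergent_prod)
     (simp add: norm_power norm_mult summable_mult summable_geometric)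

lemma euler_prod_nonzero: "norm q < 1 \<Longrightarrow> euler_prod q \<noteq> 0"
  unfolding euler_prod_def by (intro prodinf_nonzero convergent_euler_prod power_Suc_neq_1)

text \<open>Weierstrass' criterion with the majorant \<open>r^(n+1)\<close> gives uniform
  convergence of the product; its limit is then identified pointwise. For negative \<open>r\<close>
  the ball is empty.\<close>

lemma uniform_limit_euler_prod:
  assumes "r < 1"
  shows "uniform_limit (cball 0 r) (\<lambda>N q. \<Prod>k<N. 1
    - q ^ Suc k) euler_prod sequentially"
proof (cases "r \<ge> 0")
  case True
  have "uniformly_convergent_on (cball 0 r) (\<lambda>N q :: complex. \<Prod>k<N. 1 - q ^ Suc k)"
  proof (rule uniformly_convergent_on_prod')
    show "uniformly_convergent_on (cball 0 r) (\<lambda>N q :: complex. \<Sum>n<N. norm (1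
      - q ^ Suc n - 1))"
    proof (rule Weierstrass_m_test')
      show "norm (norm (1 - q ^ Suc n - 1)) \<le> r ^ Suc n" if "q \<in> cball 0 r" for n and q
        :: complex
        using that by (simp add: norm_power power_mono del: power_Suc)
      show "summable (\<lambda>n. r ^ Suc n)"
        using True assms by (simp add: summable_mult summable_geometric)
    qed
  qed (auto intro!: continuous_intros)
  then obtain g where g: "uniform_limit (cball 0 r) (\<lambda>N q :: complex. \<Prod>k<N. 1
    - q ^ Suc k) g sequentially"
    by (auto simp: uniformly_convergent_on_def)
  have "g q = euler_prod q" if "q \<in> cball 0 r" for q
  proof (rule LIMSEQ_unique)
    show "(\<lambda>N. \<Prod>k<N. 1 - q ^ Suc k) \<longlonglongrightarrow> g q"
      using tendsto_uniform_limitI[OF g that] .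
    have "norm q < 1" using that assms by simp
    then show "(\<lambda>N. \<Prod>k<N. 1 - q ^ Suc k) \<longlonglongrightarrow> euler_prod q"
      unfolding euler_prod_def LIMSEQ_lessThan_iff_atMost
      by (intro convergent_prod_LIMSEQ convergent_euler_prod)
  qed
  then have "uniform_limit (cball 0 r) (\<lambda>N q. \<Prod>k<N. 1
    - q ^ Suc k) g sequentially \<longleftrightarrow> ?thesis"
    by (intro uniform_limit_cong') auto
  with g show ?thesis by blast
next
  case False
  then show ?thesis by (simp add: uniform_limit_iff)
qed

lemma holomorphic_euler_prod: "euler_prod holomorphic_on ball 0 1"
proof (rule holomorphic_uniform_sequence)
  show "(\<lambda>q. \<Prod>k<N. 1 - q ^ Suc k) holomorphic_on ball 0 1" for N
    by (intro holomorphic_intros)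
  fix q :: complex assume q: "q \<in> ball 0 1"
  define d where "d = (1 - norm q) / 2"
  have "cball q d \<subseteq> cball 0 ((1 + norm q) / 2)"
  proof
    fix w assume "w \<in> cball q d"
    then have "norm (w - q) \<le> d" by (simp add: dist_norm norm_minus_commute)
    then show "w \<in> cball 0 ((1 + norm q) / 2)"
      using norm_triangle_ineq[of "w - q" q] by (simp add: d_def field_simps)
  qed
  moreover have "(1 + norm q) / 2 < 1" using q by simp
  ultimately have "uniform_limit (cball q d) (\<lambda>N q. \<Prod>k<N. 1
    - q ^ Suc k) euler_prod sequentially"
    by (intro uniform_limit_on_subset[OF uniform_limit_euler_prod])
  moreover have "d > 0" using q by (simp add: d_def)
  moreover have "cball q d \<subseteq> ball 0 1"
  proof
    fix w assume "w \<in> cball q d"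
    then have "w \<in> cball 0 ((1 + norm q) / 2)"
      using \<open>cball q d \<subseteq> _\<close> by blast
    then show "w \<in> ball 0 1" using \<open>(1 + norm q) / 2 < 1\<close> by simp
  qed
  ultimately show "\<exists>d>0. cball q d \<subseteq> ball 0 1 \<and>
      uniform_limit (cball q d) (\<lambda>N q. \<Prod>k<N. 1
        - q ^ Suc k) euler_prod sequentially" by blast
qed simp

text \<open>Uniform limits of holomorphic functions converge coefficientwise, so the expansion of
  the limit is the limit of the finite products as power series. The latter is \<open>euler\<close>,
  because each coefficient is eventually constant.\<close>

lemma euler_prod_has_fps_expansion: "euler_prod has_fps_expansion euler"
proof -
  have g: "euler_prod has_fps_expansion fps_expansion euler_prod 0"
    by (rule has_fps_expansion_fps_expansion[OF _ _ holomorphic_euler_prod]) simp_all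
  have "fps_expansion euler_prod 0 = euler"
  proof (rule uniform_limit_imp_fps_expansion_eq[where A = "ball 0 (1 / 2)" and F = sequentially
        and f = "\<lambda>N. \<Prod>k<N. 1 - fps_X ^ Suc k" and f' =
          "\<lambda>N q. \<Prod>k<N. 1 - q ^ Suc k"])
    show "(\<lambda>N. \<Prod>k<N. 1 - fps_X ^ Suc k) \<longlonglongrightarrow> (euler :: complex
      fps)"
      unfolding tendsto_fps_iff
    proof
      fix n
      show "\<forall>\<^sub>F N in sequentially. (\<Prod>k<N. 1 - fps_X ^ Suc k) $ n =
        (euler :: complex fps) $ n"
        using eventually_ge_at_top[of n]
        by eventually_elim (rule fps_prod_one_minus_X_power_nth)
    qed
    show "uniform_limit (ball 0 (1 / 2)) (\<lambda>N q. \<Prod>k<N. 1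
      - q ^ Suc k) euler_prod sequentially"
      by (rule uniform_limit_on_subset[OF uniform_limit_euler_prod[of "1 / 2"]]) auto
    show "\<forall>\<^sub>F N in sequentially. (\<lambda>q. \<Prod>k<N. 1
      - q ^ Suc k :: complex) has_fps_expansion (\<Prod>k<N. 1 - fps_X ^ Suc k)"
      by (intro always_eventually allI fps_expansion_intros)
    show "\<forall>\<^sub>F N in sequentially. (\<lambda>q. \<Prod>k<N. 1
      - q ^ Suc k :: complex) holomorphic_on ball 0 (1 / 2)"
      by (intro always_eventually allI holomorphic_intros)
  qed (use g in auto)
  with g show ?thesis by simp
qed

definition eprod_fun :: "(nat \<times> nat) list \<Rightarrow> complex \<Rightarrow> complex"
  where
  "eprod_fun us q = (\<Prod>(d, k)\<leftarrow>us. euler_prod (q ^ d) ^ k)"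

lemma eprod_fun_Nil [simp]: "eprod_fun [] = (\<lambda>q. 1)"
  and eprod_fun_Cons: "eprod_fun ((d, k) # us) = (\<lambda>q. euler_prod (q ^ d) ^ k * eprod_fun
    us q)"
  by (simp_all add: eprod_fun_def fun_eq_iff)

text \<open>Nonvanishing is carried along with holomorphy, so that the function may also stand in a
  denominator on the whole unit disc.\<close>

lemma eprod_fun_expansion:
  "\<forall>u\<in>set us. fst u > 0 \<Longrightarrow> eprod_fun us has_fps_expansion eprod us
    \<and>
     eprod_fun us holomorphic_on ball 0 1 \<and> (\<forall>q\<in>ball 0 1. eprod_fun us q
       \<noteq> 0)"
proof (induction us)
  case (Cons u us)
  obtain d k where u: "u = (d, k)" by fastforce
  with Cons.prems have d: "d > 0" by simp
  have "(euler_prod \<circ> (\<lambda>q. q ^ d)) has_fps_expansion dil d euler"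
    by (intro has_fps_expansion_compose euler_prod_has_fps_expansion
      has_fps_expansion_fps_X_power)
       (use d in simp)
  moreover have "euler_prod \<circ> (\<lambda>q. q ^ d) holomorphic_on ball 0 1"
    by (rule holomorphic_on_compose_gen[OF _ holomorphic_euler_prod])
       (use d in \<open>auto intro!: holomorphic_intros simp: norm_power_less_1\<close>)
  moreover have "euler_prod (q ^ d) \<noteq> 0" if "norm q < 1" for q
    using that d by (intro euler_prod_nonzero norm_power_less_1)
  ultimately show ?case
    using Cons d unfolding u eprod_fun_Cons eprod_Cons
    by (auto intro!: fps_expansion_intros holomorphic_intros simp: o_def)
qed (auto intro!: fps_expansion_intros)

lemma etaq_sums:
  assumes us: "\<forall>u\<in>set us. fst u > 0" and vs: "\<forall>u\<in>set vs. fst u > 0" and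
    q: "norm q < 1"
  shows "(\<lambda>n. etaq m us vs $ n * q ^ n) sums (q ^ m * (eprod_fun us q / eprod_fun vs q))"
proof -
  define f where "f = (\<lambda>q. q ^ m * (eprod_fun us q * inverse (eprod_fun vs q)))"
  have "f has_fps_expansion etaq m us vs"
    unfolding f_def etaq_def
    using eprod_fun_expansion[OF us] eprod_fun_expansion[OF vs] eprod_nth_0[OF vs, where 'a =
      complex]
    by (intro has_fps_expansion_mult has_fps_expansion_inverse has_fps_expansion_fps_X_power) auto
  moreover have "f holomorphic_on eball 0 1"
    unfolding f_def using eprod_fun_expansion[OF us] eprod_fun_expansion[OF vs]
    by (auto intro!: holomorphic_intros simp: one_ereal_def)
  ultimately have "(\<lambda>n. etaq m us vs $ n * q ^ n) sums f q"
    by (rule has_fps_expansion_imp_sums_complex) (use q in \<open>simp add: one_ereal_def\<close>)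
  then show ?thesis by (simp add: f_def divide_inverse)
qed

section \<open>From the unit disc to the upper half-plane\<close>

lemma norm_nome: "norm (nome z) = exp (- (2 * pi * Im z))"
  by (simp add: nome_def)

lemma nome_surj:
  assumes "w \<noteq> 0" "norm w < 1"
  obtains z where "Im z > 0" "nome z = w"
proof
  define z where "z = Ln w / (2 * of_real pi * \<i>)"
  have "2 * of_real pi * \<i> * z = Ln w" by (simp add: z_def)
  then show nz: "nome z = w" using assms by (simp add: nome_def)
  have "norm w > 0" using assms by simp
  have "exp (- (2 * pi * Im z)) < exp 0"
    using norm_nome[of z] assms nz by simp
  then show "Im z > 0"
    by (simp only: exp_less_cancel_iff) (simp add: zero_less_mult_iff)
qed

text \<open>Justifies the definite description in \<open>q_coeff\<close>: \<open>nome\<close> maps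
  the upper half-plane onto the punctured unit disc, so two admissible sequences define power series
  that agree near 0 and hence coincide.\<close>

lemma q_coeff_eqI:
  fixes c :: "nat \<Rightarrow> int"
  assumes c0: "c 0 = 0"
    and sums: "\<And>z. Im z > 0 \<Longrightarrow> (\<lambda>n. of_int (c n) * nome z ^ n) sums f
      z"
  shows "q_coeff f = c"
proof -
  let ?P = "\<lambda>c :: nat \<Rightarrow> int. c 0 = 0 \<and>
    (\<forall>z. Im z > 0 \<longrightarrow> (\<lambda>n. of_int (c (Suc n)) * nome z ^ Suc n)
      sums f z)"
  have shift: "(\<lambda>n. of_int (b (Suc n)) * nome z ^ Suc n) sums s \<longleftrightarrow>
    (\<lambda>n. of_int (b n) * nome z ^ n) sums s"
    if "b 0 = 0" for b :: "nat \<Rightarrow> int" and z s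
    using sums_Suc_iff[of "\<lambda>n. of_int (b n) * nome z ^ n" s] that by simp
  have "b = c" if b: "?P b" for b
  proof -
    define F G where "F = Abs_fps (\<lambda>n. of_int (b n) :: complex)" and "G =
      Abs_fps (\<lambda>n. of_int (c n) :: complex)"
    have F: "(\<lambda>n. F $ n * nome z ^ n) sums f z" if "Im z > 0" for z
      using b shift[of b z "f z"] that by (simp add: F_def)
    have G: "(\<lambda>n. G $ n * nome z ^ n) sums f z" if "Im z > 0" for z
      using sums that by (simp add: G_def)
    \<comment> \<open>Convergence at this single point already forces a positive radius of
      convergence.\<close>
    obtain z where z: "Im z > 0" "nome z = 1 / 2"
      using nome_surj[of "1 / 2"] by (auto simp: norm_divide)
    have "summable (\<lambda>n. fps_nth F n * (1 / 2) ^ n)" "summable (\<lambda>n. fps_nth G n *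
      (1 / 2) ^ n)"
      using F[OF z(1)] G[OF z(1)] unfolding z(2) by (auto simp: sums_iff)
    then have "fps_conv_radius F \<ge> norm (1 / 2 :: complex)" "fps_conv_radius G \<ge> norm (1
      / 2 :: complex)"
      unfolding fps_conv_radius_def by (blast intro: conv_radius_geI)+
    then have r: "fps_conv_radius F > 0" "fps_conv_radius G > 0"
      by (auto simp: norm_divide intro: less_le_trans[of 0 "ereal (1 / 2)"])
    have "eventually (\<lambda>w. eval_fps F w = eval_fps G w) (nhds 0)"
    proof (rule eventually_mono)
      show "eventually (\<lambda>w :: complex. w \<in> ball 0 1) (nhds 0)"
        by (rule eventually_nhds_in_open) auto
      fix w :: complex assume w: "w \<in> ball 0 1"
      show "eval_fps F w = eval_fps G w"
      \<comment> \<open>0 is not a value of \<open>nome\<close>; there the agreement comes from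
        \<open>b 0 = c 0 = 0\<close>.\<close>
      proof (cases "w = 0")
        case True
        then show ?thesis using b c0 by (simp add: eval_fps_at_0 F_def G_def)
      next
        case False
        with w obtain z where "Im z > 0" "nome z = w" using nome_surj[of w] by auto
        with F[of z] G[of z] show ?thesis by (simp add: eval_fps_def sums_iff)
      qed
    qed
    then have "eval_fps F has_fps_expansion G"
      using has_fps_expansion_cong eval_fps_has_fps_expansion[OF r(2)] by blast
    then have "F = G"
      using eval_fps_has_fps_expansion[OF r(1)] by (rule fps_expansion_unique_complex[rotated])
    then show "b = c"
      by (auto simp: F_def G_def fps_eq_iff)
  qed
  moreover have "?P c"
    using c0 sums shift[of c] by simp
  ultimately show ?thesis
    unfolding q_coeff_def by (intro the_equality) blast+
qed

definition etaprod :: "(nat \<times> nat) list \<Rightarrow> complex \<Rightarrow> complex" where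
  "etaprod us z = (\<Prod>(d, k)\<leftarrow>us. dedekind_eta (of_nat d * z) ^ k)"

text \<open>All 24th roots of \<open>q\<close> are gathered into one power of
  \<open>nome (z / 24)\<close>, so that no fractional exponent and no choice of a branch
  arises.\<close>

lemma etaprod_eq:
  "etaprod us z = nome (z / 24) ^ (\<Sum>(d, k)\<leftarrow>us. d * k) * eprod_fun us (nome z)"
proof (induction us)
  case (Cons u us)
  obtain d k where u: "u = (d, k)" by fastforce
  have "nome (of_nat d * z) = nome z ^ d" "nome (of_nat d * z / 24) = nome (z / 24) ^ d"
    by (simp_all add: nome_def exp_of_nat_mult[symmetric] algebra_simps)
  then have "dedekind_eta (of_nat d * z) = nome (z / 24) ^ d * euler_prod (nome z ^ d)"
    by (simp add: dedekind_eta_def euler_prod_def)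
  then show ?case
    using Cons by (simp add: u etaprod_def eprod_fun_Cons power_mult_distrib power_mult power_add)
qed (simp add: etaprod_def)

text \<open>By \<open>deg\<close> the powers of \<open>nome (z / 24)\<close> in numerator and
  denominator leave exactly \<open>q^m\<close>, and \<open>m > 0\<close> makes the constant
  coefficient 0, as prescribed in \<open>q_coeff\<close>.\<close>

lemma q_coeff_etaq:
  assumes us: "\<forall>u\<in>set us. fst u > 0" and vs: "\<forall>u\<in>set vs. fst u > 0" and
    m: "m > 0"
    and deg: "(\<Sum>(d, k)\<leftarrow>us. d * k) = 24 * m + (\<Sum>(d, k)\<leftarrow>vs. d * k)"
    and f: "\<And>z. f z = etaprod us z / etaprod vs z"
  shows "of_int (q_coeff f n) = (etaq m us vs $ n :: real)"
proof -
  define E where "E = etaq_int m us vs"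
  have E: "etaq m us vs = (of_int_fps E :: real fps)" "etaq m us vs =
    (of_int_fps E :: complex fps)"
    using vs by (simp_all add: E_def of_int_fps_etaq_int)
  have "q_coeff f = (\<lambda>n. E $ n)"
  proof (rule q_coeff_eqI)
    have "etaq m us vs $ 0 = (0 :: real)" using m by (simp add: etaq_def)
    then show "E $ 0 = 0" unfolding E(1) by simp
    fix z assume z: "Im z > 0"
    then have "norm (nome z) < 1" unfolding norm_nome by simp
    then have "(\<lambda>n. of_int (E $ n) * nome z ^ n) sums (nome z ^ m * (eprod_fun us (nome
      z) / eprod_fun vs (nome z)))"
      using etaq_sums[OF us vs, of "nome z" m] unfolding E(2) by simp
    also have "nome z ^ m * (eprod_fun us (nome z) / eprod_fun vs (nome z)) = f z"
    proof -
      have "nome z ^ m = nome (z / 24) ^ (24 * m)"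
        by (simp add: nome_def exp_of_nat_mult[symmetric] algebra_simps)
      moreover have "nome (z / 24) \<noteq> 0" by (simp add: nome_def)
      ultimately show ?thesis
        unfolding f etaprod_eq deg by (simp add: power_add)
    qed
    finally show "(\<lambda>n. of_int (E $ n) * nome z ^ n) sums f z" .
  qed
  then show ?thesis unfolding E(1) by simp
qed

section \<open>The convolution sums\<close>

lemma dil_eis_nth:
  assumes "d > 0" "n > 0"
  shows "dil d (eis k) $ n = real (divisor_sigma k (real n / real d))"
proof (cases "d dvd n")
  case True
  then obtain m where "n = d * m" by auto
  with assms show ?thesis by (simp add: dil_nth divisor_sigma_def eis_nth)
next
  case False
  have "real n / real d \<notin> \<nat>"
  proof
    assume "real n / real d \<in> \<nat>"
    then obtain m where "real n / real d = real m" by (auto elim: Nats_cases)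
    with assms have "real n = real (m * d)" by (simp add: field_simps)
    then have "n = m * d" by linarith
    with False show False by simp
  qed
  with False show ?thesis by (simp add: dil_nth divisor_sigma_def)
qed

text \<open>A summand of the Cauchy product survives only for \<open>i = a l\<close> and
  \<open>n - i = b m\<close>. The ends \<open>i = 0\<close> and \<open>i = n\<close> vanish with the
  constant coefficient of \<open>eis 1\<close>, which matches the positivity of \<open>l\<close> and
  \<open>m\<close>.\<close>

lemma W_eq:
  assumes "a > 0" "b > 0"
  shows "real (W a b n) = (dil a (eis 1) * dil b (eis 1)) $ n"
proof -
  have "(dil a (eis 1) * dil b (eis 1)) $ n =
      (\<Sum>i\<in>{i\<in>{0..n}. 0 < i \<and> i < n \<and> a dvd i \<and> b dvd n
        - i}. dil a (eis 1) $ i * dil b (eis 1) $ (n - i))"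
    unfolding fps_mult_nth by (rule sum.mono_neutral_right) (auto simp: dil_nth intro!: Nat.gr0I
      le_neq_implies_less)
  also have "\<dots> = (\<Sum>(l, m)\<in>{(l, m). l > 0 \<and> m > 0 \<and> a * l + b * m =
    n}. eis 1 $ l * eis 1 $ m)"
  proof (rule sum.reindex_bij_witness[where j = "\<lambda>i. (i div a, (n - i) div b)" and i =
    "\<lambda>(l, m). a * l"])
    fix i assume "i \<in> {i\<in>{0..n}. 0 < i \<and> i < n \<and> a dvd i \<and> b dvd n - i}"
    then have "0 < i" "i < n" "a dvd i" "b dvd n - i" by auto
    then obtain l m where lm: "i = a * l" "n - i = b * m" by (auto elim!: dvdE)
    with \<open>0 < i\<close> \<open>i < n\<close> have "l > 0" "m > 0" by (auto intro!: Nat.gr0I)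
    moreover have "a * l + b * m = n" using lm \<open>i < n\<close> by simp
    ultimately show "(i div a, (n - i) div b) \<in> {(l, m). l > 0 \<and> m > 0 \<and> a * l
      + b * m = n}"
      using lm assms by simp
    show "(case (i div a, (n - i) div b) of (l, m) \<Rightarrow> a * l) =
      i" using lm assms by simp
    show "(case (i div a, (n - i) div b) of (l, m) \<Rightarrow> eis 1 $ l * eis 1 $ m) =
        dil a (eis 1) $ i * dil b (eis 1) $ (n - i)"
      using lm by (simp add: dil_nth)
  next
    fix p assume "p \<in> {(l, m). l > 0 \<and> m > 0 \<and> a * l + b * m = n}"
    then obtain l m where p: "p = (l, m)" "l > 0" "m > 0" "a * l + b * m = n" by auto
    then have "n - a * l = b * m" "0 < a * l" "0 < b * m" using assms by auto
    then show "(case p of (l, m) \<Rightarrow> a * l) \<in> {i\<in>{0..n}. 0 < i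
      \<and> i < n \<and> a dvd i \<and> b dvd n - i}"
      and "((case p of (l, m) \<Rightarrow> a * l) div a, (n
        - (case p of (l, m) \<Rightarrow> a * l)) div b) = p"
      using p assms by auto
  qed
  also have "\<dots> = real (W a b n)"
    unfolding W_def of_nat_sum
    by (rule sum.cong) (use dil_eis_nth[of 1] in auto)
  finally show ?thesis ..
qed

lemma q_coeff_C1: "of_int (q_coeff C1 n) = (qC1 $ n :: real)"
  unfolding qC1_def by (rule q_coeff_etaq) (simp_all add: C1_def etaprod_def)

lemma q_coeff_C2: "of_int (q_coeff C2 n) = (qC2 $ n :: real)"
  unfolding qC2_def by (rule q_coeff_etaq) (simp_all add: C2_def etaprod_def)

lemma q_coeff_C3: "of_int (q_coeff C3 n) = (qC3 $ n :: real)"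
  unfolding qC3_def by (rule q_coeff_etaq) (simp_all add: C3_def etaprod_def)

lemma q_coeff_C4: "of_int (q_coeff C4 n) = (qC4 $ n :: real)"
  unfolding qC4_def by (rule q_coeff_etaq) (simp_all add: C4_def etaprod_def)

lemma q_coeff_C5: "of_int (q_coeff C5 n) = (qC5 $ n :: real)"
  unfolding qC5_def by (rule q_coeff_etaq) (simp_all add: C5_def etaprod_def)

lemma q_coeff_C6: "of_int (q_coeff C6 n) = (qC6 $ n :: real)"
  unfolding qC6_def by (rule q_coeff_etaq) (simp_all add: C6_def etaprod_def)

lemma q_coeff_C7: "of_int (q_coeff C7 n) = (qC7 $ n :: real)"
  unfolding qC7_def by (rule q_coeff_etaq) (simp_all add: C7_def etaprod_def)

lemma q_coeff_C8: "of_int (q_coeff C8 n) = (qC8 $ n :: real)"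
  unfolding qC8_def by (rule q_coeff_etaq) (simp_all add: C8_def etaprod_def)

lemma q_coeff_C9: "of_int (q_coeff C9 n) = (qC9 $ n :: real)"
  unfolding qC9_def by (rule q_coeff_etaq) (simp_all add: C9_def etaprod_def)

lemmas q_coeff_simps = q_coeff_C1 q_coeff_C2 q_coeff_C3 q_coeff_C4 q_coeff_C5 q_coeff_C6
  q_coeff_C7 q_coeff_C8 q_coeff_C9

lemma dil_eis_nth_28:
  assumes "n > 0"
  shows
  "dil 1 (eis k) $ n = real (divisor_sigma k (real n))"
  "dil 2 (eis k) $ n = real (divisor_sigma k (real n / 2))"
  "dil 4 (eis k) $ n = real (divisor_sigma k (real n / 4))"
  "dil 7 (eis k) $ n = real (divisor_sigma k (real n / 7))"
  "dil 14 (eis k) $ n = real (divisor_sigma k (real n / 14))"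
  "dil 28 (eis k) $ n = real (divisor_sigma k (real n / 28))"
  using assms dil_eis_nth[of 1] dil_eis_nth[of 2] dil_eis_nth[of 4] dil_eis_nth[of 7]
    dil_eis_nth[of 14] dil_eis_nth[of 28] by simp_all

theorem theorem3p1:
  fixes n :: nat
  assumes "n > 0"
  shows "real (W 1 28 n) =
       1 / 2400 * divisor_sigma 3 (real n) + 1 / 800 * divisor_sigma 3 (real n / 2)
       + 1 / 150 * divisor_sigma 3 (real n / 4) + 49 / 2400 * divisor_sigma 3 (real n / 7)
       + 49 / 800 * divisor_sigma 3 (real n / 14) + 49 / 150 * divisor_sigma 3 (real n / 28)
       + (1 / 24 - real n / 112) * divisor_sigma 1 (real n)
       + (1 / 24 - real n / 4) * divisor_sigma 1 (real n / 28)
       + 1121 / 67200 * q_coeff C1 n + 2389 / 22400 * q_coeff C2 n - 1 / 128 * q_coeff C3 n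
       - 3349 / 67200 * q_coeff C4 n - 101 / 200 * q_coeff C5 n - 17 / 40 * q_coeff C6 n
       + 13 / 200 * q_coeff C7 n - 433 / 150 * q_coeff C8 n - 254 / 75 * q_coeff C9 n \<and>
     real (W 4 7 n) =
       1 / 2400 * divisor_sigma 3 (real n) + 1 / 800 * divisor_sigma 3 (real n / 2)
       + 1 / 150 * divisor_sigma 3 (real n / 4) + 49 / 2400 * divisor_sigma 3 (real n / 7)
       + 49 / 800 * divisor_sigma 3 (real n / 14) + 49 / 150 * divisor_sigma 3 (real n / 28)
       + (1 / 24 - real n / 28) * divisor_sigma 1 (real n / 4)
       + (1 / 24 - real n / 16) * divisor_sigma 1 (real n / 7)
       + 697 / 470400 * q_coeff C1 n + 139 / 22400 * q_coeff C2 n - 9 / 896 * q_coeff C3 n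
       - 893 / 470400 * q_coeff C4 n + 43 / 1400 * q_coeff C5 n - 7 / 40 * q_coeff C6 n
       + 241 / 1400 * q_coeff C7 n - 881 / 1050 * q_coeff C8 n - 178 / 525 * q_coeff C9 n \<and>
     real (W 1 14 n) =
       1 / 600 * divisor_sigma 3 (real n) + 1 / 150 * divisor_sigma 3 (real n / 2)
       + 49 / 600 * divisor_sigma 3 (real n / 7) + 49 / 150 * divisor_sigma 3 (real n / 14)
       + (1 / 24 - real n / 56) * divisor_sigma 1 (real n)
       + (1 / 24 - real n / 4) * divisor_sigma 1 (real n / 14)
       + 2 / 175 * q_coeff C2 n - 1 / 600 * q_coeff C3 n - 107 / 4200 * q_coeff C4 n \<and>
     real (W 2 7 n) =
       1 / 600 * divisor_sigma 3 (real n) + 1 / 150 * divisor_sigma 3 (real n / 2)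
       + 49 / 600 * divisor_sigma 3 (real n / 7) + 49 / 150 * divisor_sigma 3 (real n / 14)
       + (1 / 24 - real n / 28) * divisor_sigma 1 (real n / 2)
       + (1 / 24 - real n / 8) * divisor_sigma 1 (real n / 7)
       + 2 / 175 * q_coeff C2 n - 107 / 4200 * q_coeff C3 n - 1 / 600 * q_coeff C4 n \<and>
     real (W 1 7 n) =
       1 / 120 * divisor_sigma 3 (real n) + 49 / 120 * divisor_sigma 3 (real n / 7)
       + (1 / 24 - real n / 28) * divisor_sigma 1 (real n)
       + (1 / 24 - real n / 4) * divisor_sigma 1 (real n / 7)
       - 1 / 70 * q_coeff C1 n - 2 / 35 * q_coeff C2 n"
proof (intro conjI, goal_cases)
  case 1
  show ?case
    \<comment> \<open>The derivatives contribute the factor \<open>n\<close>. After expanding the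
      differences, each product of \<open>n\<close> with a divisor sum counts as one unknown, so
      only division by the common denominator remains, which is linear arithmetic.\<close>
    using arg_cong[OF conv_1_28, of "\<lambda>f. f $ n"] W_eq[of 1 28 n]
    unfolding fps_add_nth fps_sub_nth fps_numeral_mult_nth XD_nth q_coeff_simps
      dil_eis_nth_28[OF assms] left_diff_distrib
    by linarith
next
  case 2
  show ?case
    using arg_cong[OF conv_4_7, of "\<lambda>f. f $ n"] W_eq[of 4 7 n]
    unfolding fps_add_nth fps_sub_nth fps_numeral_mult_nth XD_nth q_coeff_simps
      dil_eis_nth_28[OF assms] left_diff_distrib
    by linarith
next
  case 3
  show ?case
    using arg_cong[OF conv_1_14, of "\<lambda>f. f $ n"] W_eq[of 1 14 n]
    unfolding fps_add_nth fps_sub_nth fps_numeral_mult_nth XD_nth q_coeff_simps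
      dil_eis_nth_28[OF assms] left_diff_distrib
    by linarith
next
  case 4
  show ?case
    using arg_cong[OF conv_2_7, of "\<lambda>f. f $ n"] W_eq[of 2 7 n]
    unfolding fps_add_nth fps_sub_nth fps_numeral_mult_nth XD_nth q_coeff_simps
      dil_eis_nth_28[OF assms] left_diff_distrib
    by linarith
next
  case 5
  show ?case
    using arg_cong[OF conv_1_7, of "\<lambda>f. f $ n"] W_eq[of 1 7 n]
    unfolding fps_add_nth fps_sub_nth fps_numeral_mult_nth XD_nth q_coeff_simps
      dil_eis_nth_28[OF assms] left_diff_distrib
    by linarith
qed

end
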